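(* Let $f:(0,+\infty)\to\mathbb R$ and $\kappa:(0,+\infty)\to(0,+\infty)$ be smooth (at least $C^2$), $e(v,v_y)=f(v)+\tfrac12\kappa(v)v_y^2$ and $\mathcal E(\rho,\rho_x)=\rho\,e(1/\rho,-\rho_x/\rho^3)$. Assume that $(\underline\rho,\underline u)$ and $(\underline v,\underline w)$ are corresponding nonconstant periodic solutions, of periods $\Xi$ and $\Upsilon$, to respectively $$\begin{cases}\mathsf E\mathcal E[\underline\rho]+\tfrac12\underline u^2-\sigma\underline u=-\lambda,\\ \underline\rho\,\underline u-\sigma\underline\rho=j,\\ \mathsf L\mathcal E[\underline\rho]-\tfrac12\underline\rho\,\underline u^2+\sigma\underline\rho\,\underline u-\lambda\underline\rho+j\underline u=\mu,\end{cases}\qquad\begin{cases}\mathsf Ee[\underline v]-j\underline w=-\mu,\\ \underline w-j\underline v=\sigma,\\ \mathsf Le[\underline v]-\tfrac12\underline w^2+j\underline v\,\underline w-\mu\underline v+\sigma\underline w=\lambda,\end{cases}$$ depending smoothly on the parameters $(\mu,\lambda,j,\sigma)$, as well as their periods $\Xi$ and $\Upsilon$. If $\Theta_{\mu\mu}\neq0$, $\Theta_{\lambda\lambda}\neq0$, and the matrices $C_E$ and $C_L$ are nonsingular, then $$\mathsf n(\mathrm{Hess}\,\Theta)-2=\mathsf n(\mathbf A_E)-\mathsf n(C_E)=\mathsf n(\mathbf A_L)-\mathsf n(C_L).$$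
   Context: Notation: $\mathsf E\mathcal E[\rho]=\partial_\rho\mathcal E-\mathrm D_x(\partial_{\rho_x}\mathcal E)$, $\mathsf L\mathcal E[\rho]=\rho_x\partial_{\rho_x}\mathcal E-\mathcal E$, and similarly for $e$ in the variable $y$; $\mathrm{Hess}\,\mathcal E[\underline\rho]$, $\mathrm{Hess}\,e[\underline v]$ are the second variational derivatives (scalar self-adjoint second-order differential operators, e.g. $\mathrm{Hess}\,e[\underline v]h=-\partial_y(\kappa(\underline v)h_y)+(f''(\underline v)+\tfrac12\kappa''(\underline v)\underline v_y^2-\partial_y(\kappa'(\underline v)\underline v_y))h$). The profile systems are those of traveling waves of the Euler–Korteweg system in Eulerian coordinates, $(\rho,u)=(\underline\rho,\underline u)(x-\sigma t)$, and in mass Lagrangian coordinates, $(v,w)=(\underline v,\underline w)(y+jt)$. Densities $\underline\rho$ and volumes $\underline v$ are positive, and the two profiles correspond to each other through $\underline\rho(x)=1/\underline v(\underline Y(x))$, $\underline u(x)=\underline w(\underline Y(x))$, $\underline Y'=\underline\rho$, so that $\Upsilon=\int_0^\Xi\underline\rho\,dx$, $\Xi=\int_0^\Upsilon\underline v\,dy$. Common abbreviated action: $$\Theta(\mu,\lambda,j,\sigma)=\int_0^\Xi(\mathcal E(\underline\rho,\underline\rho_x)+\tfrac12\underline\rho\,\underline u^2-\sigma\underline\rho\,\underline u+\lambda\underline\rho-j\underline u+\mu)\,dx=\int_0^\Upsilon(e(\underline v,\underline v_y)+\tfrac12\underline w^2-j\underline v\,\underline w+\mu\underline v-\sigma\underline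 w+\lambda)\,dy,$$ with $4\times4$ Hessian $\mathrm{Hess}\,\Theta$. Operators: $\mathbf A_E=\begin{pmatrix}\mathrm{Hess}\,\mathcal E[\underline\rho]&j/\underline\rho\\ j/\underline\rho&\underline\rho\end{pmatrix}$ on $(L^2(\mathbb R/\Xi\mathbb Z))^2$ and $\mathbf A_L=\begin{pmatrix}\mathrm{Hess}\,e[\underline v]&-j\\-j&1\end{pmatrix}$ on $(L^2(\mathbb R/\Upsilon\mathbb Z))^2$. Constraint matrices ($3\times3$): $C_E=\frac{1}{\Theta_{\mu\mu}}\nabla_E\Theta_\mu\otimes\nabla_E\Theta_\mu-\nabla_E^2\Theta$ with $\nabla_E$ the gradient with respect to $(\lambda,j,\sigma)$ at fixed $\mu$; $C_L=\frac1{\Theta_{\lambda\lambda}}\nabla_L\Theta_\lambda\otimes\nabla_L\Theta_\lambda-\nabla_L^2\Theta$ with $\nabla_L$ the gradient with respect to $(\mu,\sigma,j)$ at fixed $\lambda$. $\mathsf n(\cdot)$ is the negative signature: number of negative eigenvalues (with multiplicity) of a symmetric matrix or self-adjoint operator, i.e. the dimension of a maximal subspace on which the quadratic form is negative definite. *)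

theory Defs
  imports "HOL-Analysis.Analysis" "HOL-Library.Function_Algebras"
begin

definition C2_on :: "real set \<Rightarrow> (real \<Rightarrow> real) \<Rightarrow> bool" where
  "C2_on S f \<longleftrightarrow>
     (\<exists>f' f''. (\<forall>x\<in>S. (f has_real_derivative f' x) (at x) \<and> (f' has_real_derivative f'' x) (at x)) \<and>
              continuous_on S f'')"

definition C1_on :: "'a::real_normed_vector set \<Rightarrow> ('a \<Rightarrow> 'b::real_normed_vector) \<Rightarrow> bool" where
  "C1_on S F \<longleftrightarrow>
     (\<exists>F' :: 'a \<Rightarrow> 'a \<Rightarrow>\<^sub>L 'b.
        (\<forall>z\<in>S. (F has_derivative blinfun_apply (F' z)) (at z)) \<and> continuous_on S F')"

text \<open>An energy density is a function \<open>E q r\<close> of a field \<open>q\<close> and of its space derivative \<open>r\<close>.\<close>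

definition lagr_energy :: "(real \<Rightarrow> real) \<Rightarrow> (real \<Rightarrow> real) \<Rightarrow> real \<Rightarrow> real \<Rightarrow> real" where
  "lagr_energy f \<kappa> v vy = f v + \<kappa> v * vy\<^sup>2 / 2"

definition euler_energy :: "(real \<Rightarrow> real) \<Rightarrow> (real \<Rightarrow> real) \<Rightarrow> real \<Rightarrow> real \<Rightarrow> real" where
  "euler_energy f \<kappa> \<rho> \<rho>x = \<rho> * lagr_energy f \<kappa> (1 / \<rho>) (- \<rho>x / \<rho> ^ 3)"

definition pd1 :: "(real \<Rightarrow> real \<Rightarrow> real) \<Rightarrow> real \<Rightarrow> real \<Rightarrow> real" where
  "pd1 E q r = deriv (\<lambda>s. E s r) q"

definition pd2 :: "(real \<Rightarrow> real \<Rightarrow> real) \<Rightarrow> real \<Rightarrow> real \<Rightarrow> real" where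
  "pd2 E q r = deriv (\<lambda>s. E q s) r"

definition along :: "(real \<Rightarrow> real \<Rightarrow> real) \<Rightarrow> (real \<Rightarrow> real) \<Rightarrow> real \<Rightarrow> real" where
  "along F q x = F (q x) (deriv q x)"

definition Euler_op :: "(real \<Rightarrow> real \<Rightarrow> real) \<Rightarrow> (real \<Rightarrow> real) \<Rightarrow> real \<Rightarrow> real" where
  "Euler_op E q x = along (pd1 E) q x - deriv (along (pd2 E) q) x"

definition Legendre_op :: "(real \<Rightarrow> real \<Rightarrow> real) \<Rightarrow> (real \<Rightarrow> real) \<Rightarrow> real \<Rightarrow> real" where
  "Legendre_op E q x = deriv q x * along (pd2 E) q x - along E q x"

definition is_period :: "real \<Rightarrow> (real \<Rightarrow> 'a) \<Rightarrow> bool" where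
  "is_period T U \<longleftrightarrow> (\<forall>x. U (x + T) = U x)"

definition fundamental_period :: "real \<Rightarrow> (real \<Rightarrow> 'a) \<Rightarrow> bool" where
  "fundamental_period T U \<longleftrightarrow> 0 < T \<and> is_period T U \<and> (\<forall>S. 0 < S \<and> S < T \<longrightarrow> \<not> is_period S U)"

definition eulerian_wave ::
  "(real \<Rightarrow> real \<Rightarrow> real) \<Rightarrow> real \<Rightarrow> real \<Rightarrow> real \<Rightarrow> real \<Rightarrow> (real \<Rightarrow> real) \<Rightarrow> (real \<Rightarrow> real) \<Rightarrow> real \<Rightarrow> bool"
where
  "eulerian_wave E \<mu> l j \<sigma> \<rho> u \<Xi> \<longleftrightarrow>
     C2_on UNIV \<rho> \<and> (\<forall>x. 0 < \<rho> x) \<and>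
     \<not> (\<lambda>x. (\<rho> x, u x)) constant_on UNIV \<and> fundamental_period \<Xi> (\<lambda>x. (\<rho> x, u x)) \<and>
     (\<forall>x. Euler_op E \<rho> x + (u x)\<^sup>2 / 2 - \<sigma> * u x = - l \<and>
          \<rho> x * u x - \<sigma> * \<rho> x = j \<and>
          Legendre_op E \<rho> x - \<rho> x * (u x)\<^sup>2 / 2 + \<sigma> * \<rho> x * u x - l * \<rho> x + j * u x = \<mu>)"

definition lagrangian_wave ::
  "(real \<Rightarrow> real \<Rightarrow> real) \<Rightarrow> real \<Rightarrow> real \<Rightarrow> real \<Rightarrow> real \<Rightarrow> (real \<Rightarrow> real) \<Rightarrow> (real \<Rightarrow> real) \<Rightarrow> real \<Rightarrow> bool"
where
  "lagrangian_wave e \<mu> l j \<sigma> v w \<Upsilon> \<longleftrightarrow>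
     C2_on UNIV v \<and> (\<forall>y. 0 < v y) \<and>
     \<not> (\<lambda>y. (v y, w y)) constant_on UNIV \<and> fundamental_period \<Upsilon> (\<lambda>y. (v y, w y)) \<and>
     (\<forall>y. Euler_op e v y - j * w y = - \<mu> \<and>
          w y - j * v y = \<sigma> \<and>
          Legendre_op e v y - (w y)\<^sup>2 / 2 + j * v y * w y - \<mu> * v y + \<sigma> * w y = l)"

definition corresponding ::
  "(real \<Rightarrow> real) \<Rightarrow> (real \<Rightarrow> real) \<Rightarrow> (real \<Rightarrow> real) \<Rightarrow> (real \<Rightarrow> real) \<Rightarrow> bool" where
  "corresponding \<rho> u v w \<longleftrightarrow>
     (\<exists>Y. \<forall>x. (Y has_real_derivative \<rho> x) (at x) \<and> \<rho> x = 1 / v (Y x) \<and> u x = w (Y x))"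

text \<open>Profiles are solutions of ODEs whose right-hand sides are of class \<open>C\<^sup>1\<close> when \<open>f\<close> and \<open>\<kappa>\<close> are
  of class \<open>C\<^sup>2\<close>; smoothness of a family of profiles \<open>q p\<close>, \<open>z p\<close> is therefore asked
  for in the form: profile, its space derivative and its velocity are jointly \<open>C\<^sup>1\<close> in parameters
  and space, and the period is \<open>C\<^sup>1\<close> in the parameters.\<close>

definition smooth_family ::
  "(real^4) set \<Rightarrow> (real^4 \<Rightarrow> real \<Rightarrow> real) \<Rightarrow> (real^4 \<Rightarrow> real \<Rightarrow> real) \<Rightarrow> (real^4 \<Rightarrow> real) \<Rightarrow> bool" where
  "smooth_family \<Omega> q z T \<longleftrightarrow>
     C1_on (\<Omega> \<times> UNIV) (\<lambda>(p, x). (q p x, deriv (q p) x, z p x)) \<and> C1_on \<Omega> T"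

text \<open>Parameters are ordered as \<open>p = (\<mu>, \<lambda>, j, \<sigma>)\<close>, with indices \<open>1, 2, 3, 4\<close>.\<close>

definition action ::
  "(real \<Rightarrow> real \<Rightarrow> real) \<Rightarrow> (real^4 \<Rightarrow> real \<Rightarrow> real) \<Rightarrow> (real^4 \<Rightarrow> real \<Rightarrow> real) \<Rightarrow> (real^4 \<Rightarrow> real) \<Rightarrow>
   real^4 \<Rightarrow> real" where
  "action E \<rho> u \<Xi> p =
     integral {0..\<Xi> p} (\<lambda>x. E (\<rho> p x) (deriv (\<rho> p) x) + \<rho> p x * (u p x)\<^sup>2 / 2
        - p $ 4 * \<rho> p x * u p x + p $ 2 * \<rho> p x - p $ 3 * u p x + p $ 1)"

definition partial :: "'n \<Rightarrow> (real^'n \<Rightarrow> real) \<Rightarrow> real^'n \<Rightarrow> real" where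
  "partial i F p = deriv (\<lambda>t. F (p + t *\<^sub>R axis i 1)) 0"

definition Hessian :: "(real^'n \<Rightarrow> real) \<Rightarrow> real^'n \<Rightarrow> real^'n^'n" where
  "Hessian F p = (\<chi> i k. partial i (partial k F) p)"

text \<open>\<open>s\<close> lists the parameters that vary while the parameter of index \<open>m\<close> is fixed.\<close>

definition constraint_matrix :: "real^4^4 \<Rightarrow> 4 \<Rightarrow> 4^3 \<Rightarrow> real^3^3" where
  "constraint_matrix H m s =
     (\<chi> a b. H $ m $ (s $ a) * H $ m $ (s $ b) / H $ m $ m - H $ (s $ a) $ (s $ b))"

definition constraint_E :: "real^4^4 \<Rightarrow> real^3^3" where
  "constraint_E H = constraint_matrix H 1 (vector [2, 3, 4])"

definition constraint_L :: "real^4^4 \<Rightarrow> real^3^3" where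
  "constraint_L H = constraint_matrix H 2 (vector [1, 4, 3])"

instantiation "fun" :: (type, real_vector) real_vector
begin

definition scaleR_fun :: "real \<Rightarrow> ('a \<Rightarrow> 'b) \<Rightarrow> 'a \<Rightarrow> 'b" where
  "scaleR_fun c U = (\<lambda>x. c *\<^sub>R U x)"

instance
  by standard (simp_all add: scaleR_fun_def fun_eq_iff scaleR_add_right scaleR_add_left)

end

text \<open>The largest dimension of a subspace of \<open>D\<close> on which \<open>Q\<close> is negative definite. It is
  \<open>ereal\<close>-valued so that it is \<open>\<infinity>\<close> when these dimensions are unbounded.\<close>

definition neg_signature :: "'a::real_vector set \<Rightarrow> ('a \<Rightarrow> real) \<Rightarrow> ereal" where
  "neg_signature D Q =
     (SUP B \<in> {B. finite B \<and> independent B \<and> span B \<subseteq> D \<and> (\<forall>U \<in> span B - {0}. Q U < 0)}.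
        ereal (real (card B)))"

definition neg_signature_matrix :: "real^'n^'n \<Rightarrow> ereal" where
  "neg_signature_matrix M = neg_signature UNIV (\<lambda>x. x \<bullet> (M *v x))"

text \<open>Elements of \<open>(L\<^sup>2(\<real>/T\<int>))\<^sup>2\<close> are represented by functions rather than by classes modulo null sets.
  This does not affect the negative signature: the quadratic form vanishes on null functions,
  so a negative definite space of functions contains no nonzero null function.\<close>

definition neg_signature_operator ::
  "real \<Rightarrow> (real \<Rightarrow> real \<times> real) set \<Rightarrow> ((real \<Rightarrow> real \<times> real) \<Rightarrow> real \<Rightarrow> real \<times> real) \<Rightarrow> ereal" where
  "neg_signature_operator T D A = neg_signature D (\<lambda>U. integral {0..T} (\<lambda>x. A U x \<bullet> U x))"

definition L2_per :: "real \<Rightarrow> (real \<Rightarrow> real) set" where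
  "L2_per T = {h. h \<in> borel_measurable lebesgue \<and> is_period T h \<and>
                  (\<lambda>x. (h x)\<^sup>2) absolutely_integrable_on {0..T}}"

text \<open>\<open>H\<^sup>1(\<real>/T\<int>)\<close> consists of the absolutely continuous periodic functions with derivative in \<open>L\<^sup>2\<close>;
  that derivative is unique up to null sets.\<close>

definition is_weak_deriv :: "real \<Rightarrow> (real \<Rightarrow> real) \<Rightarrow> (real \<Rightarrow> real) \<Rightarrow> bool" where
  "is_weak_deriv T h g \<longleftrightarrow> g \<in> L2_per T \<and> (\<forall>a b. a \<le> b \<longrightarrow> (g has_integral h b - h a) {a..b})"

definition weak_deriv :: "real \<Rightarrow> (real \<Rightarrow> real) \<Rightarrow> real \<Rightarrow> real" where
  "weak_deriv T h = (SOME g. is_weak_deriv T h g)"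

definition H1_per :: "real \<Rightarrow> (real \<Rightarrow> real) set" where
  "H1_per T = {h. is_period T h \<and> (\<exists>g. is_weak_deriv T h g)}"

definition H2_per :: "real \<Rightarrow> (real \<Rightarrow> real) set" where
  "H2_per T = {h. is_period T h \<and> (\<forall>x. h differentiable (at x)) \<and> deriv h \<in> H1_per T}"

text \<open>Linearizing \<open>Euler_op E\<close> at \<open>q\<close> gives
  \<open>E\<^sub>q\<^sub>q h + E\<^sub>q\<^sub>r h\<^sub>x - D\<^sub>x (E\<^sub>q\<^sub>r h + E\<^sub>r\<^sub>r h\<^sub>x) = - D\<^sub>x (E\<^sub>r\<^sub>r h\<^sub>x) + (E\<^sub>q\<^sub>q - D\<^sub>x E\<^sub>q\<^sub>r) h\<close>. The outer derivative
  is a weak one since \<open>h\<close> ranges over \<open>H2_per T\<close>.\<close>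

definition Hess_op ::
  "real \<Rightarrow> (real \<Rightarrow> real \<Rightarrow> real) \<Rightarrow> (real \<Rightarrow> real) \<Rightarrow> (real \<Rightarrow> real) \<Rightarrow> real \<Rightarrow> real" where
  "Hess_op T E q h x =
     - weak_deriv T (\<lambda>s. along (pd2 (pd2 E)) q s * deriv h s) x
     + (along (pd1 (pd1 E)) q x - deriv (along (pd1 (pd2 E)) q) x) * h x"

definition op_domain :: "real \<Rightarrow> (real \<Rightarrow> real \<times> real) set" where
  "op_domain T = {U. (\<lambda>x. fst (U x)) \<in> H2_per T \<and> (\<lambda>x. snd (U x)) \<in> L2_per T}"

definition A_E ::
  "(real \<Rightarrow> real \<Rightarrow> real) \<Rightarrow> real \<Rightarrow> (real \<Rightarrow> real) \<Rightarrow> real \<Rightarrow> (real \<Rightarrow> real \<times> real) \<Rightarrow> real \<Rightarrow> real \<times> real" where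
  "A_E E \<Xi> \<rho> j U x =
     (Hess_op \<Xi> E \<rho> (\<lambda>s. fst (U s)) x + j / \<rho> x * snd (U x),
      j / \<rho> x * fst (U x) + \<rho> x * snd (U x))"

definition A_L ::
  "(real \<Rightarrow> real \<Rightarrow> real) \<Rightarrow> real \<Rightarrow> (real \<Rightarrow> real) \<Rightarrow> real \<Rightarrow> (real \<Rightarrow> real \<times> real) \<Rightarrow> real \<Rightarrow> real \<times> real" where
  "A_L e \<Upsilon> v j U y =
     (Hess_op \<Upsilon> e v (\<lambda>s. fst (U s)) y - j * snd (U y), - j * fst (U y) + snd (U y))"

end

theory Submission
  imports Defs
begin

text \<open>Completing the square in the variable \<open>\<mu>\<close> (or \<open>\<lambda>\<close>) makes \<open>Hess \<Theta>\<close> congruent to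
  \<open>diag (\<Theta>\<^sub>\<mu>\<^sub>\<mu>, - C_E)\<close> (or \<open>diag (\<Theta>\<^sub>\<lambda>\<^sub>\<lambda>, - C_L)\<close>), so everything reduces to
  \<open>n (A_E) = 1 + n (\<Theta>\<^sub>\<mu>\<^sub>\<mu>)\<close> and \<open>n (A_L) = 1 + n (\<Theta>\<^sub>\<lambda>\<^sub>\<lambda>)\<close>.

  Eliminating the velocity component, each operator has the signature of a scalar Hill operator
  \<open>h \<mapsto> - (K h')' + c h\<close> with the periodic null function \<open>\<phi> = q'\<close>, where \<open>q\<close> is the profile. A zero of \<open>q'\<close>
  is a centre of symmetry of \<open>q\<close>, hence \<open>q'\<close> has exactly two zeros \<open>a < b\<close> per fundamental period \<open>T\<close>.
  The derivative \<open>\<psi>\<close> of \<open>q\<close> in \<open>\<mu>\<close> (or \<open>\<lambda>\<close>) is a second null solution with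
  \<open>K (\<phi> \<psi>' - \<phi>' \<psi>) = 1\<close> and \<open>\<psi> (x + T) = \<psi> x - \<tau> \<phi> x\<close>, where \<open>\<tau>\<close> is the derivative of the period,
  that is \<open>\<Theta>\<^sub>\<mu>\<^sub>\<mu>\<close> (or \<open>\<Theta>\<^sub>\<lambda>\<^sub>\<lambda>\<close>) because \<open>\<Theta>\<^sub>\<mu> = \<Xi>\<close> and \<open>\<Theta>\<^sub>\<lambda> = \<Upsilon>\<close>.
  Writing \<open>h = s \<psi> + g\<close> on \<open>[a, a + T]\<close> with \<open>g a = 0\<close>, the quadratic form becomes \<open>s\<^sup>2 \<tau> + Q g\<close>, and the
  Dirichlet form \<open>Q\<close> has index one since \<open>\<phi>\<close> has the single interior zero \<open>b\<close>.\<close>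

section \<open>Negative signatures\<close>

text \<open>The upper bounds need no spectral theory: the signature is at most the number of linear
  conditions on the first component that make the form nonnegative, namely one or two conditions on
  its values at the zeros \<open>a\<close> and \<open>b\<close> of \<phi>. The obstacle lies in the
  lower bounds. The operators act on twice weakly differentiable functions, whereas the natural test
  functions have corners. They are therefore averaged; only limits of the form are computed, and
  strict inequalities between Gram entries survive the passage back to the averages. The Wronskian
  value 1 and the shift by \<tau> \<phi> come from two identities in the parameter. The energy
  integral \<open>K q'^2 / 2 - P(q)\<close> equals the parameter that varies, so its derivative is
  1; and \<open>q (x + T) = q x\<close>, where \<open>T\<close> varies too, yields the shift. As the
  slope of the profile is only jointly of class C1, the linear equation of \<psi> is recovered from
  the Wronskian rather than by differentiating the profile equation in the parameter.\<close>

lemma neg_signature_le: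
  fixes L :: "'a::real_vector \<Rightarrow> 'b::euclidean_space"
  assumes L: "linear L" and nonneg: "\<And>U. U \<in> D \<Longrightarrow> L U = 0 \<Longrightarrow> 0 \<le> Q U"
  shows "neg_signature D Q \<le> ereal (real DIM('b))"
  unfolding neg_signature_def
proof (rule SUP_least, clarify)
  fix B assume B: "finite B" "independent B" "span B \<subseteq> D" "\<forall>U\<in>span B - {0}. Q U < 0"
  \<comment> \<open>On the span, \<open>L U = 0\<close> would make \<open>Q U\<close> both negative
    and nonnegative unless \<open>U = 0\<close>; a negative definite span therefore embeds into the
    target of \<open>L\<close>.\<close>
  have inj: "inj_on L (span B)"
  proof (subst linear_injective_on_subspace_0[OF L subspace_span], clarify)
    fix U assume "U \<in> span B" "L U = 0"
    then show "U = 0" using B nonneg[of U] by (meson DiffI linorder_not_le singletonD subset_iff)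
  qed
  then have "independent (L ` B)"
    by (rule linear_independent_injective_image[OF L B(2)])
  then have "card (L ` B) \<le> DIM('b)"
    using independent_bound by blast
  moreover have "card (L ` B) = card B"
    by (rule card_image[OF inj_on_subset[OF inj span_superset]])
  ultimately show "ereal (real (card B)) \<le> ereal (real DIM('b))" by simp
qed

lemma neg_signature_ge:
  assumes "finite B" "independent B" "span B \<subseteq> D" "\<And>U. U \<in> span B \<Longrightarrow> U \<noteq> 0 \<Longrightarrow> Q U < 0"
  shows "ereal (real (card B)) \<le> neg_signature D Q"
  unfolding neg_signature_def using assms by (intro SUP_upper) auto

lemma neg_signature_ge_1:
  assumes "\<And>c. c *\<^sub>R U \<in> D" "\<And>c. Q (c *\<^sub>R U) = c\<^sup>2 * m" "m < 0"
  shows "1 \<le> neg_signature D Q"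
proof -
  have "U \<noteq> 0"
    using assms(2)[of 0] assms(2)[of 1] assms(3) by auto
  then have "ereal (real (card {U})) \<le> neg_signature D Q"
    using assms by (intro neg_signature_ge) (auto simp: span_singleton mult_pos_neg)
  then show ?thesis by (simp add: one_ereal_def)
qed

text \<open>Sylvester's criterion for the Gram matrix with rows \<open>l, m\<close> and
  \<open>m, n\<close>. Independence of \<open>U\<close> and \<open>V\<close> is a consequence: the
  form is 0 at 0 but negative on every nontrivial combination.\<close>

lemma neg_signature_ge_2:
  assumes D: "\<And>s t. s *\<^sub>R U + t *\<^sub>R V \<in> D"
    and Q: "\<And>s t. Q (s *\<^sub>R U + t *\<^sub>R V) = s\<^sup>2 * l + 2 * s * t * m + t\<^sup>2 * n"
    and l: "l < 0" and det: "m\<^sup>2 < l * n"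
  shows "2 \<le> neg_signature D Q"
proof -
  have neg: "Q (s *\<^sub>R U + t *\<^sub>R V) < 0" if "s \<noteq> 0 \<or> t \<noteq> 0" for s t
  proof -
    \<comment> \<open>Multiplying by \<open>l\<close> exposes the determinant as the coefficient of
      the second square; the sign of \<open>l\<close> is restored at the end.\<close>
    have eq: "l * (s\<^sup>2 * l + 2 * s * t * m + t\<^sup>2 * n) = (l * s + m * t)\<^sup>2 + (l * n - m\<^sup>2) * t\<^sup>2"
      by (simp add: algebra_simps power2_eq_square)
    have "0 < (l * s + m * t)\<^sup>2 + (l * n - m\<^sup>2) * t\<^sup>2"
    proof (cases "t = 0")
      case True with that l show ?thesis by simp
    next
      case False with det show ?thesis by (intro add_nonneg_pos) auto
    qed
    then show ?thesis unfolding Q eq[symmetric] using l by (simp add: zero_less_mult_iff)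
  qed
  have nz: "s *\<^sub>R U + t *\<^sub>R V \<noteq> 0" if "s \<noteq> 0 \<or> t \<noteq> 0" for s t
    using neg[OF that] Q[of 0 0] by auto
  have ne: "U \<noteq> V" using nz[of 1 "-1"] by auto
  have ind: "independent {U, V}"
  proof (rule independent_insertI)
    show "U \<notin> span {V}"
    proof
      assume "U \<in> span {V}"
      then obtain k where "U = k *\<^sub>R V" by (auto simp: span_singleton)
      with nz[of 1 "-k"] show False by simp
    qed
    show "independent {V}" using nz[of 0 1] by simp
  qed
  have span: "\<exists>s t. W = s *\<^sub>R U + t *\<^sub>R V" if W: "W \<in> span {U, V}" for W
  proof -
    obtain s where "W - s *\<^sub>R U \<in> span {V}" using W span_breakdown_eq by metis
    then obtain t where "W - s *\<^sub>R U = t *\<^sub>R V" unfolding span_singleton by blast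
    then have "W = s *\<^sub>R U + t *\<^sub>R V" by (simp add: algebra_simps)
    then show ?thesis by blast
  qed
  have "ereal (real (card {U, V})) \<le> neg_signature D Q"
  proof (rule neg_signature_ge[OF _ ind])
    show "span {U, V} \<subseteq> D" using span D by blast
    fix W assume "W \<in> span {U, V}" "W \<noteq> 0"
    then obtain s t where W: "W = s *\<^sub>R U + t *\<^sub>R V" using span[of W] by blast
    then have "s \<noteq> 0 \<or> t \<noteq> 0" using \<open>W \<noteq> 0\<close> by auto
    then show "Q W < 0" unfolding W by (rule neg)
  qed simp
  then show ?thesis using ne by simp
qed

section \<open>Inertia of symmetric matrices\<close>

lemma neg_signature_eq_dim:
  fixes Q :: "'a::euclidean_space \<Rightarrow> real"
  assumes N: "subspace N" and P: "subspace P" and dim: "dim N + dim P = DIM('a)"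
    and neg: "\<And>x. x \<in> N \<Longrightarrow> x \<noteq> 0 \<Longrightarrow> Q x < 0" and nonneg: "\<And>x. x \<in> P \<Longrightarrow> 0 \<le> Q x"
  shows "neg_signature UNIV Q = ereal (real (dim N))"
proof (rule antisym)
  show "neg_signature UNIV Q \<le> ereal (real (dim N))"
    unfolding neg_signature_def
  proof (rule SUP_least, clarify)
    fix B :: "'a set" assume B: "independent B" "\<forall>U\<in>span B - {0}. Q U < 0"
    \<comment> \<open>A negative definite span meets \<open>P\<close> only in 0, so its dimension is
      at most the codimension of \<open>P\<close>, which is \<open>dim N\<close>.\<close>
    have "x = 0" if "x \<in> span B" "x \<in> P" for x
      using B(2) nonneg[of x] that by (meson DiffI not_le singletonD)
    then have "span B \<inter> P = {0}"
      using span_zero subspace_0[OF P] by blast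
    then have "dim {x + y |x y. x \<in> span B \<and> y \<in> P} = dim (span B) + dim P"
      using dim_sums_Int[OF subspace_span P, of B] by simp
    then have "dim (span B) + dim P \<le> DIM('a)"
      using dim_subset_UNIV[of "{x + y |x y. x \<in> span B \<and> y \<in> P}"] by simp
    then show "ereal (real (card B)) \<le> ereal (real (dim N))"
      using dim B(1) by (simp add: dim_eq_card_independent)
  qed
  obtain B where B: "B \<subseteq> N" "independent B" "N \<subseteq> span B" "card B = dim N"
    using basis_exists by blast
  have "span B = N" using B N by (simp add: span_subspace)
  then show "ereal (real (dim N)) \<le> neg_signature UNIV Q"
    using neg_signature_ge[of B UNIV Q] B neg independent_imp_finite by auto
qed

text \<open>A negative definite subspace of maximal dimension and its orthogonal complement for the
  bilinear form; maximality makes the form nonnegative on the latter, and Cauchy--Schwarz with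
  nondegeneracy makes it definite.\<close>

lemma symmetric_invertible_splitting:
  fixes M :: "real^'n^'n"
  assumes sym: "transpose M = M" and inv: "invertible M"
  obtains N P where "subspace N" "subspace P" "dim N + dim P = CARD('n)"
    "\<And>x. x \<in> N \<Longrightarrow> x \<noteq> 0 \<Longrightarrow> x \<bullet> (M *v x) < 0" "\<And>x. x \<in> P \<Longrightarrow> x \<noteq> 0 \<Longrightarrow> 0 < x \<bullet> (M *v x)"
proof -
  let ?neg = "\<lambda>N. subspace N \<and> (\<forall>x\<in>N. x \<noteq> 0 \<longrightarrow> x \<bullet> (M *v x) < 0)"
  have symD: "x \<bullet> (M *v y) = y \<bullet> (M *v x)" for x y
    using dot_lmul_matrix[of x M y] transpose_matrix_vector[of M x] sym by (simp add: inner_commute)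
  have inj: "inj ((*v) M)" using inv by (rule inj_matrix_vector_mult)
  have "\<exists>N. ?neg N \<and> (\<forall>N'. ?neg N' \<longrightarrow> dim N' \<le> dim N)"
  proof -
    have "?neg {0}" by simp
    moreover have "dim N < Suc CARD('n)" for N :: "(real^'n) set"
      using dim_subset_UNIV[of N] by simp
    ultimately show ?thesis
      using ex_has_greatest_nat[of ?neg "{0}" dim "Suc CARD('n)"] by blast
  qed
  then obtain N where N: "subspace N" and neg: "\<And>x. x \<in> N \<Longrightarrow> x \<noteq> 0 \<Longrightarrow> x \<bullet> (M *v x) < 0"
    and max: "\<And>N'. ?neg N' \<Longrightarrow> dim N' \<le> dim N" by blast
  define P where "P = {y \<in> UNIV. \<forall>x\<in>(*v) M ` N. orthogonal x y}"
  have P_iff: "y \<in> P \<longleftrightarrow> (\<forall>x\<in>N. y \<bullet> (M *v x) = 0)" for y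
    by (auto simp: P_def orthogonal_def inner_commute)
  have subP: "subspace P"
    by (auto simp: subspace_def P_iff inner_add_left)
  have "dim P + dim ((*v) M ` N) = dim (UNIV :: (real^'n) set)"
    unfolding P_def
    by (rule dim_subspace_orthogonal_to_vectors) (auto intro: linear_subspace_image N)
  moreover have "dim ((*v) M ` N) = dim N"
    by (rule dim_image_eq) (use inj inj_on_subset in \<open>auto intro: inj_on_subset\<close>)
  ultimately have dims: "dim N + dim P = CARD('n)" by simp
  have nonneg: "0 \<le> y \<bullet> (M *v y)" if y: "y \<in> P" for y
  proof (rule ccontr)
    assume "\<not> ?thesis"
    then have y0: "y \<bullet> (M *v y) < 0" by simp
    have yN: "y \<notin> span N" using y0 y N P_iff
      by (metis order_less_irrefl span_eq_iff)
    \<comment> \<open>Since \<open>y\<close> is orthogonal to \<open>N\<close> for the form, no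
      cross term appears, and adjoining \<open>y\<close> would contradict the maximality of
      \<open>N\<close>.\<close>
    have "?neg (span (insert y N))"
    proof (intro conjI ballI impI subspace_span)
      fix z assume z: "z \<in> span (insert y N)" "z \<noteq> 0"
      obtain k where "z - k *\<^sub>R y \<in> span N" using z span_breakdown_eq by metis
      then have k: "z - k *\<^sub>R y \<in> N" using N by (simp add: span_eq_iff[THEN iffD2])
      define n where "n = z - k *\<^sub>R y"
      have zn: "z = n + k *\<^sub>R y" by (simp add: n_def)
      have "n \<in> N" using k n_def by simp
      then have "y \<bullet> (M *v n) = 0" using y P_iff by blast
      then have e: "z \<bullet> (M *v z) = n \<bullet> (M *v n) + k\<^sup>2 * (y \<bullet> (M *v y))"
        using symD[of n y] unfolding zn
        by (simp add: matrix_vector_right_distrib scaleR_matrix_vector_assoc[symmetric]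
            matrix_vector_mult_scaleR inner_add power2_eq_square algebra_simps)
      show "z \<bullet> (M *v z) < 0"
      proof (cases "n = 0")
        case True
        then have "k \<noteq> 0" using z zn by auto
        then show ?thesis unfolding e using True y0 by (simp add: mult_pos_neg)
      next
        case False
        then have "n \<bullet> (M *v n) < 0" using neg \<open>n \<in> N\<close> by blast
        moreover have "k\<^sup>2 * (y \<bullet> (M *v y)) \<le> 0" using y0 by (simp add: mult_nonneg_nonpos)
        ultimately show ?thesis unfolding e by linarith
      qed
    qed
    then have "dim (span (insert y N)) \<le> dim N" by (rule max)
    then show False using yN by (simp add: dim_insert)
  qed
  have pos: "0 < y \<bullet> (M *v y)" if y: "y \<in> P" "y \<noteq> 0" for y
  proof (rule ccontr)
    assume "\<not> ?thesis"
    then have y0: "y \<bullet> (M *v y) = 0" using nonneg y by force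
    have yP: "z \<bullet> (M *v y) = 0" if "z \<in> P" for z
    proof (rule ccontr)
      assume nz: "z \<bullet> (M *v y) \<noteq> 0"
      define a where "a = z \<bullet> (M *v y)"
      \<comment> \<open>With \<open>y\<close> isotropic the form at \<open>z + k *\<^sub>R y\<close>
        is affine in \<open>k\<close>; this \<open>k\<close> gives it the value -1.\<close>
      define k where "k = - (z \<bullet> (M *v z) + 1) / (2 * a)"
      have "z + k *\<^sub>R y \<in> P" using subP \<open>z \<in> P\<close> y by (simp add: subspace_add subspace_scale)
      from nonneg[OF this] have "0 \<le> z \<bullet> (M *v z) + 2 * k * a"
        using y0 symD[of y z]
        by (simp add: a_def matrix_vector_right_distrib matrix_vector_mult_scaleR inner_add algebra_simps)
      moreover have "2 * k * a = - (z \<bullet> (M *v z) + 1)"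
        using nz by (simp add: k_def a_def)
      ultimately show False by linarith
    qed
    have NP: "N \<inter> P = {0}"
    proof -
      have "x = 0" if "x \<in> N" "x \<in> P" for x
        using neg[of x] nonneg[of x] that by force
      then show ?thesis using subspace_0 N subP by blast
    qed
    have "dim {x + z |x z. x \<in> N \<and> z \<in> P} = CARD('n)"
      using dim_sums_Int[OF N subP] NP dims by simp
    then have "{x + z |x z. x \<in> N \<and> z \<in> P} = UNIV"
      using subspace_sums[OF N subP] dim_eq_full[of "{x + z |x z. x \<in> N \<and> z \<in> P}"]
      by (simp add: span_eq_iff[THEN iffD2])
    then obtain x z where xz: "M *v y = x + z" "x \<in> N" "z \<in> P" by blast
    \<comment> \<open>The component in \<open>N\<close> pairs to zero with \<open>M *v y\<close>
      because \<open>y \<in> P\<close>, the component in \<open>P\<close> by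
      \<open>yP\<close>.\<close>
    have "(M *v y) \<bullet> (M *v y) = 0"
      using xz yP[of z] P_iff[of y] y symD[of x y] by (metis add.right_neutral inner_add_left)
    then have "M *v y = 0" by simp
    then show False using inj y by (metis injD matrix_vector_mult_0_right)
  qed
  show ?thesis using that N subP dims neg pos by blast
qed

text \<open>The scalar slot holds the completed variable; it is joined to one side of the splitting
  or to the other according to the sign of the pivot, which is why both products are
  measured.\<close>

lemma dim_pair_image:
  fixes S :: "'a::euclidean_space set" and \<Phi> :: "real \<times> 'a \<Rightarrow> 'b::euclidean_space"
  assumes \<Phi>: "linear \<Phi>" "inj \<Phi>" and S: "subspace S"
  shows "dim (\<Phi> ` ({0} \<times> S)) = dim S" "dim (\<Phi> ` (UNIV \<times> S)) = dim S + 1"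
proof -
  have im: "dim (\<Phi> ` V) = dim V" for V
    by (rule dim_image_eq[OF \<Phi>(1)]) (rule inj_on_subset[OF \<Phi>(2)], simp)
  have lin: "linear (\<lambda>y::'a. (0::real, y))" by (auto intro!: linearI)
  have eq: "{0::real} \<times> S = (\<lambda>y. (0, y)) ` S" by auto
  have "dim ((\<lambda>y::'a. (0::real, y)) ` S) = dim S"
    by (rule dim_image_eq[OF lin]) (auto simp: inj_on_def)
  then have d0: "dim ({0::real} \<times> S) = dim S" by (simp add: eq)
  then show "dim (\<Phi> ` ({0} \<times> S)) = dim S" by (simp add: im)
  have sub: "subspace ({0::real} \<times> S)" unfolding eq by (rule linear_subspace_image[OF lin S])
  let ?e = "(1, 0) :: real \<times> 'a"
  have "{x + y |x y. x \<in> span {?e} \<and> y \<in> {0} \<times> S} = UNIV \<times> S"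
  proof (intro equalityI subsetI)
    fix z :: "real \<times> 'a" assume "z \<in> UNIV \<times> S"
    then have "z = fst z *\<^sub>R ?e + (0, snd z)" "(0::real, snd z) \<in> {0} \<times> S" by auto
    then show "z \<in> {x + y |x y. x \<in> span {?e} \<and> y \<in> {0} \<times> S}"
      by (metis (mono_tags, lifting) mem_Collect_eq span_base span_scale singletonI)
  qed (auto simp: span_singleton)
  moreover have "span {?e} \<inter> {0} \<times> S = {0}"
    using subspace_0[OF S] by (auto simp: span_singleton zero_prod_def)
  ultimately have "dim ((UNIV::real set) \<times> S) = dim (span {?e}) + dim ({0::real} \<times> S)"
    using dim_sums_Int[OF subspace_span sub, of "{?e}"] by simp
  moreover have "dim (span {?e}) = 1"
    using dim_singleton[of ?e] by (simp add: zero_prod_def)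
  ultimately show "dim (\<Phi> ` (UNIV \<times> S)) = dim S + 1" using d0 by (simp add: im)
qed

text \<open>Sums over the index type are expanded along an arbitrary enumeration, so that one
  computation serves the Eulerian and the Lagrangian ordering of the parameters.\<close>

lemma sum_4_insert:
  fixes g :: "4 \<Rightarrow> real"
  assumes "distinct [m, s1, s2, s3]"
  shows "(\<Sum>i\<in>UNIV. g i) = g m + g s1 + g s2 + g s3"
proof -
  have "card {m, s1, s2, s3} = CARD(4)" using assms by simp
  then have eq: "UNIV = {m, s1, s2, s3}" by (metis card_subset_eq finite subset_UNIV)
  show ?thesis unfolding eq using assms by (simp add: add.assoc)
qed

text \<open>Completing the square in the variable of index \<open>m\<close> turns the form of \<open>H\<close> into
  \<open>H\<^sub>m\<^sub>m a\<^sup>2 - y \<bullet> C y\<close>.\<close>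

lemma neg_signature_constraint_matrix:
  fixes H :: "real^4^4" and s :: "4^3"
  assumes sym: "transpose H = H" and Hm: "H $ m $ m \<noteq> 0"
    and dist: "distinct [m, s $ 1, s $ 2, s $ 3]"
    and inv: "invertible (constraint_matrix H m s)"
  shows "neg_signature_matrix H - 2
     = ereal (if H $ m $ m < 0 then 2 else 1) - neg_signature_matrix (constraint_matrix H m s)"
proof -
  define C where "C = constraint_matrix H m s"
  have Hs: "H $ i $ k = H $ k $ i" for i k
    using arg_cong[OF sym, of "\<lambda>M. M $ k $ i"] by (simp add: transpose_def)
  have "transpose C = C"
    by (simp add: C_def constraint_matrix_def transpose_def vec_eq_iff Hs mult.commute)
  then obtain N P where NP: "subspace N" "subspace P" "dim N + dim P = CARD(3)"
    and N: "\<And>x. x \<in> N \<Longrightarrow> x \<noteq> 0 \<Longrightarrow> x \<bullet> (C *v x) < 0"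
    and P: "\<And>x. x \<in> P \<Longrightarrow> x \<noteq> 0 \<Longrightarrow> 0 < x \<bullet> (C *v x)"
    using symmetric_invertible_splitting[of C] inv C_def by blast
  have nC: "neg_signature_matrix C = ereal (real (dim N))"
    unfolding neg_signature_matrix_def
    by (rule neg_signature_eq_dim[OF NP(1,2)]) (use NP N P in \<open>auto simp: le_less intro: P\<close>)
  \<comment> \<open>The shift that removes the mixed terms: the coordinate of index \<open>m\<close>
    is \<open>a - b \<bullet> y\<close>, with \<open>a\<close> the completed variable.\<close>
  define b :: "real^3" where "b = (\<chi> a. H $ m $ (s $ a) / H $ m $ m)"
  define \<Phi> :: "real \<times> (real^3) \<Rightarrow> real^4" where
    "\<Phi> = (\<lambda>(a, y). \<chi> i. if i = m then a - b \<bullet> y else if i = s $ 1 then y $ 1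
       else if i = s $ 2 then y $ 2 else y $ 3)"
  have \<Phi>s: "\<Phi> z $ m = fst z - b \<bullet> snd z" "\<Phi> z $ (s $ 1) = snd z $ 1"
    "\<Phi> z $ (s $ 2) = snd z $ 2" "\<Phi> z $ (s $ 3) = snd z $ 3" for z
    using dist by (auto simp: \<Phi>_def split_beta)
  have lin: "linear \<Phi>"
    by (rule linearI) (auto simp: \<Phi>_def split_beta vec_eq_iff inner_add_right algebra_simps)
  have inj: "inj \<Phi>"
  proof (subst linear_injective_0[OF lin], clarify)
    fix a y assume 0: "\<Phi> (a, y) = 0"
    then have "\<Phi> (a, y) $ i = 0" for i by simp
    then have "y $ 1 = 0" "y $ 2 = 0" "y $ 3 = 0" "a - b \<bullet> y = 0"
      using \<Phi>s[of "(a, y)"] by auto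
    then have "y = 0" by (simp add: vec_eq_iff forall_3)
    with \<open>a - b \<bullet> y = 0\<close> show "(a, y) = 0" by (simp add: zero_prod_def)
  qed
  have form: "\<Phi> z \<bullet> (H *v \<Phi> z) = H $ m $ m * (fst z)\<^sup>2 - snd z \<bullet> (C *v snd z)" for z
  proof -
    have "\<Phi> z \<bullet> (H *v \<Phi> z) = H $ m $ m * (\<Phi> z $ m + b \<bullet> snd z)\<^sup>2 - snd z \<bullet> (C *v snd z)"
      unfolding inner_vec_def matrix_vector_mult_def sum_4_insert[OF dist] sum_3 inner_real_def
      using Hm
      by (simp add: \<Phi>s(2-4) C_def constraint_matrix_def b_def Hs[of "s $ 1" m] Hs[of "s $ 2" m]
          Hs[of "s $ 3" m] Hs[of "s $ 2" "s $ 1"] Hs[of "s $ 3" "s $ 1"] Hs[of "s $ 3" "s $ 2"]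
          sum_4_insert[OF dist] sum_3 field_simps power2_eq_square)
    then show ?thesis by (simp add: \<Phi>s)
  qed
  have zero: "\<Phi> (0, 0) = 0" using linear_0[OF lin] by (simp add: zero_prod_def)
  have subs: "subspace (\<Phi> ` ({0} \<times> V))" "subspace (\<Phi> ` (UNIV \<times> V))" if "subspace V" for V
    using that by (auto intro!: linear_subspace_image[OF lin] subspace_Times)
  have "neg_signature_matrix H = ereal (real (dim P + (if H $ m $ m < 0 then 1 else 0)))"
  proof (cases "H $ m $ m < 0")
    case True
    have "neg_signature_matrix H = ereal (real (dim (\<Phi> ` (UNIV \<times> P))))"
      unfolding neg_signature_matrix_def
    proof (rule neg_signature_eq_dim[OF subs(2)[OF NP(2)] subs(1)[OF NP(1)]])
      show "dim (\<Phi> ` (UNIV \<times> P)) + dim (\<Phi> ` ({0} \<times> N)) = DIM(real^4)"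
        using dim_pair_image[OF lin inj] NP by simp
      fix x assume "x \<in> \<Phi> ` (UNIV \<times> P)" "x \<noteq> 0"
      then obtain a y where x: "x = \<Phi> (a, y)" "y \<in> P" "a \<noteq> 0 \<or> y \<noteq> 0" using zero by auto
      show "x \<bullet> (H *v x) < 0"
      proof (cases "y = 0")
        case True with x form[of "(a, y)"] \<open>H $ m $ m < 0\<close> show ?thesis by (simp add: mult_neg_pos)
      next
        case False
        have "H $ m $ m * a\<^sup>2 \<le> 0" using \<open>H $ m $ m < 0\<close> by (simp add: mult_nonpos_nonneg)
        then show ?thesis using x form[of "(a, y)"] P[OF x(2) False] by simp
      qed
    next
      fix x assume "x \<in> \<Phi> ` ({0} \<times> N)"
      then obtain y where x: "x = \<Phi> (0, y)" "y \<in> N" by auto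
      then show "0 \<le> x \<bullet> (H *v x)" using form[of "(0, y)"] N[of y] by (cases "y = 0") auto
    qed
    then show ?thesis using True dim_pair_image[OF lin inj] NP by simp
  next
    case False
    then have pos: "0 < H $ m $ m" using Hm by simp
    have "neg_signature_matrix H = ereal (real (dim (\<Phi> ` ({0} \<times> P))))"
      unfolding neg_signature_matrix_def
    proof (rule neg_signature_eq_dim[OF subs(1)[OF NP(2)] subs(2)[OF NP(1)]])
      show "dim (\<Phi> ` ({0} \<times> P)) + dim (\<Phi> ` (UNIV \<times> N)) = DIM(real^4)"
        using dim_pair_image[OF lin inj] NP by simp
      fix x assume "x \<in> \<Phi> ` ({0} \<times> P)" "x \<noteq> 0"
      then obtain y where x: "x = \<Phi> (0, y)" "y \<in> P" "y \<noteq> 0" using zero by auto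
      then show "x \<bullet> (H *v x) < 0" using form[of "(0, y)"] P[of y] by simp
    next
      fix x assume "x \<in> \<Phi> ` (UNIV \<times> N)"
      then obtain a y where x: "x = \<Phi> (a, y)" "y \<in> N" by auto
      have "0 \<le> H $ m $ m * a\<^sup>2" using pos by simp
      moreover have "y \<bullet> (C *v y) \<le> 0" using N[OF x(2)] by (cases "y = 0") auto
      ultimately show "0 \<le> x \<bullet> (H *v x)" using x form[of "(a, y)"] by simp
    qed
    then show ?thesis using False dim_pair_image[OF lin inj] NP by simp
  qed
  \<comment> \<open>By invertibility the two parts of \<open>C\<close> exhaust the three dimensions,
    so \<open>- C\<close> has \<open>3 - dim N\<close> negative directions; subtracting 2 leaves the
    1 of the statement, raised to 2 by a negative pivot.\<close>
  moreover have "real (dim P) = 3 - real (dim N)" using NP(3) by simp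
  ultimately show ?thesis unfolding C_def[symmetric] nC by simp
qed

section \<open>Periodic and weakly differentiable functions\<close>

lemma is_period_int:
  assumes "is_period T f"
  shows "f (x + of_int k * T) = f x"
proof -
  have nat: "f (y + of_nat n * T) = f y" for y n
  proof (induction n)
    case (Suc n)
    have "y + of_nat (Suc n) * T = (y + of_nat n * T) + T" by (simp add: algebra_simps)
    then show ?case using Suc assms unfolding is_period_def by metis
  qed simp
  show ?thesis
  proof (cases "k \<ge> 0")
    case True then show ?thesis using nat[of x "nat k"] by simp
  next
    case False
    then show ?thesis using nat[of "x + of_int k * T" "nat (- k)"] by simp
  qed
qed

lemma is_period_reduce:
  assumes "is_period T f" "0 < T"
  obtains y where "a \<le> y" "y < a + T" "f y = f x"
proof -
  define k where "k = \<lfloor>(x - a) / T\<rfloor>"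
  have "of_int k \<le> (x - a) / T" "(x - a) / T < of_int k + 1" by (auto simp: k_def)
  then have "of_int k * T \<le> x - a" "x - a < (of_int k + 1) * T"
    using assms(2) by (simp_all add: field_simps)
  then show ?thesis
    using that[of "x + of_int (- k) * T"] is_period_int[OF assms(1), of x "- k"]
    by (simp add: algebra_simps)
qed

lemma periodic_bounded:
  fixes k :: "real \<Rightarrow> real"
  assumes "continuous_on UNIV k" "is_period T k" "0 < T"
  obtains M where "0 < M" "\<And>x. \<bar>k x\<bar> \<le> M"
proof -
  have "compact (k ` {0..T})"
    using assms(1) by (intro compact_continuous_image) (auto intro: continuous_on_subset)
  then obtain M where M: "0 < M" "\<And>x. x \<in> {0..T} \<Longrightarrow> \<bar>k x\<bar> \<le> M"
    using compact_imp_bounded bounded_pos by (metis image_eqI real_norm_def)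
  have "\<bar>k x\<bar> \<le> M" for x
  proof -
    obtain y where "0 \<le> y" "y < 0 + T" "k y = k x" using is_period_reduce[OF assms(2,3)] .
    then show ?thesis using M(2)[of y] by simp
  qed
  with M(1) that show ?thesis by blast
qed

lemma periodic_integrable:
  fixes f :: "real \<Rightarrow> real"
  assumes per: "is_period T f" and T: "0 < T" and int: "f integrable_on {0..T}"
  shows "f integrable_on {a..b}"
proof -
  have piece: "f integrable_on {of_int k * T..of_int k * T + T}" for k
  proof -
    have "((\<lambda>x. f (1 * x + (- of_int k * T))) has_integral (1 / \<bar>1\<bar> ^ DIM(real)) *\<^sub>R integral {0..T} f)
      ((\<lambda>x. (1 / 1) *\<^sub>R x + - ((1 / 1) *\<^sub>R (- of_int k * T))) ` cbox 0 T)"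
      using has_integral_affinity[of f "integral {0..T} f" 0 T 1 "- of_int k * T"] int
      by (simp add: integrable_integral)
    moreover have "f (1 * x + (- of_int k * T)) = f x" for x
      using is_period_int[OF per, of x "- k"] by simp
    moreover have "(\<lambda>x. (1 / 1) *\<^sub>R x + - ((1 / 1) *\<^sub>R (- of_int k * T))) ` cbox 0 T
        = {of_int k * T..of_int k * T + T}"
      using image_add_atLeastAtMost[of "of_int k * T" 0 T] by (simp add: add.commute)
    ultimately show ?thesis by (metis (no_types, lifting) has_integral_cong has_integral_integrable)
  qed
  have big: "f integrable_on {- (of_nat n * T)..of_nat n * T}" for n
  proof (induction n)
    case (Suc n)
    have p1: "f integrable_on {- (of_nat (Suc n) * T)..- (of_nat n * T)}"
      using piece[of "- int (Suc n)"] by (simp add: algebra_simps)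
    have p2: "f integrable_on {of_nat n * T..of_nat (Suc n) * T}"
      using piece[of "int n"] by (simp add: algebra_simps)
    have n: "0 \<le> real n * T" "real n * T \<le> real (Suc n) * T" using T by (auto simp: algebra_simps)
    have "f integrable_on {- (of_nat (Suc n) * T)..of_nat n * T}"
      by (rule Henstock_Kurzweil_Integration.integrable_combine[OF _ _ p1 Suc]) (use n in auto)
    then show ?case
      by (rule Henstock_Kurzweil_Integration.integrable_combine[OF _ _ _ p2, rotated 2]) (use n in linarith)+
  qed (use integrable_on_refl[of f "0::real"] in simp)
  obtain n where n: "max \<bar>a\<bar> \<bar>b\<bar> < of_nat n * T" using reals_Archimedean3[OF T] by blast
  show ?thesis
    by (rule integrable_on_subinterval[OF big[of n]]) (use n in auto)
qed

lemma periodic_integral_shift: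
  fixes f :: "real \<Rightarrow> real"
  assumes cont: "continuous_on UNIV f" and per: "is_period T f" and T: "0 < T"
  shows "integral {a..a + T} f = integral {0..T} f"
proof -
  obtain F where F: "\<And>x. (F has_vector_derivative f x) (at x)"
    using einterval_antiderivative[of "-\<infinity>" "\<infinity>" f] cont
    by (auto simp: continuous_on_eq_continuous_at)
  have FTC: "integral {c..c + T} f = F (c + T) - F c" for c
    using T F by (intro integral_unique fundamental_theorem_of_calculus)
      (auto intro: has_vector_derivative_at_within)
  have "((\<lambda>x. F (x + T) - F x) has_real_derivative 0) (at x)" for x
  proof -
    have "(F has_real_derivative f x) (at x)" "(F has_real_derivative f (x + T)) (at (x + T))"
      using F by (simp_all add: has_real_derivative_iff_has_vector_derivative)
    then have "((\<lambda>x. F (x + T) - F x) has_real_derivative f (x + T) - f x) (at x)"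
      by (intro DERIV_diff) (simp_all add: DERIV_shift)
    then show ?thesis using per by (simp add: is_period_def)
  qed
  then have "F (a + T) - F a = F (0 + T) - F 0"
    using DERIV_isconst_all by blast
  then show ?thesis using FTC[of a] FTC[of 0] by simp
qed

section \<open>Square integrable periodic functions\<close>

lemma L2_per_square_integrable:
  assumes "g \<in> L2_per T" "0 < T"
  shows "(\<lambda>x. (g x)\<^sup>2) integrable_on {a..b}"
proof (rule periodic_integrable[OF _ assms(2)])
  show "is_period T (\<lambda>x. (g x)\<^sup>2)" using assms by (simp add: L2_per_def is_period_def)
  show "(\<lambda>x. (g x)\<^sup>2) integrable_on {0..T}"
    using assms by (auto simp: L2_per_def dest: set_lebesgue_integral_eq_integral)
qed

lemma L2_per_measurable:
  assumes "g \<in> L2_per T"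
  shows "g \<in> borel_measurable (lebesgue_on S)"
  using assms by (auto simp: L2_per_def intro: measurable_restrict_space1)

lemma L2_per_mult_integrable:
  assumes "g1 \<in> L2_per T" "g2 \<in> L2_per T" "0 < T"
  shows "(\<lambda>x. g1 x * g2 x) absolutely_integrable_on {a..b}"
proof (rule measurable_bounded_by_integrable_imp_absolutely_integrable)
  show "(\<lambda>x. g1 x * g2 x) \<in> borel_measurable (lebesgue_on {a..b})"
    using assms by (intro borel_measurable_times L2_per_measurable)
  show "(\<lambda>x. (g1 x)\<^sup>2 + (g2 x)\<^sup>2) integrable_on {a..b}"
    using assms by (intro integrable_add L2_per_square_integrable)
  show "norm (g1 x * g2 x) \<le> (g1 x)\<^sup>2 + (g2 x)\<^sup>2" for x
    using sum_squares_bound[of "\<bar>g1 x\<bar>" "\<bar>g2 x\<bar>"] mult_nonneg_nonneg[OF abs_ge_zero abs_ge_zero, of "g1 x" "g2 x"]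
    unfolding real_norm_def abs_mult power2_abs by linarith
qed simp

lemma L2_perI:
  assumes "g \<in> borel_measurable lebesgue" "is_period T g" "b integrable_on {0..T}"
    and "\<And>x. (g x)\<^sup>2 \<le> b x"
  shows "g \<in> L2_per T"
  unfolding L2_per_def
proof (intro CollectI conjI assms(1,2))
  show "(\<lambda>x. (g x)\<^sup>2) absolutely_integrable_on {0..T}"
    using assms
    by (intro measurable_bounded_by_integrable_imp_absolutely_integrable[OF _ _ assms(3)])
      (auto intro!: borel_measurable_power measurable_restrict_space1)
qed

lemma continuous_L2_per:
  assumes "continuous_on UNIV k" "is_period T k"
  shows "k \<in> L2_per T"
proof (rule L2_perI[OF _ assms(2), of "\<lambda>x. (k x)\<^sup>2"])
  show "k \<in> borel_measurable lebesgue"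
    using borel_measurable_continuous_onI[OF assms(1)] by (intro measurable_completion) simp
  show "(\<lambda>x. (k x)\<^sup>2) integrable_on {0..T}"
    using assms(1) by (intro integrable_continuous_interval continuous_intros)
      (auto intro: continuous_on_subset)
qed simp

lemma continuous_mult_L2_per:
  assumes k: "continuous_on UNIV k" "is_period T k" and g: "g \<in> L2_per T" and T: "0 < T"
  shows "(\<lambda>x. k x * g x) \<in> L2_per T"
proof -
  obtain M where M: "0 < M" "\<And>x. \<bar>k x\<bar> \<le> M" using periodic_bounded[OF k T] by blast
  show ?thesis
  proof (rule L2_perI[of _ _ "\<lambda>x. M\<^sup>2 * (g x)\<^sup>2"])
    have "k \<in> borel_measurable lebesgue" using continuous_L2_per[OF k] by (simp add: L2_per_def)
    then show "(\<lambda>x. k x * g x) \<in> borel_measurable lebesgue"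
      using g by (intro borel_measurable_times) (auto simp: L2_per_def)
    show "is_period T (\<lambda>x. k x * g x)" using k g by (simp add: L2_per_def is_period_def)
    show "(\<lambda>x. M\<^sup>2 * (g x)\<^sup>2) integrable_on {0..T}"
      using L2_per_square_integrable[OF g T] by (rule integrable_on_mult_right)
    show "(k x * g x)\<^sup>2 \<le> M\<^sup>2 * (g x)\<^sup>2" for x
      unfolding power_mult_distrib using M(2)[of x] M(1)
      by (intro mult_right_mono) (auto simp: abs_le_square_iff[symmetric])
  qed
qed

lemma L2_per_add:
  assumes "g1 \<in> L2_per T" "g2 \<in> L2_per T" and T: "0 < T"
  shows "(\<lambda>x. g1 x + g2 x) \<in> L2_per T"
proof (rule L2_perI[of _ _ "\<lambda>x. 2 * (g1 x)\<^sup>2 + 2 * (g2 x)\<^sup>2"])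
  show "(\<lambda>x. g1 x + g2 x) \<in> borel_measurable lebesgue" "is_period T (\<lambda>x. g1 x + g2 x)"
    using assms by (auto simp: L2_per_def is_period_def)
  show "(\<lambda>x. 2 * (g1 x)\<^sup>2 + 2 * (g2 x)\<^sup>2) integrable_on {0..T}"
    using assms by (intro integrable_add integrable_on_mult_right L2_per_square_integrable)
  show "(g1 x + g2 x)\<^sup>2 \<le> 2 * (g1 x)\<^sup>2 + 2 * (g2 x)\<^sup>2" for x
    using sum_squares_bound[of "g1 x" "g2 x"] by (simp add: power2_sum)
qed

lemma L2_per_integrable:
  assumes "g \<in> L2_per T" "0 < T"
  shows "g absolutely_integrable_on {a..b}"
  using L2_per_mult_integrable[OF assms(1) continuous_L2_per[of "\<lambda>x. 1"] assms(2)]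
  by (simp add: is_period_def)

section \<open>Weak derivatives and the Sobolev spaces\<close>

text \<open>The difference of the two sides changes by at most a multiple of \<open>\<bar>y - x\<bar> \<integral>\<^sub>x\<^sup>y \<bar>g\<bar>\<close> between \<open>x\<close>
  and \<open>y\<close>, so its derivative vanishes everywhere although \<open>G\<close> need not be differentiable.\<close>

lemma has_integral_by_parts_weak:
  fixes G g w w' :: "real \<Rightarrow> real"
  assumes G: "\<And>a b. a \<le> b \<Longrightarrow> (g has_integral G b - G a) {a..b}"
    and g: "\<And>a b. g absolutely_integrable_on {a..b}"
    and w: "\<And>x. (w has_real_derivative w' x) (at x)" and w': "continuous_on UNIV w'"
    and ab: "a \<le> b"
  shows "((\<lambda>x. g x * w x + G x * w' x) has_integral G b * w b - G a * w a) {a..b}"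
proof -
  have gint: "g integrable_on {x..y}" "(\<lambda>t. \<bar>g t\<bar>) integrable_on {x..y}" for x y
    using g[of x y] by (auto simp: absolutely_integrable_on_def)
  define N where "N y = integral {a..y} (\<lambda>t. \<bar>g t\<bar>)" for y
  have N_diff: "integral {x..y} (\<lambda>t. \<bar>g t\<bar>) = N y - N x" if "a \<le> x" "x \<le> y" for x y
    using Henstock_Kurzweil_Integration.integral_combine[OF that gint(2)] by (simp add: N_def)
  have contN: "continuous_on {a..b} N"
    unfolding N_def by (rule indefinite_integral_continuous_1[OF gint(2)])
  have contG: "continuous_on {a..b} G"
  proof -
    have "continuous_on {a..b} (\<lambda>y. G a + integral {a..y} g)"
      by (intro continuous_intros indefinite_integral_continuous_1 gint(1))
    moreover have "G a + integral {a..y} g = G y" if "y \<in> {a..b}" for y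
      using integral_unique[OF G[of a y]] that by simp
    ultimately show ?thesis by (rule continuous_on_eq)
  qed
  have cw: "continuous_on S w" for S
    using w by (meson DERIV_continuous_on DERIV_subset top_greatest)
  have cw': "continuous_on S w'" for S using w' continuous_on_subset by blast
  obtain M where M: "0 < M" "\<And>x. x \<in> {a..b} \<Longrightarrow> \<bar>w' x\<bar> \<le> M"
  proof -
    have "bounded (w' ` {a..b})"
      by (intro compact_imp_bounded compact_continuous_image cw') simp
    then show ?thesis using that unfolding bounded_pos by auto
  qed
  have w_lip: "\<bar>w y - w x\<bar> \<le> M * (y - x)" if xy: "a \<le> x" "x \<le> y" "y \<le> b" for x y
  proof (cases "x = y")
    case False
    then obtain z where "x < z" "z < y" "w y - w x = (y - x) * w' z"
      using MVT2[of x y w w'] w xy by auto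
    then show ?thesis using M(2)[of z] xy by (simp add: abs_mult mult.commute mult_right_mono)
  qed simp
  have gw: "(\<lambda>t. g t * v t) integrable_on {x..y}" if "continuous_on {x..y} v" for x y v
  proof -
    have "(\<lambda>t. v t * g t) absolutely_integrable_on {x..y}"
      by (rule absolutely_integrable_bounded_measurable_product_real[OF _ _ _ g])
        (use that in \<open>auto intro!: continuous_imp_measurable_on_sets_lebesgue compact_imp_bounded
          compact_continuous_image\<close>)
    then show ?thesis by (simp add: absolutely_integrable_on_def mult.commute)
  qed
  let ?f = "\<lambda>x. g x * w x + G x * w' x"
  have Gw: "(\<lambda>t. G t * w' t) integrable_on {x..y}" if "a \<le> x" "y \<le> b" for x y
    by (intro integrable_continuous_interval continuous_intros cw' continuous_on_subset[OF contG])
      (use that in auto)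
  have fint: "?f integrable_on {x..y}" if "a \<le> x" "y \<le> b" for x y
    using gw[OF cw] Gw[OF that] by (rule integrable_add)
  define D where "D y = G y * w y - integral {a..y} ?f" for y
  have D_bound: "\<bar>D y - D x\<bar> \<le> 2 * M * (y - x) * (N y - N x)" if xy: "a \<le> x" "x \<le> y" "y \<le> b" for x y
  proof -
    have "D y - D x = G y * w y - G x * w x - integral {x..y} ?f"
      using Henstock_Kurzweil_Integration.integral_combine[OF xy(1,2) fint] xy by (simp add: D_def)
    then have D_eq: "D y - D x = ((G y - G x) * w y + G x * (w y - w x)) - integral {x..y} ?f"
      by (simp add: algebra_simps)
    have w_int: "(w' has_integral w y - w x) {x..y}"
      using xy(2) by (rule fundamental_theorem_of_calculus)
        (simp add: has_real_derivative_iff_has_vector_derivative[symmetric] DERIV_subset[OF w])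
    \<comment> \<open>Freezing \<open>w\<close> at the right end and \<open>G\<close> at the left
      end integrates exactly to the increment of \<open>G * w\<close>. What remains of the integrand
      has one factor bounded by \<open>M * (y - x)\<close> or by \<open>N y - N x\<close> in each
      term.\<close>
    have "((\<lambda>t. g t * w y + G x * w' t) has_integral (G y - G x) * w y + G x * (w y - w x)) {x..y}"
      by (rule has_integral_add[OF has_integral_mult_left[OF G[OF xy(2)]]
            has_integral_mult_right[OF w_int]])
    from has_integral_diff[OF this integrable_integral[OF fint[OF xy(1,3)]]]
    have "((\<lambda>t. (g t * w y + G x * w' t) - ?f t) has_integral D y - D x) {x..y}"
      unfolding D_eq .
    then have I: "((\<lambda>t. g t * (w y - w t) + (G x - G t) * w' t) has_integral D y - D x) {x..y}"
      by (rule has_integral_eq[rotated]) (simp add: algebra_simps)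
    have le: "norm (g t * (w y - w t) + (G x - G t) * w' t) \<le> \<bar>g t\<bar> * (M * (y - x)) + (N y - N x) * M"
      if t: "t \<in> {x..y}" for t
    proof -
      have "\<bar>w y - w t\<bar> \<le> M * (y - x)"
        using w_lip[of t y] t xy M(1) by (smt (verit, ccfv_SIG) atLeastAtMost_iff mult_left_mono)
      then have 1: "\<bar>g t * (w y - w t)\<bar> \<le> \<bar>g t\<bar> * (M * (y - x))"
        by (simp add: abs_mult mult_left_mono)
      have "\<bar>G t - G x\<bar> \<le> integral {x..t} (\<lambda>t. \<bar>g t\<bar>)"
        using integral_norm_bound_integral[OF gint(1) gint(2), of x t] G[of x t] t
        by (auto simp: integral_unique)
      also have "\<dots> \<le> integral {x..y} (\<lambda>t. \<bar>g t\<bar>)"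
        using t by (intro integral_subset_le gint) auto
      finally have "\<bar>G x - G t\<bar> \<le> N y - N x" using N_diff xy by (simp add: abs_minus_commute)
      then have "\<bar>(G x - G t) * w' t\<bar> \<le> (N y - N x) * M"
        unfolding abs_mult using M(2)[of t] t xy by (intro mult_mono) auto
      with 1 show ?thesis by simp
    qed
    have N_int: "((\<lambda>t. \<bar>g t\<bar>) has_integral N y - N x) {x..y}"
      using integrable_integral[OF gint(2)[of x y]] unfolding N_diff[OF xy(1,2)] .
    have c_int: "((\<lambda>t. (N y - N x) * M) has_integral (y - x) * ((N y - N x) * M)) {x..y}"
      using has_integral_const_real[of "(N y - N x) * M" x y] xy by simp
    note J = has_integral_add[OF has_integral_mult_left[OF N_int, of "M * (y - x)"] c_int]
    have "norm (D y - D x) \<le> (N y - N x) * (M * (y - x)) + (y - x) * ((N y - N x) * M)"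
      using integral_norm_bound_integral[OF has_integral_integrable[OF I] has_integral_integrable[OF J] le]
      unfolding integral_unique[OF I] integral_unique[OF J] by blast
    then show ?thesis by (simp add: algebra_simps)
  qed
  have D_sym: "\<bar>D y - D x\<bar> \<le> 2 * M * \<bar>y - x\<bar> * \<bar>N y - N x\<bar>" if "x \<in> {a..b}" "y \<in> {a..b}" for x y
  proof (cases "x \<le> y")
    case True
    have "0 \<le> N y - N x" using N_diff[of x y] True that by (metis abs_ge_zero atLeastAtMost_iff integral_nonneg gint(2))
    then show ?thesis using D_bound[of x y] True that by simp
  next
    case False
    have "0 \<le> N x - N y" using N_diff[of y x] False that
      by (metis abs_ge_zero atLeastAtMost_iff integral_nonneg gint(2) linear)
    then show ?thesis using D_bound[of y x] False that by (simp add: abs_minus_commute)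
  qed
  \<comment> \<open>The difference quotient is at most \<open>2 * M * \<bar>N y - N x\<bar>\<close>,
    which tends to 0 by continuity of \<open>N\<close>.\<close>
  have "(D has_field_derivative 0) (at x within {a..b})" if x: "x \<in> {a..b}" for x
    unfolding has_field_derivative_iff
  proof (rule Lim_null_comparison)
    show "\<forall>\<^sub>F y in at x within {a..b}. norm ((D y - D x) / (y - x)) \<le> 2 * M * \<bar>N y - N x\<bar>"
      unfolding eventually_at_filter
    proof (intro always_eventually allI impI)
      fix y assume "y \<noteq> x" "y \<in> {a..b}"
      then show "norm ((D y - D x) / (y - x)) \<le> 2 * M * \<bar>N y - N x\<bar>"
        using D_sym[OF x, of y] by (simp add: field_simps abs_divide)
    qed
    have "(N \<longlongrightarrow> N x) (at x within {a..b})" using contN x by (auto simp: continuous_on_def)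
    then have "((\<lambda>y. 2 * M * \<bar>N y - N x\<bar>) \<longlongrightarrow> 2 * M * \<bar>N x - N x\<bar>) (at x within {a..b})"
      by (intro tendsto_intros)
    then show "((\<lambda>y. 2 * M * \<bar>N y - N x\<bar>) \<longlongrightarrow> 0) (at x within {a..b})" by simp
  qed
  then have "D b = D a"
    using has_field_derivative_zero_constant[of "{a..b}" D] ab by auto
  then have "integral {a..b} ?f = G b * w b - G a * w a" by (simp add: D_def)
  then show ?thesis using fint[of a b] by (metis integrable_integral order_refl)
qed

lemma is_weak_deriv_continuous:
  assumes "is_weak_deriv T h g"
  shows "continuous_on UNIV h"
proof -
  have int: "(g has_integral h b - h a) {a..b}" if "a \<le> b" for a b
    using assms that by (simp add: is_weak_deriv_def)
  have c: "continuous_on {-n..n} h" if "0 \<le> n" for n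
  proof -
    have "g integrable_on {-n..n}" using int[of "-n" n] that by auto
    then have "continuous_on {-n..n} (\<lambda>y. h (-n) + integral {-n..y} g)"
      by (intro continuous_intros indefinite_integral_continuous_1)
    then show ?thesis
    proof (rule continuous_on_eq)
      fix y assume "y \<in> {-n..n}"
      then show "h (-n) + integral {-n..y} g = h y" using integral_unique[OF int[of "-n" y]] by simp
    qed
  qed
  show ?thesis
    unfolding continuous_on_eq_continuous_at[OF open_UNIV]
  proof
    fix x :: real
    have "x \<in> interior {-(\<bar>x\<bar> + 1)..\<bar>x\<bar> + 1}" by auto
    then show "isCont h x" using c[of "\<bar>x\<bar> + 1"] continuous_on_interior by fastforce
  qed
qed

lemma is_weak_deriv_lincomb:
  assumes T: "0 < T" and "is_weak_deriv T h g" "is_weak_deriv T h' g'"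
  shows "is_weak_deriv T (\<lambda>x. s * h x + t * h' x) (\<lambda>x. s * g x + t * g' x)"
  unfolding is_weak_deriv_def
proof (intro conjI allI impI)
  show "(\<lambda>x. s * g x + t * g' x) \<in> L2_per T"
    using assms by (intro L2_per_add continuous_mult_L2_per) (auto simp: is_weak_deriv_def is_period_def)
  fix a b :: real assume "a \<le> b"
  then have "((\<lambda>x. s * g x + t * g' x) has_integral s * (h b - h a) + t * (h' b - h' a)) {a..b}"
    using assms by (intro has_integral_add has_integral_mult_right) (auto simp: is_weak_deriv_def)
  then show "((\<lambda>x. s * g x + t * g' x) has_integral s * h b + t * h' b - (s * h a + t * h' a)) {a..b}"
    by (simp add: algebra_simps)
qed

text \<open>Applied with \<open>deriv h\<close> in place of \<open>h\<close>, it provides a weak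
  derivative of \<open>K * deriv h\<close>, without which the choice in \<open>weak_deriv\<close>
  would be meaningless.\<close>

lemma is_weak_deriv_mult:
  assumes T: "0 < T" and h: "is_weak_deriv T h g" "is_period T h"
    and K: "\<And>x. (K has_real_derivative K1 x) (at x)" "continuous_on UNIV K1"
      "is_period T K" "is_period T K1"
  shows "is_weak_deriv T (\<lambda>x. K x * h x) (\<lambda>x. K x * g x + K1 x * h x)"
  unfolding is_weak_deriv_def
proof (intro conjI allI impI)
  have g: "g \<in> L2_per T" and int: "\<And>a b. a \<le> b \<Longrightarrow> (g has_integral h b - h a) {a..b}"
    using h by (auto simp: is_weak_deriv_def)
  have cK: "continuous_on UNIV K" using K(1) by (meson DERIV_continuous_on)
  have "(\<lambda>x. K1 x * h x) \<in> L2_per T"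
    using continuous_L2_per[OF is_weak_deriv_continuous[OF h(1)] h(2)]
    by (rule continuous_mult_L2_per[OF K(2,4) _ T])
  then show "(\<lambda>x. K x * g x + K1 x * h x) \<in> L2_per T"
    using continuous_mult_L2_per[OF cK K(3) g T] T by (intro L2_per_add)
  fix a b :: real assume "a \<le> b"
  from has_integral_by_parts_weak[OF int L2_per_integrable[OF g T] K(1,2) this]
  show "((\<lambda>x. K x * g x + K1 x * h x) has_integral K b * h b - K a * h a) {a..b}"
    by (simp add: mult.commute)
qed

lemma H2_perD:
  assumes "h \<in> H2_per T"
  shows "(h has_real_derivative deriv h x) (at x)" "is_period T h" "is_period T (deriv h)"
    "continuous_on UNIV (deriv h)" "continuous_on UNIV h" "\<exists>g. is_weak_deriv T (deriv h) g"
proof -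
  have "\<forall>x. h differentiable (at x)" using assms by (simp add: H2_per_def)
  then show d: "(h has_real_derivative deriv h x) (at x)" for x
    by (simp add: DERIV_deriv_iff_real_differentiable)
  show "is_period T h" "is_period T (deriv h)" and w: "\<exists>g. is_weak_deriv T (deriv h) g"
    using assms by (auto simp: H2_per_def H1_per_def)
  show "continuous_on UNIV (deriv h)" using is_weak_deriv_continuous w by blast
  show "continuous_on UNIV h" using d by (meson DERIV_continuous_on)
qed

lemma H2_perI:
  assumes "is_period T h" "\<And>x. (h has_real_derivative h1 x) (at x)" "is_period T h1"
    "is_weak_deriv T h1 g"
  shows "h \<in> H2_per T" "deriv h = h1"
proof -
  show d: "deriv h = h1" using assms(2) by (auto intro: DERIV_imp_deriv)
  show "h \<in> H2_per T"
    unfolding H2_per_def H1_per_def real_differentiable_def mem_Collect_eq d using assms by blast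
qed

lemma H2_per_lincomb:
  assumes T: "0 < T" and h: "h \<in> H2_per T" and k: "k \<in> H2_per T"
  shows "(\<lambda>x. s * h x + t * k x) \<in> H2_per T"
    "deriv (\<lambda>x. s * h x + t * k x) = (\<lambda>x. s * deriv h x + t * deriv k x)"
proof -
  obtain g g' where g: "is_weak_deriv T (deriv h) g" "is_weak_deriv T (deriv k) g'"
    using H2_perD(6)[OF h] H2_perD(6)[OF k] by blast
  have 1: "is_period T (\<lambda>x. s * h x + t * k x)" "is_period T (\<lambda>x. s * deriv h x + t * deriv k x)"
    using H2_perD(2,3)[OF h] H2_perD(2,3)[OF k] by (auto simp: is_period_def)
  have 2: "((\<lambda>x. s * h x + t * k x) has_real_derivative s * deriv h x + t * deriv k x) (at x)" for x
    by (intro DERIV_add DERIV_cmult H2_perD(1)[OF h] H2_perD(1)[OF k])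
  show "(\<lambda>x. s * h x + t * k x) \<in> H2_per T"
    "deriv (\<lambda>x. s * h x + t * k x) = (\<lambda>x. s * deriv h x + t * deriv k x)"
    using H2_perI[OF 1(1) 2 1(2) is_weak_deriv_lincomb[OF T g]] by auto
qed

lemma deriv_periodic:
  assumes "is_period T f" "\<And>x. (f has_real_derivative f1 x) (at x)"
  shows "is_period T f1"
  unfolding is_period_def
proof
  fix x
  have "((\<lambda>x. f (x + T)) has_real_derivative f1 (x + T)) (at x)"
    using assms(2)[of "x + T"] by (simp add: DERIV_shift)
  moreover have "(\<lambda>x. f (x + T)) = f" using assms(1) by (auto simp: is_period_def)
  ultimately show "f1 (x + T) = f1 x" using assms(2) DERIV_unique by metis
qed

section \<open>Reduction of block operators to a scalar Hill form\<close>

definition hill_form :: "real \<Rightarrow> (real \<Rightarrow> real) \<Rightarrow> (real \<Rightarrow> real) \<Rightarrow> (real \<Rightarrow> real) \<Rightarrow> (real \<Rightarrow> real) \<Rightarrow> real" where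
  "hill_form T K c h k = integral {0..T} (\<lambda>x. K x * deriv h x * deriv k x + c x * h x * k x)"

text \<open>The \<open>2 \<times> 2\<close> operators \<open>A_E\<close> and \<open>A_L\<close> share this shape, with \<open>-(K h')' + d h\<close> in the upper left
  corner.\<close>

definition block_op ::
  "real \<Rightarrow> (real \<Rightarrow> real) \<Rightarrow> (real \<Rightarrow> real) \<Rightarrow> (real \<Rightarrow> real) \<Rightarrow> (real \<Rightarrow> real) \<Rightarrow>
   (real \<Rightarrow> real \<times> real) \<Rightarrow> real \<Rightarrow> real \<times> real" where
  "block_op T K d \<beta> \<gamma> U x =
     (- weak_deriv T (\<lambda>s. K s * deriv (\<lambda>s. fst (U s)) s) x + d x * fst (U x) + \<beta> x * snd (U x),
      \<beta> x * fst (U x) + \<gamma> x * snd (U x))"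

locale block =
  fixes T :: real and K K1 d \<beta> \<gamma> :: "real \<Rightarrow> real"
  assumes T: "0 < T"
    and K: "\<And>x. (K has_real_derivative K1 x) (at x)" "continuous_on UNIV K1" "is_period T K"
    and d: "continuous_on UNIV d" "is_period T d"
    and \<beta>: "continuous_on UNIV \<beta>" "is_period T \<beta>"
    and \<gamma>: "continuous_on UNIV \<gamma>" "is_period T \<gamma>" "\<And>x. 0 < \<gamma> x"
begin

text \<open>The Schur complement: the zeroth order coefficient left after minimizing pointwise over
  the second component.\<close>

definition c where "c x = d x - (\<beta> x)\<^sup>2 / \<gamma> x"

lemma gam_nz: "\<gamma> x \<noteq> 0"
  using \<gamma>(3)[of x] by simp

lemma c_cont: "continuous_on UNIV c" and c_per: "is_period T c"
proof -
  show "continuous_on UNIV c"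
    unfolding c_def by (intro continuous_intros d \<beta> \<gamma>) (use gam_nz in auto)
  show "is_period T c" using d(2) \<beta>(2) \<gamma>(2) by (auto simp: is_period_def c_def)
qed

lemma K_cont: "continuous_on UNIV K"
  using K(1) by (meson DERIV_continuous_on)

lemma quot_cont: "continuous_on UNIV (\<lambda>x. \<beta> x / \<gamma> x)" and quot_per: "is_period T (\<lambda>x. \<beta> x / \<gamma> x)"
proof -
  show "continuous_on UNIV (\<lambda>x. \<beta> x / \<gamma> x)"
    by (intro continuous_intros \<beta> \<gamma>) (use gam_nz in auto)
  show "is_period T (\<lambda>x. \<beta> x / \<gamma> x)" using \<beta>(2) \<gamma>(2) by (simp add: is_period_def)
qed

lemma hill_form_integrable:
  assumes f: "f \<in> H2_per T" and g: "g \<in> H2_per T"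
  shows "(\<lambda>x. K x * deriv f x * deriv g x + c x * f x * g x) integrable_on {0..T}"
  by (intro integrable_continuous_interval continuous_intros
      continuous_on_subset[OF K_cont] continuous_on_subset[OF c_cont]
      continuous_on_subset[OF H2_perD(4)[OF f]] continuous_on_subset[OF H2_perD(4)[OF g]]
      continuous_on_subset[OF H2_perD(5)[OF f]] continuous_on_subset[OF H2_perD(5)[OF g]] subset_UNIV)

text \<open>Completing the square pointwise in the second component and integrating the weak
  derivative by parts. The integrability of the square is stated separately so that its integral can
  be bounded below.\<close>

lemma block_form:
  assumes U: "U \<in> op_domain T"
  defines "h \<equiv> \<lambda>x. fst (U x)" and "z \<equiv> \<lambda>x. snd (U x)"
  shows "integral {0..T} (\<lambda>x. block_op T K d \<beta> \<gamma> U x \<bullet> U x)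
     = hill_form T K c h h + integral {0..T} (\<lambda>x. \<gamma> x * (z x + \<beta> x / \<gamma> x * h x)\<^sup>2)"
    and "(\<lambda>x. \<gamma> x * (z x + \<beta> x / \<gamma> x * h x)\<^sup>2) integrable_on {0..T}"
proof -
  have h: "h \<in> H2_per T" and z: "z \<in> L2_per T" using U by (auto simp: op_domain_def h_def z_def)
  note hD = H2_perD[OF h]
  define w where "w = weak_deriv T (\<lambda>s. K s * deriv h s)"
  obtain g where g: "is_weak_deriv T (deriv h) g" using hD(6) by blast
  have w: "is_weak_deriv T (\<lambda>s. K s * deriv h s) w"
    unfolding w_def weak_deriv_def
    by (rule someI[where P = "is_weak_deriv T (\<lambda>s. K s * deriv h s)",
          OF is_weak_deriv_mult[OF T g hD(3) K deriv_periodic[OF K(3,1)]]])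
  have wL: "w \<in> L2_per T" using w by (simp add: is_weak_deriv_def)
  have hL: "h \<in> L2_per T" by (rule continuous_L2_per[OF hD(5,2)])
  \<comment> \<open>All boundary terms cancel by periodicity.\<close>
  have w_int: "((\<lambda>x. w x * h x + K x * deriv h x * deriv h x) has_integral 0) {0..T}"
  proof -
    have "f T = f 0" if "is_period T f" for f :: "real \<Rightarrow> real"
      using that unfolding is_period_def by (metis add_0)
    then have eq: "h T = h 0" "deriv h T = deriv h 0" "K T = K 0"
      using hD(2,3) K(3) by blast+
    have "((\<lambda>x. w x * h x + (K x * deriv h x) * deriv h x) has_integral
       (K T * deriv h T) * h T - (K 0 * deriv h 0) * h 0) {0..T}"
      by (rule has_integral_by_parts_weak[OF _ L2_per_integrable[OF wL T] hD(1,4)])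
        (use w T in \<open>auto simp: is_weak_deriv_def\<close>)
    then show ?thesis by (simp add: eq)
  qed
  have L: "(\<lambda>x. z x + \<beta> x / \<gamma> x * h x) \<in> L2_per T"
    by (intro L2_per_add z T continuous_mult_L2_per[OF quot_cont quot_per] hL)
  have "(\<lambda>x. (\<gamma> x * (z x + \<beta> x / \<gamma> x * h x)) * (z x + \<beta> x / \<gamma> x * h x)) absolutely_integrable_on {0..T}"
    by (intro L2_per_mult_integrable[OF _ L T] continuous_mult_L2_per[OF \<gamma>(1,2) L T])
  then show sq: "(\<lambda>x. \<gamma> x * (z x + \<beta> x / \<gamma> x * h x)\<^sup>2) integrable_on {0..T}"
    unfolding absolutely_integrable_on_def power2_eq_square mult.assoc by blast
  have "((\<lambda>x. (K x * deriv h x * deriv h x + c x * h x * h x) + \<gamma> x * (z x + \<beta> x / \<gamma> x * h x)\<^sup>2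
       - (w x * h x + K x * deriv h x * deriv h x)) has_integral
     hill_form T K c h h + integral {0..T} (\<lambda>x. \<gamma> x * (z x + \<beta> x / \<gamma> x * h x)\<^sup>2) - 0) {0..T}"
    unfolding hill_form_def
    by (intro has_integral_diff has_integral_add integrable_integral hill_form_integrable h sq w_int)
  moreover have "(K x * deriv h x * deriv h x + c x * h x * h x) + \<gamma> x * (z x + \<beta> x / \<gamma> x * h x)\<^sup>2
       - (w x * h x + K x * deriv h x * deriv h x) = block_op T K d \<beta> \<gamma> U x \<bullet> U x" for x
  proof -
    have "block_op T K d \<beta> \<gamma> U x \<bullet> U x
        = (- w x + d x * h x + \<beta> x * z x) * h x + (\<beta> x * h x + \<gamma> x * z x) * z x"
      unfolding block_op_def by (simp add: inner_prod_def w_def h_def z_def)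
    moreover have "(K x * deriv h x * deriv h x + c x * h x * h x) + \<gamma> x * (z x + \<beta> x / \<gamma> x * h x)\<^sup>2
       - (w x * h x + K x * deriv h x * deriv h x)
        = (- w x + d x * h x + \<beta> x * z x) * h x + (\<beta> x * h x + \<gamma> x * z x) * z x"
      using gam_nz[of x] by (simp add: c_def field_simps power2_eq_square)
    ultimately show ?thesis by simp
  qed
  ultimately show "integral {0..T} (\<lambda>x. block_op T K d \<beta> \<gamma> U x \<bullet> U x)
     = hill_form T K c h h + integral {0..T} (\<lambda>x. \<gamma> x * (z x + \<beta> x / \<gamma> x * h x)\<^sup>2)"
    by (simp add: integral_unique)
qed

lemma hill_form_lincomb:
  assumes h: "h \<in> H2_per T" and k: "k \<in> H2_per T"
  shows "hill_form T K c (\<lambda>x. s * h x + t * k x) (\<lambda>x. s * h x + t * k x)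
    = s\<^sup>2 * hill_form T K c h h + 2 * s * t * hill_form T K c h k + t\<^sup>2 * hill_form T K c k k"
proof -
  have "((\<lambda>x. s\<^sup>2 * (K x * deriv h x * deriv h x + c x * h x * h x)
       + (2 * s * t) * (K x * deriv h x * deriv k x + c x * h x * k x)
       + t\<^sup>2 * (K x * deriv k x * deriv k x + c x * k x * k x)) has_integral
     s\<^sup>2 * hill_form T K c h h + (2 * s * t) * hill_form T K c h k + t\<^sup>2 * hill_form T K c k k) {0..T}"
    unfolding hill_form_def
    by (intro has_integral_add has_integral_mult_right integrable_integral hill_form_integrable h k)
  then have "((\<lambda>x. K x * (s * deriv h x + t * deriv k x) * (s * deriv h x + t * deriv k x)
      + c x * (s * h x + t * k x) * (s * h x + t * k x)) has_integral
     s\<^sup>2 * hill_form T K c h h + (2 * s * t) * hill_form T K c h k + t\<^sup>2 * hill_form T K c k k) {0..T}"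
    by (rule has_integral_eq[rotated]) (simp add: algebra_simps power2_eq_square)
  then show ?thesis
    unfolding hill_form_def[of T K c "\<lambda>x. s * h x + t * k x"] H2_per_lincomb(2)[OF T h k]
    by (simp add: integral_unique)
qed

text \<open>The completed square is nonnegative, so conditions on the first component alone
  suffice.\<close>

lemma block_signature_le:
  fixes L :: "(real \<Rightarrow> real) \<Rightarrow> 'b::euclidean_space"
  assumes "linear (\<lambda>U :: real \<Rightarrow> real \<times> real. L (\<lambda>x. fst (U x)))"
    and "\<And>h. h \<in> H2_per T \<Longrightarrow> L h = 0 \<Longrightarrow> 0 \<le> hill_form T K c h h"
  shows "neg_signature_operator T (op_domain T) (block_op T K d \<beta> \<gamma>) \<le> ereal (real DIM('b))"
  unfolding neg_signature_operator_def
proof (rule neg_signature_le[OF assms(1)])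
  fix U :: "real \<Rightarrow> real \<times> real"
  assume U: "U \<in> op_domain T" "L (\<lambda>x. fst (U x)) = 0"
  have "0 \<le> integral {0..T} (\<lambda>x. \<gamma> x * (snd (U x) + \<beta> x / \<gamma> x * fst (U x))\<^sup>2)"
    using \<gamma>(3) by (intro integral_nonneg block_form(2) U) (simp add: less_imp_le)
  moreover have "0 \<le> hill_form T K c (\<lambda>x. fst (U x)) (\<lambda>x. fst (U x))"
    using assms(2) U by (simp add: op_domain_def)
  ultimately show "0 \<le> integral {0..T} (\<lambda>x. block_op T K d \<beta> \<gamma> U x \<bullet> U x)"
    unfolding block_form(1)[OF U(1)] by simp
qed

text \<open>The second component is the one that makes the completed square vanish, so the block
  form of a lift is exactly the Hill form; the lift is linear in \<open>h\<close>.\<close>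

definition lift :: "(real \<Rightarrow> real) \<Rightarrow> real \<Rightarrow> real \<times> real" where
  "lift h x = (h x, - (\<beta> x / \<gamma> x * h x))"

lemma lift_domain:
  assumes h: "h \<in> H2_per T"
  shows "lift h \<in> op_domain T"
proof -
  have "(\<lambda>x. - 1 * (\<beta> x / \<gamma> x * h x)) \<in> L2_per T"
    by (intro continuous_mult_L2_per[OF quot_cont quot_per] continuous_mult_L2_per[of "\<lambda>x. - 1"]
        continuous_L2_per H2_perD[OF h] T continuous_intros) (simp add: is_period_def)
  then show ?thesis using h by (simp add: op_domain_def lift_def)
qed

lemma lift_form:
  assumes h: "h \<in> H2_per T"
  shows "integral {0..T} (\<lambda>x. block_op T K d \<beta> \<gamma> (lift h) x \<bullet> lift h x) = hill_form T K c h h"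
  using block_form(1)[OF lift_domain[OF h]] by (simp add: lift_def)

lemma lift_lincomb: "s *\<^sub>R lift h + t *\<^sub>R lift k = lift (\<lambda>x. s * h x + t * k x)"
  by (simp add: fun_eq_iff lift_def scaleR_fun_def algebra_simps)

lemma block_signature_ge_1:
  assumes h: "h \<in> H2_per T" and neg: "hill_form T K c h h < 0"
  shows "1 \<le> neg_signature_operator T (op_domain T) (block_op T K d \<beta> \<gamma>)"
  unfolding neg_signature_operator_def
proof (rule neg_signature_ge_1[where U = "lift h", OF _ _ neg])
  fix s
  have s: "s *\<^sub>R lift h = lift (\<lambda>x. s * h x + 0 * h x)"
    using lift_lincomb[of s h 0 h] by simp
  show "s *\<^sub>R lift h \<in> op_domain T"
    unfolding s by (intro lift_domain H2_per_lincomb T h)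
  show "integral {0..T} (\<lambda>x. block_op T K d \<beta> \<gamma> (s *\<^sub>R lift h) x \<bullet> (s *\<^sub>R lift h) x)
      = s\<^sup>2 * hill_form T K c h h"
    unfolding s lift_form[OF H2_per_lincomb(1)[OF T h h]] hill_form_lincomb[OF h h] by simp
qed

lemma block_signature_ge_2:
  assumes h: "h \<in> H2_per T" and k: "k \<in> H2_per T"
    and neg: "hill_form T K c h h < 0"
    and det: "(hill_form T K c h k)\<^sup>2 < hill_form T K c h h * hill_form T K c k k"
  shows "2 \<le> neg_signature_operator T (op_domain T) (block_op T K d \<beta> \<gamma>)"
  unfolding neg_signature_operator_def
proof (rule neg_signature_ge_2[where U = "lift h" and V = "lift k", OF _ _ neg det])
  fix s t
  show "s *\<^sub>R lift h + t *\<^sub>R lift k \<in> op_domain T"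
    unfolding lift_lincomb by (intro lift_domain H2_per_lincomb T h k)
  show "integral {0..T} (\<lambda>x. block_op T K d \<beta> \<gamma> (s *\<^sub>R lift h + t *\<^sub>R lift k) x \<bullet>
        (s *\<^sub>R lift h + t *\<^sub>R lift k) x)
      = s\<^sup>2 * hill_form T K c h h + 2 * s * t * hill_form T K c h k + t\<^sup>2 * hill_form T K c k k"
    unfolding lift_lincomb lift_form[OF H2_per_lincomb(1)[OF T h k]] hill_form_lincomb[OF h k] ..
qed

end

section \<open>Smoothing of test functions and Picone's identity\<close>

lemma diff_quotient_LIMSEQ:
  fixes f :: "real \<Rightarrow> real"
  assumes "(f has_real_derivative D) (at x)"
  shows "(\<lambda>n. (f (x + 1 / Suc n) - f x) * Suc n) \<longlonglongrightarrow> D"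
proof -
  have "(\<lambda>n. 1 / real (Suc n)) \<longlonglongrightarrow> 0"
    using LIMSEQ_inverse_real_of_nat by (simp add: inverse_eq_divide)
  then have "filterlim (\<lambda>n. 1 / real (Suc n)) (at 0) sequentially"
    by (simp add: filterlim_at)
  moreover have "((\<lambda>h. (f (x + h) - f x) / h) \<longlongrightarrow> D) (at 0)" using assms by (simp add: DERIV_def)
  ultimately have "(\<lambda>n. (f (x + 1 / Suc n) - f x) / (1 / Suc n)) \<longlonglongrightarrow> D"
    by (rule filterlim_compose[rotated])
  then show ?thesis by simp
qed

text \<open>The averages of \<open>y\<close> over \<open>[x, x + 1 / Suc n]\<close> have the
  difference quotients of \<open>y\<close> as derivatives. These are bounded by the Lipschitz
  constant and converge at every point to \<open>g\<close>, which is what dominated convergence in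
  the form requires.\<close>

lemma steklov_approximation:
  fixes y g :: "real \<Rightarrow> real"
  assumes T: "0 < T" and per: "is_period T y"
    and lip: "\<And>x z. \<bar>y x - y z\<bar> \<le> L * \<bar>x - z\<bar>"
    and lim: "\<And>x. (\<lambda>n. (y (x + 1 / Suc n) - y x) * Suc n) \<longlonglongrightarrow> g x"
  obtains Y :: "nat \<Rightarrow> real \<Rightarrow> real" and M where
    "\<And>n. Y n \<in> H2_per T" "\<And>n x. \<bar>Y n x\<bar> \<le> M" "\<And>n x. \<bar>deriv (Y n) x\<bar> \<le> M"
    "\<And>x. (\<lambda>n. Y n x) \<longlonglongrightarrow> y x" "\<And>x. (\<lambda>n. deriv (Y n) x) \<longlonglongrightarrow> g x"
proof -
  have cy: "continuous_on UNIV y"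
  proof (rule continuous_onI)
    fix x e :: real assume "0 < e"
    have L0: "0 \<le> L" using lip[of 1 0] by simp
    show "\<exists>d>0. \<forall>x'\<in>UNIV. dist x' x < d \<longrightarrow> dist (y x') (y x) \<le> e"
    proof (intro exI[of _ "e / (L + 1)"] conjI ballI impI)
      show "0 < e / (L + 1)" using \<open>0 < e\<close> L0 by simp
      fix x' assume "dist x' x < e / (L + 1)"
      then have "\<bar>x' - x\<bar> * (L + 1) < e" using L0 by (simp add: dist_real_def field_simps)
      moreover have "L * \<bar>x' - x\<bar> \<le> \<bar>x' - x\<bar> * (L + 1)" by (simp add: algebra_simps)
      ultimately show "dist (y x') (y x) \<le> e" using lip[of x' x] by (simp add: dist_real_def)
    qed
  qed
  obtain F where F: "\<And>x. (F has_real_derivative y x) (at x)"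
    using einterval_antiderivative[of "-\<infinity>" "\<infinity>" y] cy
    by (auto simp: continuous_on_eq_continuous_at has_real_derivative_iff_has_vector_derivative)
  obtain M0 where M0: "0 < M0" "\<And>x. \<bar>y x\<bar> \<le> M0" using periodic_bounded[OF cy per T] by blast
  define Y where "Y n x = (F (x + 1 / Suc n) - F x) * Suc n" for n x
  define D where "D n x = (y (x + 1 / Suc n) - y x) * Suc n" for n x
  have dY: "(Y n has_real_derivative D n x) (at x)" for n x
  proof -
    have "((\<lambda>x. F (x + 1 / Suc n)) has_real_derivative y (x + 1 / Suc n)) (at x)"
      using F by (subst DERIV_shift[symmetric]) simp
    then show ?thesis unfolding Y_def D_def by (intro DERIV_cmult_right DERIV_diff F)
  qed
  have perD: "is_period T (D n)" for n
    unfolding is_period_def D_def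
  proof
    fix x
    have "x + T + 1 / Suc n = (x + 1 / Suc n) + T" by simp
    then show "(y (x + T + 1 / Suc n) - y (x + T)) * Suc n = (y (x + 1 / Suc n) - y x) * Suc n"
      using per unfolding is_period_def by metis
  qed
  have cD: "continuous_on UNIV (D n)" for n
    unfolding D_def by (intro continuous_intros continuous_on_compose2[OF cy]) auto
  have D_bound: "\<bar>D n x\<bar> \<le> L" for n x
    using lip[of "x + 1 / Suc n" x] unfolding D_def abs_mult by (simp add: field_simps)
  have g_bound: "\<bar>g x\<bar> \<le> L" for x
    using D_bound lim[of x] by (intro LIMSEQ_le_const2[OF tendsto_rabs[OF lim]]) (auto simp: D_def)
  have perY: "is_period T (Y n)" for n
  proof -
    have c: "F (x + T) - F x = F T - F 0" for x
    proof -
      have "((\<lambda>x. F (x + T) - F x) has_real_derivative 0) (at x)" for x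
      proof -
        have "((\<lambda>x. F (x + T)) has_real_derivative y (x + T)) (at x)"
          using F by (subst DERIV_shift[symmetric]) simp
        then have "((\<lambda>x. F (x + T) - F x) has_real_derivative y (x + T) - y x) (at x)"
          by (intro DERIV_diff F)
        then show ?thesis using per by (simp add: is_period_def)
      qed
      from DERIV_isconst_all[of "\<lambda>x. F (x + T) - F x" x 0] this show ?thesis by simp
    qed
    show ?thesis unfolding is_period_def Y_def
    proof
      fix x
      have "x + T + 1 / Suc n = (x + 1 / Suc n) + T" by simp
      then show "(F (x + T + 1 / Suc n) - F (x + T)) * Suc n = (F (x + 1 / Suc n) - F x) * Suc n"
        using c[of "x + 1 / Suc n"] c[of x] by (smt (verit))
    qed
  qed
  have Y_bound: "\<bar>Y n x\<bar> \<le> M0" for n x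
  proof -
    obtain z where "F (x + 1 / Suc n) - F x = (x + 1 / Suc n - x) * y z"
      using MVT2[of x "x + 1 / Suc n" F y] F by auto
    then have "Y n x = y z" by (simp add: Y_def)
    then show ?thesis using M0 by simp
  qed
  have Ylim: "(\<lambda>n. Y n x) \<longlonglongrightarrow> y x" for x
    unfolding Y_def by (rule diff_quotient_LIMSEQ[OF F])
  \<comment> \<open>The quotients \<open>D n\<close> are bounded by \<open>L\<close> and converge to
    \<open>g\<close>, so the fundamental theorem for \<open>Y n\<close> passes to the limit although
    \<open>y\<close> may have corners.\<close>
  have g_int: "(g has_integral y b - y a) {a..b}" if "a \<le> b" for a b
  proof -
    have Dint: "(D n has_integral Y n b - Y n a) {a..b}" for n
      by (rule fundamental_theorem_of_calculus[OF that])
        (simp add: has_real_derivative_iff_has_vector_derivative[symmetric] DERIV_subset[OF dY])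
    have "D n integrable_on {a..b}" for n using Dint by blast
    moreover have "(\<lambda>x. L) integrable_on {a..b}" by auto
    moreover have "norm (D n x) \<le> L" for n x using D_bound by simp
    moreover have "(\<lambda>n. D n x) \<longlonglongrightarrow> g x" for x using lim by (simp add: D_def)
    ultimately have *: "g integrable_on {a..b}" "(\<lambda>n. integral {a..b} (D n)) \<longlonglongrightarrow> integral {a..b} g"
      using dominated_convergence[of D "{a..b}" "\<lambda>x. L" g] by blast+
    have "(\<lambda>n. integral {a..b} (D n)) \<longlonglongrightarrow> y b - y a"
      unfolding integral_unique[OF Dint] by (intro tendsto_diff Ylim)
    then have "integral {a..b} g = y b - y a" using *(2) LIMSEQ_unique by blast
    then show ?thesis using integrable_integral[OF *(1)] by simp
  qed
  have perg: "is_period T g"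
    unfolding is_period_def
  proof
    fix x
    have "(\<lambda>n. D n (x + T)) \<longlonglongrightarrow> g (x + T)" using lim by (simp add: D_def)
    then have "(\<lambda>n. D n x) \<longlonglongrightarrow> g (x + T)" using perD by (simp add: is_period_def)
    then show "g (x + T) = g x" using lim[of x] LIMSEQ_unique unfolding D_def by blast
  qed
  have gm: "g \<in> borel_measurable lebesgue"
  proof (rule borel_measurable_LIMSEQ_real[where u = D])
    show "(\<lambda>n. D n x) \<longlonglongrightarrow> g x" for x using lim by (simp add: D_def)
    show "D n \<in> borel_measurable lebesgue" for n
      using continuous_L2_per[OF cD perD] by (simp add: L2_per_def)
  qed
  have gL: "g \<in> L2_per T"
  proof (rule L2_perI[OF gm perg, of "\<lambda>x. L\<^sup>2"])
    show "(g x)\<^sup>2 \<le> L\<^sup>2" for x using g_bound[of x] by (simp add: abs_le_square_iff[symmetric])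
  qed auto
  \<comment> \<open>The derivative of an average is a difference of two translates of
    \<open>y\<close>; its weak derivative is the same difference for \<open>g\<close>. This puts the
    averages in \<open>H2_per T\<close>.\<close>
  have wD: "is_weak_deriv T (D n) (\<lambda>x. (g (x + 1 / Suc n) - g x) * Suc n)" for n
  proof -
    let ?s = "\<lambda>x. x + 1 / real (Suc n)"
    have sh: "is_weak_deriv T (\<lambda>x. y (?s x)) (\<lambda>x. g (?s x))"
      unfolding is_weak_deriv_def
    proof (intro conjI allI impI)
      show "(\<lambda>x. g (?s x)) \<in> L2_per T"
      proof (rule L2_perI[of _ _ "\<lambda>x. L\<^sup>2"])
        show "(\<lambda>x. g (?s x)) \<in> borel_measurable lebesgue"
        proof (rule borel_measurable_LIMSEQ_real[where u = "\<lambda>k x. D k (?s x)"])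
          show "(\<lambda>k. D k (?s x)) \<longlonglongrightarrow> g (?s x)" for x using lim by (simp add: D_def)
          have "continuous_on UNIV (\<lambda>x. D k (?s x))" for k
            by (intro continuous_on_compose2[OF cD] continuous_intros) auto
          then show "(\<lambda>x. D k (?s x)) \<in> borel_measurable lebesgue" for k
            by (intro measurable_completion) (simp add: borel_measurable_continuous_onI)
        qed
        have "?s (x + T) = ?s x + T" for x by simp
        then show "is_period T (\<lambda>x. g (?s x))" using perg unfolding is_period_def by metis
        show "(g (?s x))\<^sup>2 \<le> L\<^sup>2" for x
          using g_bound[of "?s x"] by (simp add: abs_le_square_iff[symmetric])
      qed auto
      fix a b :: real assume "a \<le> b"
      then have "(g has_integral y (?s b) - y (?s a)) {?s a..?s b}" by (intro g_int) simp
      then show "((\<lambda>x. g (?s x)) has_integral y (?s b) - y (?s a)) {a..b}"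
        using has_integral_shift_Icc_real[of g "1 / Suc n" "y (?s b) - y (?s a)" a b]
        by (simp add: o_def add.commute)
    qed
    have "is_weak_deriv T y g" using gL g_int by (simp add: is_weak_deriv_def)
    from is_weak_deriv_lincomb[OF T sh this, of "real (Suc n)" "- real (Suc n)"]
    show ?thesis by (simp add: D_def[abs_def] algebra_simps)
  qed
  have H2: "Y n \<in> H2_per T" "deriv (Y n) = D n" for n
    using H2_perI[OF perY dY perD wD] by auto
  show ?thesis
  proof (rule that[of Y "max M0 L"])
    show "\<bar>Y n x\<bar> \<le> max M0 L" for n x using Y_bound[of n x] by simp
    show "\<bar>deriv (Y n) x\<bar> \<le> max M0 L" for n x using D_bound[of n x] by (simp add: H2)
    show "(\<lambda>n. deriv (Y n) x) \<longlonglongrightarrow> g x" for x using lim by (simp add: H2 D_def)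
  qed (auto intro: H2 Ylim)
qed

text \<open>Picone's identity \<open>K g'\<^sup>2 + c g\<^sup>2 = K (g' - g \<phi>'/\<phi>)\<^sup>2 + (K \<phi>' g\<^sup>2/\<phi>)'\<close>; at the endpoints
  \<open>g\<^sup>2/\<phi>\<close> tends to its junk value \<open>0\<close> since the zeros of \<open>\<phi>\<close> are simple.\<close>

lemma picone_nonneg:
  fixes K c \<phi> \<phi>1 g g1 :: "real \<Rightarrow> real"
  assumes ab: "a < b" and K: "continuous_on {a..b} K" "\<And>x. x \<in> {a..b} \<Longrightarrow> 0 < K x" and c: "continuous_on {a..b} c"
    and \<phi>: "\<And>x. (\<phi> has_real_derivative \<phi>1 x) (at x)"
      "\<And>x. ((\<lambda>x. K x * \<phi>1 x) has_real_derivative c x * \<phi> x) (at x)"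
      "\<phi> a = 0" "\<phi> b = 0" "\<phi>1 a \<noteq> 0" "\<phi>1 b \<noteq> 0" "\<And>x. a < x \<Longrightarrow> x < b \<Longrightarrow> \<phi> x \<noteq> 0"
    and g: "\<And>x. (g has_real_derivative g1 x) (at x)" "continuous_on {a..b} g1" "g a = 0" "g b = 0"
  shows "0 \<le> integral {a..b} (\<lambda>x. K x * (g1 x)\<^sup>2 + c x * (g x)\<^sup>2)"
proof -
  define w where "w x = K x * \<phi>1 x * ((g x)\<^sup>2 / \<phi> x)" for x
  have dw: "(w has_real_derivative
      K x * (g1 x)\<^sup>2 + c x * (g x)\<^sup>2 - K x * (g1 x - g x * \<phi>1 x / \<phi> x)\<^sup>2) (at x)"
    if x: "a < x" "x < b" for x
  proof -
    have nz: "\<phi> x \<noteq> 0" using \<phi>(7) x by blast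
    have "(w has_real_derivative (c x * \<phi> x) * ((g x)\<^sup>2 / \<phi> x)
        + (2 * g x * g1 x * \<phi> x - (g x)\<^sup>2 * \<phi>1 x) / (\<phi> x * \<phi> x) * (K x * \<phi>1 x)) (at x)"
      unfolding w_def
      by (rule DERIV_mult[OF \<phi>(2)])
        (use nz in \<open>auto intro!: derivative_eq_intros \<phi>(1) g(1) simp: power2_eq_square\<close>)
    moreover have "(c x * \<phi> x) * ((g x)\<^sup>2 / \<phi> x)
        + (2 * g x * g1 x * \<phi> x - (g x)\<^sup>2 * \<phi>1 x) / (\<phi> x * \<phi> x) * (K x * \<phi>1 x)
      = K x * (g1 x)\<^sup>2 + c x * (g x)\<^sup>2 - K x * (g1 x - g x * \<phi>1 x / \<phi> x)\<^sup>2"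
      using nz by (simp add: field_simps power2_eq_square)
    ultimately show ?thesis by simp
  qed
  have quot: "((\<lambda>x. (g x)\<^sup>2 / \<phi> x) \<longlongrightarrow> 0) (at z)"
    if "\<phi> z = 0" "\<phi>1 z \<noteq> 0" "g z = 0" for z
  proof -
    \<comment> \<open>One factor \<open>g\<close> tends to 0, and the other divided by \<phi> is a
      ratio of difference quotients with finite limit because the zero of \<phi> is simple.\<close>
    have "((\<lambda>x. (g x - g z) * (((g x - g z) / (x - z)) / ((\<phi> x - \<phi> z) / (x - z)))) \<longlongrightarrow>
        (g z - g z) * (g1 z / \<phi>1 z)) (at z)"
      using \<phi>(1)[of z] g(1)[of z] that(2)
      by (intro tendsto_intros isContD[OF DERIV_isCont[OF g(1)]]) (auto simp: has_field_derivative_iff)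
    then have lim: "((\<lambda>x. (g x - g z) * (((g x - g z) / (x - z)) / ((\<phi> x - \<phi> z) / (x - z)))) \<longlongrightarrow> 0) (at z)"
      by simp
    show ?thesis
      by (rule Lim_transform_eventually[OF lim])
        (auto simp: eventually_at_filter that power2_eq_square)
  qed
  have cKphi: "isCont (\<lambda>x. K x * \<phi>1 x) z" for z using \<phi>(2) DERIV_isCont by blast
  have "continuous_on {a..b} w"
    unfolding continuous_on_eq_continuous_within
  proof
    fix z assume z: "z \<in> {a..b}"
    show "continuous (at z within {a..b}) w"
    proof (cases "z = a \<or> z = b")
      case True
      then have "((\<lambda>x. (g x)\<^sup>2 / \<phi> x) \<longlongrightarrow> 0) (at z)" using quot \<phi> g by blast
      then have "(w \<longlongrightarrow> K z * \<phi>1 z * 0) (at z)"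
        unfolding w_def using isContD[OF cKphi] by (rule tendsto_mult[rotated])
      moreover have "w z = 0" using True g by (auto simp: w_def)
      ultimately show ?thesis
        unfolding continuous_within using tendsto_within_subset subset_UNIV by fastforce
    next
      case False
      then show ?thesis using dw[of z] z DERIV_isCont continuous_at_imp_continuous_at_within by force
    qed
  qed
  then have I: "((\<lambda>x. K x * (g1 x)\<^sup>2 + c x * (g x)\<^sup>2 - K x * (g1 x - g x * \<phi>1 x / \<phi> x)\<^sup>2)
      has_integral w b - w a) {a..b}"
    using ab dw by (intro fundamental_theorem_of_calculus_interior)
      (auto simp: has_real_derivative_iff_has_vector_derivative)
  have J: "(\<lambda>x. K x * (g1 x)\<^sup>2 + c x * (g x)\<^sup>2) integrable_on {a..b}"
    using DERIV_continuous_on[OF DERIV_subset[OF g(1)], of "{a..b}"]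
    by (intro integrable_continuous_interval continuous_intros K c g(2)) auto
  have "w b - w a \<le> integral {a..b} (\<lambda>x. K x * (g1 x)\<^sup>2 + c x * (g x)\<^sup>2)"
    using K(2) by (intro has_integral_le[OF I integrable_integral[OF J]]) (simp add: less_imp_le)
  moreover have "w b - w a = 0" using g by (simp add: w_def)
  ultimately show ?thesis by simp
qed

section \<open>The index of a Hill operator with a known periodic solution\<close>

lemma shift_LIMSEQ:
  fixes f :: "real \<Rightarrow> real"
  assumes "isCont f x"
  shows "(\<lambda>n. f (x + 1 / Suc n)) \<longlonglongrightarrow> f x"
proof -
  have "(\<lambda>n. x + 1 / real (Suc n)) \<longlonglongrightarrow> x + 0"
    using LIMSEQ_inverse_real_of_nat by (intro tendsto_intros) (simp add: inverse_eq_divide)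
  then show ?thesis using isCont_tendsto_compose[OF assms] by simp
qed

text \<open>Where \<open>f\<close> is nonzero its sign persists nearby. At a zero, taking the
  positive part commutes with the positive factor \<open>Suc n\<close>, so the limit is the positive
  part of the slope.\<close>

lemma max_diff_quotient_LIMSEQ:
  fixes f f1 :: "real \<Rightarrow> real"
  assumes "(f has_real_derivative f1 x) (at x)"
  shows "(\<lambda>n. (max (f (x + 1 / Suc n)) 0 - max (f x) 0) * Suc n) \<longlonglongrightarrow>
    (if f x > 0 then f1 x else if f x < 0 then 0 else max (f1 x) 0)"
proof -
  note Q = diff_quotient_LIMSEQ[OF assms] and S = shift_LIMSEQ[OF DERIV_isCont[OF assms]]
  consider "f x > 0" | "f x < 0" | "f x = 0" by linarith
  then show ?thesis
  proof cases
    case 1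
    from order_tendstoD(1)[OF S 1]
    have "\<forall>\<^sub>F n in sequentially. (f (x + 1 / Suc n) - f x) * Suc n
        = (max (f (x + 1 / Suc n)) 0 - max (f x) 0) * Suc n"
      by eventually_elim (use 1 in simp)
    from Lim_transform_eventually[OF Q this] 1 show ?thesis by simp
  next
    case 2
    from order_tendstoD(2)[OF S 2]
    have "\<forall>\<^sub>F n in sequentially. 0 = (max (f (x + 1 / Suc n)) 0 - max (f x) 0) * Suc n"
      by eventually_elim (use 2 in simp)
    from Lim_transform_eventually[OF tendsto_const this] 2 show ?thesis by simp
  next
    case 3
    have "max (z * real (Suc n)) 0 = max z 0 * real (Suc n)" for z n
      by (simp add: max_def zero_le_mult_iff mult_le_0_iff)
    then show ?thesis using tendsto_max[OF Q tendsto_const[of 0]] 3 by simp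
  qed
qed

lemma lipschitz_of_deriv_bound:
  fixes f f1 :: "real \<Rightarrow> real"
  assumes f: "\<And>t. t \<in> {l..r} \<Longrightarrow> (f has_real_derivative f1 t) (at t)"
    and M: "\<And>t. t \<in> {l..r} \<Longrightarrow> \<bar>f1 t\<bar> \<le> M" and "x \<in> {l..r}" "z \<in> {l..r}"
  shows "\<bar>f x - f z\<bar> \<le> M * \<bar>x - z\<bar>"
proof -
  have *: "\<bar>f u - f t\<bar> \<le> M * \<bar>u - t\<bar>" if tu: "t < u" "l \<le> t" "u \<le> r" for t u
  proof -
    obtain s where "t < s" "s < u" "f u - f t = (u - t) * f1 s" using MVT2[of t u f f1] f tu by auto
    moreover have "\<bar>f1 s\<bar> \<le> M" using M tu calculation by auto
    ultimately show ?thesis using tu by (simp add: abs_mult mult.commute mult_right_mono)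
  qed
  show ?thesis
    using *[of x z] *[of z x] assms(3,4) by (cases x z rule: linorder_cases) (auto simp: abs_minus_commute)
qed

text \<open>Within one cell the increments agree with those of \<open>f\<close>. Across cells the
  values are compared through the common value of \<open>f\<close> at \<open>a\<close> and
  \<open>a + T\<close>.\<close>

lemma lipschitz_periodization:
  fixes f :: "real \<Rightarrow> real"
  assumes T: "0 < T" and f: "\<And>x z. x \<in> {a..a + T} \<Longrightarrow> z \<in> {a..a + T} \<Longrightarrow> \<bar>f x - f z\<bar> \<le> L * \<bar>x - z\<bar>"
    and eq: "f (a + T) = f a"
  defines "r \<equiv> \<lambda>x. x - of_int \<lfloor>(x - a) / T\<rfloor> * T"
  shows "\<bar>f (r x) - f (r z)\<bar> \<le> L * \<bar>x - z\<bar>"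
proof -
  have L: "0 \<le> L" using f[of a "a + T"] eq T by (simp add: zero_le_mult_iff)
  have r: "a \<le> r x" "r x < a + T" for x
  proof -
    have "of_int \<lfloor>(x - a) / T\<rfloor> * T \<le> (x - a) / T * T" using T by (intro mult_right_mono) auto
    moreover have "(x - a) / T * T < (of_int \<lfloor>(x - a) / T\<rfloor> + 1) * T"
      using T by (intro mult_strict_right_mono) auto
    moreover have "(x - a) / T * T = x - a" using T by simp
    ultimately show "a \<le> r x" "r x < a + T" unfolding r_def distrib_right by linarith+
  qed
  have *: "\<bar>f (r x) - f (r z)\<bar> \<le> L * \<bar>x - z\<bar>" if "x \<le> z" for x z
  proof (cases "\<lfloor>(x - a) / T\<rfloor> = \<lfloor>(z - a) / T\<rfloor>")
    case True
    then have "r x - r z = x - z" by (simp add: r_def)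
    then show ?thesis using f[of "r x" "r z"] r[of x] r[of z] by simp
  next
    case False
    have "(x - a) / T \<le> (z - a) / T" using that T by (simp add: divide_right_mono)
    then have "\<lfloor>(x - a) / T\<rfloor> \<le> \<lfloor>(z - a) / T\<rfloor>" by (rule floor_mono)
    with False have "\<lfloor>(x - a) / T\<rfloor> + 1 \<le> \<lfloor>(z - a) / T\<rfloor>" by simp
    then have "(of_int \<lfloor>(x - a) / T\<rfloor> + 1) * T \<le> of_int \<lfloor>(z - a) / T\<rfloor> * T"
      using T by (intro mult_right_mono) linarith+
    \<comment> \<open>The distance from \<open>r x\<close> to the right end of its cell plus that
      from the left end to \<open>r z\<close> does not exceed \<open>z - x\<close>: at least one
      cell boundary separates the two points.\<close>
    then have d: "(a + T - r x) + (r z - a) \<le> z - x" by (simp add: r_def algebra_simps)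
    have "\<bar>f (r x) - f (r z)\<bar> \<le> \<bar>f (r x) - f (a + T)\<bar> + \<bar>f a - f (r z)\<bar>" using eq by simp
    also have "\<dots> \<le> L * \<bar>r x - (a + T)\<bar> + L * \<bar>a - r z\<bar>"
      using r[of x] r[of z] T by (intro add_mono f) auto
    also have "\<dots> = L * ((a + T - r x) + (r z - a))"
      using r[of x] r[of z] by (simp add: algebra_simps)
    also have "\<dots> \<le> L * (z - x)" using d L by (rule mult_left_mono)
    finally show ?thesis using that by simp
  qed
  show ?thesis using *[of x z] *[of z x] by (cases "x \<le> z") (auto simp: abs_minus_commute)
qed

text \<open>Translation by \<open>T\<close> acts on \<phi> and \<psi> as a shear, with \<tau> as its
  only invariant. The zeros \<open>a\<close> and \<open>b\<close> cut the period into two nodal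
  intervals of \<phi>.\<close>

locale hill = block +
  fixes \<phi> \<phi>1 \<psi> \<psi>1 :: "real \<Rightarrow> real" and \<tau> a b :: real
  assumes K_pos: "\<And>x. 0 < K x"
    and \<phi>: "\<And>x. (\<phi> has_real_derivative \<phi>1 x) (at x)"
      "\<And>x. ((\<lambda>x. K x * \<phi>1 x) has_real_derivative c x * \<phi> x) (at x)" "is_period T \<phi>"
    and ab: "a < b" "b < a + T" "\<phi> a = 0" "\<phi> b = 0"
      "\<And>x. a < x \<Longrightarrow> x < b \<Longrightarrow> 0 < \<phi> x" "\<And>x. b < x \<Longrightarrow> x < a + T \<Longrightarrow> \<phi> x < 0"
    and \<psi>: "\<And>x. (\<psi> has_real_derivative \<psi>1 x) (at x)" "continuous_on UNIV \<psi>1"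
      "\<And>x. K x * (\<phi> x * \<psi>1 x - \<phi>1 x * \<psi> x) = 1" "\<And>x. \<psi> (x + T) = \<psi> x - \<tau> * \<phi> x"
begin

lemma K_nz: "K x \<noteq> 0"
  using K_pos[of x] by simp

lemma phi1_cont: "continuous_on UNIV \<phi>1"
proof -
  have "continuous_on UNIV (\<lambda>x. (K x * \<phi>1 x) / K x)"
    by (rule continuous_on_divide[OF DERIV_continuous_on[OF \<phi>(2)] K_cont]) (simp add: K_nz)
  then show ?thesis using K_nz by simp
qed

lemma phi1_per: "is_period T \<phi>1"
  by (rule deriv_periodic[OF \<phi>(3,1)])

lemma phi_aT: "\<phi> (a + T) = 0"
  using \<phi>(3) ab by (simp add: is_period_def)

lemma wronskian_at_zero: "\<phi> x = 0 \<Longrightarrow> K x * \<phi>1 x * \<psi> x = - 1"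
  using \<psi>(3)[of x] by (simp add: algebra_simps)

lemma simple_zero: "\<phi> x = 0 \<Longrightarrow> \<phi>1 x \<noteq> 0" "\<phi> x = 0 \<Longrightarrow> \<psi> x \<noteq> 0"
  using wronskian_at_zero[of x] by auto

lemma psi_aT: "\<psi> (a + T) = \<psi> a"
  using \<psi>(4)[of a] ab by simp

lemma psi1_shift: "\<psi>1 (x + T) = \<psi>1 x - \<tau> * \<phi>1 x"
proof -
  have "((\<lambda>x. \<psi> (x + T)) has_real_derivative \<psi>1 (x + T)) (at x)"
    using \<psi>(1)[of "x + T"] by (simp add: DERIV_shift)
  moreover have "((\<lambda>x. \<psi> x - \<tau> * \<phi> x) has_real_derivative \<psi>1 x - \<tau> * \<phi>1 x) (at x)"
    by (intro DERIV_diff DERIV_cmult \<psi>(1) \<phi>(1))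
  ultimately show ?thesis using \<psi>(4) DERIV_unique by simp
qed

lemma phi_by_parts:
  assumes w: "\<And>x. (w has_real_derivative w1 x) (at x)" and "x \<le> y"
  shows "((\<lambda>x. K x * \<phi>1 x * w1 x + c x * \<phi> x * w x) has_integral
    K y * \<phi>1 y * w y - K x * \<phi>1 x * w x) {x..y}"
proof (rule fundamental_theorem_of_calculus[OF \<open>x \<le> y\<close>])
  fix z
  have "((\<lambda>x. K x * \<phi>1 x * w x) has_real_derivative (c z * \<phi> z) * w z + w1 z * (K z * \<phi>1 z)) (at z)"
    by (rule DERIV_mult[OF \<phi>(2) w])
  then have "((\<lambda>x. K x * \<phi>1 x * w x) has_real_derivative K z * \<phi>1 z * w1 z + c z * \<phi> z * w z) (at z)"
    by (simp add: algebra_simps)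
  then show "((\<lambda>x. K x * \<phi>1 x * w x) has_vector_derivative K z * \<phi>1 z * w1 z + c z * \<phi> z * w z) (at z within {x..y})"
    unfolding has_real_derivative_iff_has_vector_derivative[symmetric]
    by (rule has_field_derivative_at_within)
qed

text \<open>Away from the zeros of \<open>\<phi>\<close> the Wronskian identity gives \<open>K \<psi>' = (1 + K \<phi>' \<psi>) / \<phi>\<close>, hence
  \<open>(K \<psi>')' = c \<psi>\<close>.\<close>

lemma K_psi1_deriv:
  assumes nz: "\<phi> x \<noteq> 0"
  shows "((\<lambda>x. K x * \<psi>1 x) has_real_derivative c x * \<psi> x) (at x)"
proof -
  have eq: "(1 + K y * \<phi>1 y * \<psi> y) / \<phi> y = K y * \<psi>1 y" if "\<phi> y \<noteq> 0" for y
    using \<psi>(3)[of y] that by (simp add: field_simps)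
  have "((\<lambda>x. (1 + K x * \<phi>1 x * \<psi> x) / \<phi> x) has_real_derivative
      ((0 + ((c x * \<phi> x) * \<psi> x + \<psi>1 x * (K x * \<phi>1 x))) * \<phi> x - (1 + K x * \<phi>1 x * \<psi> x) * \<phi>1 x) / (\<phi> x * \<phi> x)) (at x)"
    by (intro DERIV_divide DERIV_add DERIV_const DERIV_mult[OF \<phi>(2) \<psi>(1)] \<phi>(1) nz)
  moreover have "((0 + ((c x * \<phi> x) * \<psi> x + \<psi>1 x * (K x * \<phi>1 x))) * \<phi> x - (1 + K x * \<phi>1 x * \<psi> x) * \<phi>1 x) / (\<phi> x * \<phi> x)
      = c x * \<psi> x"
  proof -
    have "1 + K x * \<phi>1 x * \<psi> x = K x * \<psi>1 x * \<phi> x" using eq[OF nz] nz by (simp add: field_simps)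
    then show ?thesis using nz by (simp add: field_simps)
  qed
  ultimately have D: "((\<lambda>x. (1 + K x * \<phi>1 x * \<psi> x) / \<phi> x) has_real_derivative c x * \<psi> x) (at x)" by simp
  have "continuous_on UNIV \<phi>" using \<phi>(1) by (meson DERIV_continuous_on)
  then have "open {x. \<phi> x \<noteq> 0}" by (intro open_Collect_neq continuous_intros)
  then show ?thesis
    by (rule has_field_derivative_transform_within_open[OF D]) (use nz eq in auto)
qed

text \<open>The equation of \<psi> is available only where \<phi> is nonzero. The interior zero
  \<open>b\<close> is an exceptional point in the fundamental theorem, and continuity of
  \<open>K * \<psi>1\<close> bridges it.\<close>

lemma psi_by_parts:
  assumes w: "\<And>x. (w has_real_derivative w1 x) (at x)" and xy: "a \<le> x" "x \<le> y" "y \<le> a + T"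
  shows "((\<lambda>x. K x * \<psi>1 x * w1 x + c x * \<psi> x * w x) has_integral
    K y * \<psi>1 y * w y - K x * \<psi>1 x * w x) {x..y}"
proof (rule fundamental_theorem_of_calculus_interior_strong[of "{b}", OF _ xy(2)])
  fix z assume z: "z \<in> {x<..<y} - {b}"
  then have "\<phi> z \<noteq> 0" using ab(5)[of z] ab(6)[of z] xy by (cases z b rule: linorder_cases) auto
  then have "((\<lambda>x. K x * \<psi>1 x * w x) has_real_derivative (c z * \<psi> z) * w z + w1 z * (K z * \<psi>1 z)) (at z)"
    by (intro DERIV_mult K_psi1_deriv w)
  then show "((\<lambda>x. K x * \<psi>1 x * w x) has_vector_derivative K z * \<psi>1 z * w1 z + c z * \<psi> z * w z) (at z)"
    unfolding has_real_derivative_iff_has_vector_derivative[symmetric] by (simp add: algebra_simps)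
next
  have "continuous_on UNIV w" using w by (meson DERIV_continuous_on)
  then show "continuous_on {x..y} (\<lambda>x. K x * \<psi>1 x * w x)"
    by (intro continuous_intros continuous_on_subset[OF K_cont] continuous_on_subset[OF \<psi>(2)])
      (auto intro: continuous_on_subset)
qed simp

text \<open>Over one period \<psi> returns to its value at \<open>a\<close> while its slope changes
  by \<open>- \<tau> * \<phi>1 a\<close>; the Wronskian at the zero \<open>a\<close> turns this
  boundary term into exactly \<tau>.\<close>

lemma psi_form: "((\<lambda>x. K x * \<psi>1 x * \<psi>1 x + c x * \<psi> x * \<psi> x) has_integral \<tau>) {a..a + T}"
proof -
  have "K (a + T) = K a" using K(3) by (simp add: is_period_def)
  then have "K (a + T) * \<psi>1 (a + T) * \<psi> (a + T) - K a * \<psi>1 a * \<psi> a = - \<tau> * (K a * \<phi>1 a * \<psi> a)"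
    unfolding psi1_shift psi_aT by (simp add: algebra_simps)
  also have "\<dots> = \<tau>" using wronskian_at_zero[OF ab(3)] by simp
  finally show ?thesis using psi_by_parts[OF \<psi>(1), of a "a + T"] T by simp
qed

lemma hill_form_shift:
  assumes h: "h \<in> H2_per T" and k: "k \<in> H2_per T"
  shows "hill_form T K c h k = integral {a..a + T} (\<lambda>x. K x * deriv h x * deriv k x + c x * h x * k x)"
  unfolding hill_form_def
proof (rule periodic_integral_shift[symmetric, OF _ _ T])
  show "continuous_on UNIV (\<lambda>x. K x * deriv h x * deriv k x + c x * h x * k x)"
    by (intro continuous_intros K_cont c_cont H2_perD[OF h] H2_perD[OF k])
  show "is_period T (\<lambda>x. K x * deriv h x * deriv k x + c x * h x * k x)"
    using K(3) c_per H2_perD(2,3)[OF h] H2_perD(2,3)[OF k] by (simp add: is_period_def)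
qed

text \<open>The condition at \<open>b\<close> makes the remainder \<open>g\<close> vanish at
  \<open>a\<close>, \<open>b\<close> and \<open>a + T\<close>, so Picone's inequality applies on
  both nodal intervals. The disjunction serves both counts: one condition when \<tau> is
  nonnegative, two in general.\<close>

lemma hill_form_nonneg:
  assumes h: "h \<in> H2_per T" and hb: "h b = h a / \<psi> a * \<psi> b" and sign: "0 \<le> \<tau> \<or> h a = 0"
  shows "0 \<le> hill_form T K c h h"
proof -
  define q where "q = h a / \<psi> a"
  define g where "g x = h x - q * \<psi> x" for x
  define g1 where "g1 x = deriv h x - q * \<psi>1 x" for x
  have dg: "(g has_real_derivative g1 x) (at x)" for x
    unfolding g_def g1_def by (intro DERIV_diff DERIV_cmult \<psi>(1) H2_perD(1)[OF h])
  have cg1: "continuous_on S g1" for S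
    unfolding g1_def by (intro continuous_intros continuous_on_subset[OF \<psi>(2)]
        continuous_on_subset[OF H2_perD(4)[OF h]] subset_UNIV)
  have cg: "continuous_on S g" for S
    using dg by (meson DERIV_continuous_on DERIV_subset top_greatest)
  have haT: "h (a + T) = h a" using H2_perD(2)[OF h] by (simp add: is_period_def)
  have g0: "g a = 0" "g b = 0" "g (a + T) = 0"
    using simple_zero(2)[OF ab(3)] hb haT psi_aT by (simp_all add: g_def q_def)
  have i3: "(\<lambda>x. K x * (g1 x)\<^sup>2 + c x * (g x)\<^sup>2) integrable_on {x..y}" for x y
    by (intro integrable_continuous_interval continuous_intros cg cg1
        continuous_on_subset[OF K_cont] continuous_on_subset[OF c_cont] subset_UNIV)
  have picone: "0 \<le> integral {x..y} (\<lambda>x. K x * (g1 x)\<^sup>2 + c x * (g x)\<^sup>2)"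
    if "x < y" "\<phi> x = 0" "\<phi> y = 0" "g x = 0" "g y = 0" "\<And>z. x < z \<Longrightarrow> z < y \<Longrightarrow> \<phi> z \<noteq> 0" for x y
    using that simple_zero(1)
    by (intro picone_nonneg[of x y K c \<phi> \<phi>1 g g1] \<phi> dg cg1 K_pos continuous_on_subset[OF K_cont]
        continuous_on_subset[OF c_cont]) auto
  have "0 \<le> integral {a..b} (\<lambda>x. K x * (g1 x)\<^sup>2 + c x * (g x)\<^sup>2)"
    using ab g0 by (intro picone) (auto dest: ab(5))
  moreover have "0 \<le> integral {b..a + T} (\<lambda>x. K x * (g1 x)\<^sup>2 + c x * (g x)\<^sup>2)"
    using ab g0 phi_aT by (intro picone) (auto dest: ab(6))
  ultimately have pos: "0 \<le> integral {a..a + T} (\<lambda>x. K x * (g1 x)\<^sup>2 + c x * (g x)\<^sup>2)"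
    using Henstock_Kurzweil_Integration.integral_combine[OF _ _ i3, of a b "a + T"] ab by simp
  \<comment> \<open>The cross term is a boundary term of \<open>g\<close> at \<open>a\<close> and
    \<open>a + T\<close>, hence zero.\<close>
  have "((\<lambda>x. K x * \<psi>1 x * g1 x + c x * \<psi> x * g x) has_integral 0) {a..a + T}"
    using psi_by_parts[OF dg, of a "a + T"] g0 T by simp
  then have "((\<lambda>x. q\<^sup>2 * (K x * \<psi>1 x * \<psi>1 x + c x * \<psi> x * \<psi> x)
       + (2 * q) * (K x * \<psi>1 x * g1 x + c x * \<psi> x * g x) + (K x * (g1 x)\<^sup>2 + c x * (g x)\<^sup>2)) has_integral
     q\<^sup>2 * \<tau> + (2 * q) * 0 + integral {a..a + T} (\<lambda>x. K x * (g1 x)\<^sup>2 + c x * (g x)\<^sup>2)) {a..a + T}"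
    by (intro has_integral_add has_integral_mult_right psi_form integrable_integral i3)
  then have "((\<lambda>x. K x * deriv h x * deriv h x + c x * h x * h x) has_integral
     q\<^sup>2 * \<tau> + (2 * q) * 0 + integral {a..a + T} (\<lambda>x. K x * (g1 x)\<^sup>2 + c x * (g x)\<^sup>2)) {a..a + T}"
    by (rule has_integral_eq[rotated]) (simp add: g_def g1_def algebra_simps power2_eq_square)
  then have "hill_form T K c h h = q\<^sup>2 * \<tau> + integral {a..a + T} (\<lambda>x. K x * (g1 x)\<^sup>2 + c x * (g x)\<^sup>2)"
    unfolding hill_form_shift[OF h h] by (simp add: integral_unique)
  moreover have "0 \<le> q\<^sup>2 * \<tau>" using sign by (auto simp: q_def)
  ultimately show ?thesis using pos by simp
qed

lemma signature_le_1:
  assumes "0 < \<tau>"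
  shows "neg_signature_operator T (op_domain T) (block_op T K d \<beta> \<gamma>) \<le> 1"
proof -
  have "neg_signature_operator T (op_domain T) (block_op T K d \<beta> \<gamma>) \<le> ereal (real DIM(real))"
  proof (rule block_signature_le[where L = "\<lambda>h. h b - h a / \<psi> a * \<psi> b"])
    show "linear (\<lambda>U :: real \<Rightarrow> real \<times> real. fst (U b) - fst (U a) / \<psi> a * \<psi> b)"
      by (rule linearI) (simp_all add: scaleR_fun_def algebra_simps add_divide_distrib)
  qed (use hill_form_nonneg assms in auto)
  then show ?thesis by (simp add: one_ereal_def)
qed

text \<open>Vanishing at both zeros forces the coefficient of \<psi> to be 0, so the sign of \<tau>
  does not matter.\<close>

lemma signature_le_2: "neg_signature_operator T (op_domain T) (block_op T K d \<beta> \<gamma>) \<le> 2"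
proof -
  have "neg_signature_operator T (op_domain T) (block_op T K d \<beta> \<gamma>) \<le> ereal (real DIM(real \<times> real))"
  proof (rule block_signature_le[where L = "\<lambda>h. (h a, h b)"])
    show "linear (\<lambda>U :: real \<Rightarrow> real \<times> real. (fst (U a), fst (U b)))"
      by (rule linearI) (simp_all add: scaleR_fun_def)
  qed (use hill_form_nonneg in \<open>auto simp: zero_prod_def\<close>)
  then show ?thesis by simp
qed

section \<open>Test functions for the lower bounds\<close>

lemma form_limit:
  assumes Y: "\<And>n. Y n \<in> H2_per T" "\<And>n x. \<bar>Y n x\<bar> \<le> M" "\<And>n x. \<bar>deriv (Y n) x\<bar> \<le> M"
      "\<And>x. (\<lambda>n. Y n x) \<longlonglongrightarrow> y x" "\<And>x. (\<lambda>n. deriv (Y n) x) \<longlonglongrightarrow> g x"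
    and Z: "\<And>n. Z n \<in> H2_per T" "\<And>n x. \<bar>Z n x\<bar> \<le> N" "\<And>n x. \<bar>deriv (Z n) x\<bar> \<le> N"
      "\<And>x. (\<lambda>n. Z n x) \<longlonglongrightarrow> z x" "\<And>x. (\<lambda>n. deriv (Z n) x) \<longlonglongrightarrow> k x"
    and I: "((\<lambda>x. K x * g x * k x + c x * y x * z x) has_integral I) {a..a + T}"
  shows "(\<lambda>n. hill_form T K c (Y n) (Z n)) \<longlonglongrightarrow> I"
proof -
  obtain MK where MK: "0 < MK" "\<And>x. \<bar>K x\<bar> \<le> MK" using periodic_bounded[OF K_cont K(3) T] by blast
  obtain Mc where Mc: "0 < Mc" "\<And>x. \<bar>c x\<bar> \<le> Mc" using periodic_bounded[OF c_cont c_per T] by blast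
  have MN: "0 \<le> M" "0 \<le> N" using Y(2)[of 0 0] Z(2)[of 0 0] by auto
  let ?f = "\<lambda>n x. K x * deriv (Y n) x * deriv (Z n) x + c x * Y n x * Z n x"
  have "(\<lambda>n. integral {a..a + T} (?f n)) \<longlonglongrightarrow> integral {a..a + T} (\<lambda>x. K x * g x * k x + c x * y x * z x)"
  proof (rule dominated_convergence(2)[where h = "\<lambda>x. MK * M * N + Mc * M * N"])
    show "?f n integrable_on {a..a + T}" for n
      by (intro integrable_continuous_interval continuous_intros continuous_on_subset[OF K_cont]
          continuous_on_subset[OF c_cont] continuous_on_subset[OF H2_perD(4)[OF Y(1)]]
          continuous_on_subset[OF H2_perD(5)[OF Y(1)]] continuous_on_subset[OF H2_perD(4)[OF Z(1)]]
          continuous_on_subset[OF H2_perD(5)[OF Z(1)]] subset_UNIV)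
    show "(\<lambda>x. MK * M * N + Mc * M * N) integrable_on {a..a + T}" by auto
    show "norm (?f n x) \<le> MK * M * N + Mc * M * N" for n x
    proof -
      have "\<bar>K x * deriv (Y n) x * deriv (Z n) x\<bar> \<le> MK * M * N"
        unfolding abs_mult using MK Y(3) Z(3) MN by (intro mult_mono) auto
      moreover have "\<bar>c x * Y n x * Z n x\<bar> \<le> Mc * M * N"
        unfolding abs_mult using Mc Y(2) Z(2) MN by (intro mult_mono) auto
      ultimately show ?thesis by simp
    qed
    show "(\<lambda>n. ?f n x) \<longlonglongrightarrow> K x * g x * k x + c x * y x * z x" for x
      by (intro tendsto_intros Y Z)
  qed
  then show ?thesis using I by (simp add: hill_form_shift[OF Y(1) Z(1)] integral_unique)
qed

text \<open>This slope is the size of the corner of \<open>max (\<phi> x) 0\<close> at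
  \<open>b\<close>; its sign decides that a small perturbation there lowers the form.\<close>

lemma phi1_b_neg: "\<phi>1 b < 0"
proof (rule ccontr)
  assume "\<not> ?thesis"
  then have "0 < \<phi>1 b" using simple_zero(1)[OF ab(4)] by simp
  from DERIV_pos_inc_left[OF \<phi>(1) this] obtain e where e: "e > 0" "\<And>h. 0 < h \<Longrightarrow> h < e \<Longrightarrow> \<phi> (b - h) < \<phi> b"
    by auto
  define h where "h = min e (b - a) / 2"
  have "0 < h" "h < e" "h < b - a" using e ab by (auto simp: h_def)
  then show False using e(2)[of h] ab(4) ab(5)[of "b - h"] by simp
qed

text \<open>Test functions with corners, to be smoothed: \<open>max \<phi> 0\<close> has vanishing form, which adding a small
  multiple of \<open>\<eta>\<close> makes negative; \<open>\<psi>\<close> restricted to \<open>[a, a + T]\<close> and periodically extended has form \<open>\<tau>\<close>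
  and is orthogonal to every function vanishing at \<open>a\<close>.\<close>

definition \<eta> where "\<eta> x = 1 - cos (2 * pi * (x - a) / T)"

definition \<eta>1 where "\<eta>1 x = 2 * pi / T * sin (2 * pi * (x - a) / T)"

lemma eta_deriv: "(\<eta> has_real_derivative \<eta>1 x) (at x)"
  unfolding \<eta>_def \<eta>1_def using T by (auto intro!: derivative_eq_intros simp: field_simps)

lemma eta_facts: "continuous_on S \<eta>1" "is_period T \<eta>" "is_period T \<eta>1" "\<eta> a = 0" "\<eta> (a + T) = 0" "0 < \<eta> b"
proof -
  show "continuous_on S \<eta>1" unfolding \<eta>1_def using T by (intro continuous_intros) auto
  show per: "is_period T \<eta>"
    unfolding is_period_def \<eta>_def
  proof
    fix x
    have "2 * pi * (x + T - a) / T = 2 * pi * (x - a) / T + 2 * pi" using T by (simp add: field_simps)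
    then show "1 - cos (2 * pi * (x + T - a) / T) = 1 - cos (2 * pi * (x - a) / T)"
      by (simp add: cos_periodic)
  qed
  then show "is_period T \<eta>1" using eta_deriv by (rule deriv_periodic)
  show a: "\<eta> a = 0" by (simp add: \<eta>_def)
  then show "\<eta> (a + T) = 0" using per by (simp add: is_period_def)
  have "sin (pi * (b - a) / T) \<noteq> 0"
  proof -
    have "pi * (b - a) < pi * T" using ab by (intro mult_strict_left_mono) auto
    then have "0 < pi * (b - a) / T" "pi * (b - a) / T < pi" using ab T by (auto simp: pos_divide_less_eq)
    then show ?thesis using sin_gt_zero by force
  qed
  moreover have "\<eta> b = 2 * (sin (pi * (b - a) / T))\<^sup>2"
    using cos_double_sin[of "pi * (b - a) / T"] by (simp add: \<eta>_def mult.assoc)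
  ultimately show "0 < \<eta> b" by simp
qed

definition J where "J = integral {a..a + T} (\<lambda>x. K x * \<eta>1 x * \<eta>1 x + c x * \<eta> x * \<eta> x)"

definition y1 where "y1 \<epsilon> x = max (\<phi> x) 0 + \<epsilon> * \<eta> x"

text \<open>The right derivative of \<open>y1 \<epsilon>\<close>, defined at every point including
  the corners.\<close>

definition g1 where
  "g1 \<epsilon> x = (if \<phi> x > 0 then \<phi>1 x else if \<phi> x < 0 then 0 else max (\<phi>1 x) 0) + \<epsilon> * \<eta>1 x"

lemma y1_on:
  "x \<in> {a..b} - {a, b} \<Longrightarrow> y1 \<epsilon> x = \<phi> x + \<epsilon> * \<eta> x \<and> g1 \<epsilon> x = \<phi>1 x + \<epsilon> * \<eta>1 x"
  "x \<in> {b..a + T} - {b, a + T} \<Longrightarrow> y1 \<epsilon> x = \<epsilon> * \<eta> x \<and> g1 \<epsilon> x = \<epsilon> * \<eta>1 x"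
  using ab(5)[of x] ab(6)[of x] by (auto simp: y1_def g1_def)

lemma eta_integral:
  "((\<lambda>x. K x * \<eta>1 x * \<eta>1 x + c x * \<eta> x * \<eta> x) has_integral
    integral {x..y} (\<lambda>x. K x * \<eta>1 x * \<eta>1 x + c x * \<eta> x * \<eta> x)) {x..y}"
proof -
  have c\<eta>: "continuous_on UNIV \<eta>" using eta_deriv by (meson DERIV_continuous_on)
  show ?thesis
    by (intro integrable_integral integrable_continuous_interval continuous_intros eta_facts(1)
        continuous_on_subset[OF K_cont] continuous_on_subset[OF c_cont] continuous_on_subset[OF c\<eta>] subset_UNIV)
qed

text \<open>On \<open>[a, b]\<close> the equation of \<phi> reduces everything involving \<phi> to
  boundary terms. The form of the positive part itself vanishes, and the term linear in \<epsilon>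
  is the jump of slope at \<open>b\<close>.\<close>

lemma form_11:
  "((\<lambda>x. K x * g1 \<epsilon> x * g1 \<epsilon> x + c x * y1 \<epsilon> x * y1 \<epsilon> x) has_integral
     2 * \<epsilon> * (K b * \<phi>1 b * \<eta> b) + \<epsilon>\<^sup>2 * J) {a..a + T}"
proof -
  let ?J = "\<lambda>x y. integral {x..y} (\<lambda>x. K x * \<eta>1 x * \<eta>1 x + c x * \<eta> x * \<eta> x)"
  let ?f = "\<lambda>x. K x * g1 \<epsilon> x * g1 \<epsilon> x + c x * y1 \<epsilon> x * y1 \<epsilon> x"
  have "((\<lambda>x. (K x * \<phi>1 x * \<phi>1 x + c x * \<phi> x * \<phi> x) + (2 * \<epsilon>) * (K x * \<phi>1 x * \<eta>1 x + c x * \<phi> x * \<eta> x)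
      + \<epsilon>\<^sup>2 * (K x * \<eta>1 x * \<eta>1 x + c x * \<eta> x * \<eta> x)) has_integral
      (K b * \<phi>1 b * \<phi> b - K a * \<phi>1 a * \<phi> a) + (2 * \<epsilon>) * (K b * \<phi>1 b * \<eta> b - K a * \<phi>1 a * \<eta> a)
      + \<epsilon>\<^sup>2 * ?J a b) {a..b}"
    by (rule has_integral_add[OF has_integral_add[OF phi_by_parts[OF \<phi>(1)]
          has_integral_mult_right[OF phi_by_parts[OF eta_deriv]]] has_integral_mult_right[OF eta_integral]])
      (use ab(1) in simp_all)
  \<comment> \<open>The endpoints are excluded because at a zero of \<phi> the right slope
    \<open>g1\<close> need not equal \<open>\<phi>1 x + \<epsilon> * \<eta>1 x\<close>.\<close>
  then have 1: "(?f has_integral (2 * \<epsilon>) * (K b * \<phi>1 b * \<eta> b) + \<epsilon>\<^sup>2 * ?J a b) {a..b}"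
    unfolding ab(3,4) eta_facts(4)
    by (intro has_integral_spike_finite[of "{a, b}" "{a..b}" ?f])
      (simp_all add: y1_on algebra_simps power2_eq_square)
  have "((\<lambda>x. \<epsilon>\<^sup>2 * (K x * \<eta>1 x * \<eta>1 x + c x * \<eta> x * \<eta> x)) has_integral \<epsilon>\<^sup>2 * ?J b (a + T)) {b..a + T}"
    by (intro has_integral_mult_right eta_integral)
  then have 2: "(?f has_integral \<epsilon>\<^sup>2 * ?J b (a + T)) {b..a + T}"
    by (intro has_integral_spike_finite[of "{b, a + T}" "{b..a + T}" ?f])
      (simp_all add: y1_on algebra_simps power2_eq_square)
  have J: "?J a b + ?J b (a + T) = J"
    unfolding J_def using ab
    by (intro Henstock_Kurzweil_Integration.integral_combine has_integral_integrable[OF eta_integral]) auto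
  have "(?f has_integral ((2 * \<epsilon>) * (K b * \<phi>1 b * \<eta> b) + \<epsilon>\<^sup>2 * ?J a b) + \<epsilon>\<^sup>2 * ?J b (a + T)) {a..a + T}"
    using ab by (intro has_integral_combine[OF _ _ 1 2]) auto
  then show ?thesis unfolding J[symmetric] distrib_left add.assoc .
qed

text \<open>The representative of \<open>x\<close> modulo \<open>T\<close> in the half-open interval
  from \<open>a\<close> to \<open>a + T\<close>; composing with it extends \<psi> periodically,
  continuously since \<psi> agrees at both ends.\<close>

definition red where "red x = x - of_int \<lfloor>(x - a) / T\<rfloor> * T"

lemma red_id: "x \<in> {a..<a + T} \<Longrightarrow> red x = x"
proof -
  assume "x \<in> {a..<a + T}"
  then have "\<lfloor>(x - a) / T\<rfloor> = 0" using T by (simp add: floor_eq_iff field_simps)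
  then show ?thesis by (simp add: red_def)
qed

lemma form_22:
  "((\<lambda>x. K x * \<psi>1 (red x) * \<psi>1 (red x) + c x * \<psi> (red x) * \<psi> (red x)) has_integral \<tau>) {a..a + T}"
  by (rule has_integral_spike_finite[of "{a + T}", OF _ _ psi_form]) (auto simp: red_id)

text \<open>The boundary terms at \<open>b\<close> from the two nodal intervals cancel, as
  \<open>y1\<close> is continuous there, and those at \<open>a\<close> and \<open>a + T\<close>
  vanish with \<open>y1\<close>.\<close>

lemma form_12:
  "((\<lambda>x. K x * g1 \<epsilon> x * \<psi>1 (red x) + c x * y1 \<epsilon> x * \<psi> (red x)) has_integral 0) {a..a + T}"
proof -
  let ?f = "\<lambda>x. K x * g1 \<epsilon> x * \<psi>1 (red x) + c x * y1 \<epsilon> x * \<psi> (red x)"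
  have d: "((\<lambda>x. \<phi> x + \<epsilon> * \<eta> x) has_real_derivative \<phi>1 x + \<epsilon> * \<eta>1 x) (at x)"
    "((\<lambda>x. \<epsilon> * \<eta> x) has_real_derivative \<epsilon> * \<eta>1 x) (at x)" for x
    by (intro DERIV_add DERIV_cmult \<phi>(1) eta_deriv)+
  have "((\<lambda>x. K x * \<psi>1 x * (\<phi>1 x + \<epsilon> * \<eta>1 x) + c x * \<psi> x * (\<phi> x + \<epsilon> * \<eta> x)) has_integral
      K b * \<psi>1 b * (\<phi> b + \<epsilon> * \<eta> b) - K a * \<psi>1 a * (\<phi> a + \<epsilon> * \<eta> a)) {a..b}"
    using ab by (intro psi_by_parts d) auto
  then have 1: "(?f has_integral K b * \<psi>1 b * (\<epsilon> * \<eta> b)) {a..b}"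
    unfolding ab(3,4) eta_facts(4) using ab(2)
    by (intro has_integral_spike_finite[of "{a, b}" "{a..b}" ?f]) (auto simp: y1_on red_id algebra_simps)
  have "((\<lambda>x. K x * \<psi>1 x * (\<epsilon> * \<eta>1 x) + c x * \<psi> x * (\<epsilon> * \<eta> x)) has_integral
      K (a + T) * \<psi>1 (a + T) * (\<epsilon> * \<eta> (a + T)) - K b * \<psi>1 b * (\<epsilon> * \<eta> b)) {b..a + T}"
    using ab by (intro psi_by_parts d) auto
  then have 2: "(?f has_integral - (K b * \<psi>1 b * (\<epsilon> * \<eta> b))) {b..a + T}"
    unfolding eta_facts(5) using ab(1)
    by (intro has_integral_spike_finite[of "{b, a + T}" "{b..a + T}" ?f]) (auto simp: y1_on red_id algebra_simps)
  show ?thesis using has_integral_combine[OF _ _ 1 2] ab by simp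
qed

lemma y1_approximation:
  obtains Y M where
    "\<And>n. Y n \<in> H2_per T" "\<And>n x. \<bar>Y n x\<bar> \<le> M" "\<And>n x. \<bar>deriv (Y n) x\<bar> \<le> M"
    "\<And>x. (\<lambda>n. Y n x) \<longlonglongrightarrow> y1 \<epsilon> x" "\<And>x. (\<lambda>n. deriv (Y n) x) \<longlonglongrightarrow> g1 \<epsilon> x"
proof -
  obtain M1 where M1: "\<And>x. \<bar>\<phi>1 x\<bar> \<le> M1" using periodic_bounded[OF phi1_cont phi1_per T] by blast
  obtain M2 where M2: "\<And>x. \<bar>\<eta>1 x\<bar> \<le> M2" using periodic_bounded[OF eta_facts(1,3) T] by blast
  show ?thesis
  proof (rule steklov_approximation[OF T, of "y1 \<epsilon>" "M1 + \<bar>\<epsilon>\<bar> * M2" "g1 \<epsilon>"])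
    show "is_period T (y1 \<epsilon>)" using \<phi>(3) eta_facts(2) by (simp add: is_period_def y1_def)
    show "\<bar>y1 \<epsilon> x - y1 \<epsilon> z\<bar> \<le> (M1 + \<bar>\<epsilon>\<bar> * M2) * \<bar>x - z\<bar>" for x z
    proof -
      have "\<bar>\<phi> x - \<phi> z\<bar> \<le> M1 * \<bar>x - z\<bar>"
        by (rule lipschitz_of_deriv_bound[OF \<phi>(1), of "min x z" "max x z"]) (auto intro: M1)
      then have 1: "\<bar>max (\<phi> x) 0 - max (\<phi> z) 0\<bar> \<le> M1 * \<bar>x - z\<bar>" by linarith
      have "\<bar>\<eta> x - \<eta> z\<bar> \<le> M2 * \<bar>x - z\<bar>"
        by (rule lipschitz_of_deriv_bound[OF eta_deriv, of "min x z" "max x z"]) (auto intro: M2)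
      then have "\<bar>\<epsilon> * (\<eta> x - \<eta> z)\<bar> \<le> \<bar>\<epsilon>\<bar> * (M2 * \<bar>x - z\<bar>)"
        unfolding abs_mult by (intro mult_left_mono) auto
      moreover have "y1 \<epsilon> x - y1 \<epsilon> z = (max (\<phi> x) 0 - max (\<phi> z) 0) + \<epsilon> * (\<eta> x - \<eta> z)"
        by (simp add: y1_def algebra_simps)
      moreover have "(M1 + \<bar>\<epsilon>\<bar> * M2) * \<bar>x - z\<bar> = M1 * \<bar>x - z\<bar> + \<bar>\<epsilon>\<bar> * (M2 * \<bar>x - z\<bar>)"
        by (simp add: algebra_simps)
      ultimately show ?thesis using 1 by linarith
    qed
    show "(\<lambda>n. (y1 \<epsilon> (x + 1 / Suc n) - y1 \<epsilon> x) * Suc n) \<longlonglongrightarrow> g1 \<epsilon> x" for x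
    proof -
      have "(\<lambda>n. (max (\<phi> (x + 1 / Suc n)) 0 - max (\<phi> x) 0) * Suc n
          + \<epsilon> * ((\<eta> (x + 1 / Suc n) - \<eta> x) * Suc n)) \<longlonglongrightarrow> g1 \<epsilon> x"
        unfolding g1_def
        by (intro tendsto_add tendsto_mult_left max_diff_quotient_LIMSEQ \<phi>(1) diff_quotient_LIMSEQ eta_deriv)
      then show ?thesis
        by (rule Lim_transform_eventually) (simp add: y1_def algebra_simps)
    qed
  qed (use that in blast)
qed

lemma psi_approximation:
  obtains Y M where
    "\<And>n. Y n \<in> H2_per T" "\<And>n x. \<bar>Y n x\<bar> \<le> M" "\<And>n x. \<bar>deriv (Y n) x\<bar> \<le> M"
    "\<And>x. (\<lambda>n. Y n x) \<longlonglongrightarrow> \<psi> (red x)" "\<And>x. (\<lambda>n. deriv (Y n) x) \<longlonglongrightarrow> \<psi>1 (red x)"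
proof -
  obtain M where M: "\<And>x. x \<in> {a..a + T} \<Longrightarrow> \<bar>\<psi>1 x\<bar> \<le> M"
  proof -
    have "bounded (\<psi>1 ` {a..a + T})"
      by (intro compact_imp_bounded compact_continuous_image continuous_on_subset[OF \<psi>(2)]) auto
    then obtain B where "\<forall>x\<in>\<psi>1 ` {a..a + T}. norm x \<le> B" unfolding bounded_iff by blast
    then show ?thesis using that[of B] by auto
  qed
  show ?thesis
  proof (rule steklov_approximation[OF T, of "\<lambda>x. \<psi> (red x)" M "\<lambda>x. \<psi>1 (red x)"])
    have "red (x + T) = red x" for x
    proof -
      have "(x + T - a) / T = (x - a) / T + 1" using T by (simp add: field_simps)
      then show ?thesis unfolding red_def by (simp add: algebra_simps)
    qed
    then show "is_period T (\<lambda>x. \<psi> (red x))" by (simp add: is_period_def)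
    show "\<bar>\<psi> (red x) - \<psi> (red z)\<bar> \<le> M * \<bar>x - z\<bar>" for x z
      unfolding red_def
      by (rule lipschitz_periodization[OF T _ psi_aT]) (rule lipschitz_of_deriv_bound[OF \<psi>(1) M])
    show "(\<lambda>n. (\<psi> (red (x + 1 / Suc n)) - \<psi> (red x)) * Suc n) \<longlonglongrightarrow> \<psi>1 (red x)" for x
    proof -
      define k where "k = \<lfloor>(x - a) / T\<rfloor>"
      have k: "of_int k \<le> (x - a) / T" "(x - a) / T < of_int k + 1" by (auto simp: k_def)
      have "(\<lambda>n. (x + 1 / Suc n - a) / T) \<longlonglongrightarrow> (x - a) / T"
        using T by (intro shift_LIMSEQ[where f = "\<lambda>x. (x - a) / T"] continuous_intros) auto
      \<comment> \<open>Cells are half-open on the right, so \<open>x + 1 / Suc n\<close> eventually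
        lies in the cell of \<open>x\<close>, even when \<open>x\<close> is a corner.\<close>
      from order_tendstoD(2)[OF this k(2)]
      have "\<forall>\<^sub>F n in sequentially. (\<psi> (red x + 1 / Suc n) - \<psi> (red x)) * Suc n
          = (\<psi> (red (x + 1 / Suc n)) - \<psi> (red x)) * Suc n"
      proof eventually_elim
        case (elim n)
        have "(x - a) / T \<le> (x + 1 / Suc n - a) / T" using T by (intro divide_right_mono) auto
        then have "\<lfloor>(x + 1 / Suc n - a) / T\<rfloor> = k" using elim k(1) by (simp add: floor_eq_iff)
        then have "red (x + 1 / Suc n) = red x + 1 / Suc n" by (simp add: red_def k_def)
        then show ?case by simp
      qed
      with diff_quotient_LIMSEQ[OF \<psi>(1)] show ?thesis by (rule Lim_transform_eventually)
    qed
  qed (use that in blast)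
qed

lemma form_11_neg:
  obtains \<epsilon> where "2 * \<epsilon> * (K b * \<phi>1 b * \<eta> b) + \<epsilon>\<^sup>2 * J < 0"
proof -
  define m where "m = - (K b * \<phi>1 b * \<eta> b)"
  have m: "0 < m" using K_pos[of b] phi1_b_neg eta_facts(6) by (simp add: m_def mult_pos_neg mult_neg_pos)
  \<comment> \<open>Small enough that \<open>\<epsilon> * J \<le> m\<close>, half of what the linear
    term offers.\<close>
  define \<epsilon> where "\<epsilon> = m / (\<bar>J\<bar> + 1)"
  have \<epsilon>: "0 < \<epsilon>" using m by (simp add: \<epsilon>_def)
  have "\<epsilon> * J \<le> \<epsilon> * (\<bar>J\<bar> + 1)" using \<epsilon> by (intro mult_left_mono) auto
  also have "\<dots> = m" by (simp add: \<epsilon>_def)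
  finally have "\<epsilon> * (\<epsilon> * J - 2 * m) < 0" using \<epsilon> m by (intro mult_pos_neg) auto
  then show ?thesis using that[of \<epsilon>] by (simp add: m_def algebra_simps power2_eq_square)
qed

text \<open>In the limit the Gram matrix of the two test functions is diagonal with entries
  \<open>?m < 0\<close> and \<tau>. When \<tau> is negative, its negative definiteness passes to the
  approximations for large \<open>n\<close>.\<close>

theorem hill_signature:
  assumes "\<tau> \<noteq> 0"
  shows "neg_signature_operator T (op_domain T) (block_op T K d \<beta> \<gamma>) = ereal (if \<tau> < 0 then 2 else 1)"
proof -
  obtain \<epsilon> where \<epsilon>: "2 * \<epsilon> * (K b * \<phi>1 b * \<eta> b) + \<epsilon>\<^sup>2 * J < 0" (is "?m < 0") using form_11_neg .
  obtain Y M where Y: "\<And>n. Y n \<in> H2_per T" "\<And>n x. \<bar>Y n x\<bar> \<le> M" "\<And>n x. \<bar>deriv (Y n) x\<bar> \<le> M"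
    "\<And>x. (\<lambda>n. Y n x) \<longlonglongrightarrow> y1 \<epsilon> x" "\<And>x. (\<lambda>n. deriv (Y n) x) \<longlonglongrightarrow> g1 \<epsilon> x"
    using y1_approximation by blast
  have l11: "(\<lambda>n. hill_form T K c (Y n) (Y n)) \<longlonglongrightarrow> ?m" by (rule form_limit[OF Y Y form_11])
  from order_tendstoD(2)[OF l11 \<epsilon>]
  have neg: "\<forall>\<^sub>F n in sequentially. hill_form T K c (Y n) (Y n) < 0" .
  show ?thesis
  proof (cases "\<tau> < 0")
    case True
    obtain Z N where Z: "\<And>n. Z n \<in> H2_per T" "\<And>n x. \<bar>Z n x\<bar> \<le> N" "\<And>n x. \<bar>deriv (Z n) x\<bar> \<le> N"
      "\<And>x. (\<lambda>n. Z n x) \<longlonglongrightarrow> \<psi> (red x)" "\<And>x. (\<lambda>n. deriv (Z n) x) \<longlonglongrightarrow> \<psi>1 (red x)"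
      using psi_approximation by blast
    have "(\<lambda>n. hill_form T K c (Y n) (Y n) * hill_form T K c (Z n) (Z n) - (hill_form T K c (Y n) (Z n))\<^sup>2)
        \<longlonglongrightarrow> ?m * \<tau> - 0\<^sup>2"
      by (intro tendsto_diff tendsto_mult tendsto_power l11 form_limit[OF Z Z form_22] form_limit[OF Y Z form_12])
    moreover have "0 < ?m * \<tau> - 0\<^sup>2" using mult_neg_neg[OF \<epsilon> True] by simp
    ultimately have "\<forall>\<^sub>F n in sequentially. 0 < hill_form T K c (Y n) (Y n) * hill_form T K c (Z n) (Z n)
        - (hill_form T K c (Y n) (Z n))\<^sup>2"
      by (rule order_tendstoD(1))
    with neg have "\<forall>\<^sub>F n in sequentially. hill_form T K c (Y n) (Y n) < 0 \<and>
        (hill_form T K c (Y n) (Z n))\<^sup>2 < hill_form T K c (Y n) (Y n) * hill_form T K c (Z n) (Z n)"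
      by eventually_elim simp
    then obtain n where "hill_form T K c (Y n) (Y n) < 0"
        "(hill_form T K c (Y n) (Z n))\<^sup>2 < hill_form T K c (Y n) (Y n) * hill_form T K c (Z n) (Z n)"
      using eventually_happens'[OF sequentially_bot] by blast
    then have "2 \<le> neg_signature_operator T (op_domain T) (block_op T K d \<beta> \<gamma>)"
      by (intro block_signature_ge_2[OF Y(1) Z(1)])
    then show ?thesis using signature_le_2 True by simp
  next
    case False
    obtain n where "hill_form T K c (Y n) (Y n) < 0"
      using eventually_happens'[OF sequentially_bot neg] by blast
    then have "1 \<le> neg_signature_operator T (op_domain T) (block_op T K d \<beta> \<gamma>)"
      by (rule block_signature_ge_1[OF Y(1)])
    then show ?thesis using signature_le_1 False assms by (simp add: one_ereal_def)
  qed
qed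

end

section \<open>Periodic profiles\<close>

lemma gronwall_zero:
  fixes N N1 :: "real \<Rightarrow> real"
  assumes N: "\<And>s. (N has_real_derivative N1 s) (at s)" and le: "\<And>s. N1 s \<le> C * N s"
    and nonneg: "\<And>s. 0 \<le> N s" and "N 0 = 0" "0 \<le> s"
  shows "N s = 0"
proof -
  have "exp (- C * s) * N s \<le> exp (- C * 0) * N 0"
  proof (rule DERIV_nonpos_imp_nonincreasing[OF \<open>0 \<le> s\<close>, of "\<lambda>s. exp (- C * s) * N s"])
    fix x
    have "((\<lambda>s. exp (- C * s) * N s) has_real_derivative exp (- C * x) * (N1 x - C * N x)) (at x)"
      by (auto intro!: derivative_eq_intros N simp: algebra_simps)
    moreover have "exp (- C * x) * (N1 x - C * N x) \<le> 0"
      using le[of x] by (simp add: mult_le_0_iff)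
    ultimately show "\<exists>y. ((\<lambda>s. exp (- C * s) * N s) has_real_derivative y) (at x) \<and> y \<le> 0" by blast
  qed
  then have "exp (- C * s) * N s \<le> 0" using assms(4) by simp
  then have "N s \<le> 0" by (simp add: mult_le_0_iff)
  then show ?thesis using nonneg[of s] by simp
qed

lemma second_order_zero:
  fixes y y1 y2 :: "real \<Rightarrow> real"
  assumes y: "\<And>s. (y has_real_derivative y1 s) (at s)" "\<And>s. (y1 has_real_derivative y2 s) (at s)"
    and le: "\<And>s. \<bar>y2 s\<bar> \<le> C * (\<bar>y s\<bar> + \<bar>y1 s\<bar>)" and C: "0 \<le> C"
    and "y 0 = 0" "y1 0 = 0" "0 \<le> s"
  shows "y s = 0"
proof -
  define N where "N s = (y s)\<^sup>2 + (y1 s)\<^sup>2" for s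
  have "N s = 0"
  \<comment> \<open>The constant collects 1 from \<open>2 * y * y1 \<le> N\<close> and
    \<open>3 * C\<close> from \<open>2 * \<bar>y\<bar> * \<bar>y1\<bar> \<le> N\<close> and
    \<open>2 * y1^2 \<le> 2 * N\<close>.\<close>
  proof (rule gronwall_zero[of N "\<lambda>s. 2 * y s * y1 s + 2 * y1 s * y2 s" "1 + 3 * C"])
    show "(N has_real_derivative 2 * y s * y1 s + 2 * y1 s * y2 s) (at s)" for s
      unfolding N_def by (auto intro!: derivative_eq_intros y)
    show "2 * y s * y1 s + 2 * y1 s * y2 s \<le> (1 + 3 * C) * N s" for s
    proof -
      have 1: "2 * y s * y1 s \<le> N s" using sum_squares_bound[of "y s" "y1 s"] by (simp add: N_def)
      have "2 * \<bar>y s\<bar> * \<bar>y1 s\<bar> \<le> N s"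
        using sum_squares_bound[of "\<bar>y s\<bar>" "\<bar>y1 s\<bar>"] by (simp add: N_def)
      moreover have "2 * \<bar>y1 s\<bar> * \<bar>y1 s\<bar> \<le> 2 * N s" by (simp add: N_def power2_eq_square mult.assoc)
      ultimately have 2: "C * (2 * \<bar>y s\<bar> * \<bar>y1 s\<bar> + 2 * \<bar>y1 s\<bar> * \<bar>y1 s\<bar>) \<le> C * (3 * N s)"
        using C by (intro mult_left_mono) auto
      have "y1 s * y2 s \<le> \<bar>y1 s\<bar> * \<bar>y2 s\<bar>" by (metis abs_ge_self abs_mult)
      also have "\<dots> \<le> \<bar>y1 s\<bar> * (C * (\<bar>y s\<bar> + \<bar>y1 s\<bar>))" using le[of s] by (intro mult_left_mono) auto
      finally have "2 * y1 s * y2 s \<le> C * (2 * \<bar>y s\<bar> * \<bar>y1 s\<bar> + 2 * \<bar>y1 s\<bar> * \<bar>y1 s\<bar>)"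
        by (simp add: algebra_simps)
      with 1 2 show ?thesis by (simp add: algebra_simps)
    qed
  qed (use assms in \<open>auto simp: N_def\<close>)
  then show ?thesis by (simp add: N_def sum_power2_eq_zero_iff)
qed

lemma pos_on_interval:
  fixes f :: "real \<Rightarrow> real"
  assumes cont: "continuous_on UNIV f" and nz: "\<And>x. l < x \<Longrightarrow> x < r \<Longrightarrow> f x \<noteq> 0"
    and y: "l < y" "y < r" "0 < f y" and x: "l < x" "x < r"
  shows "0 < f x"
proof (rule ccontr)
  assume "\<not> ?thesis"
  then have "f x \<le> 0" by simp
  have c: "continuous_on S f" for S using cont continuous_on_subset by blast
  show False
  proof (cases "x \<le> y")
    case True
    then obtain z where "x \<le> z" "z \<le> y" "f z = 0" using IVT'[of f x 0 y] \<open>f x \<le> 0\<close> y c by auto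
    then show False using nz[of z] x y by auto
  next
    case False
    then obtain z where "y \<le> z" "z \<le> x" "f z = 0" using IVT2'[of f x 0 y] \<open>f x \<le> 0\<close> y c by auto
    then show False using nz[of z] x y by auto
  qed
qed

text \<open>\<open>P1\<close> and \<open>P2\<close> are the first two derivatives of the effective
  potential, and \<open>ode\<close> is the Euler equation of the energy
  \<open>K(q) q'^2 / 2 + P(q)\<close>. The condition on \<open>d\<close> identifies the Schur
  complement with the coefficient of the linearization of \<open>ode\<close>.\<close>

locale profile =
  fixes T :: real and K K1 K2 P1 P2 q q1 q2 \<psi> \<psi>1 d \<beta> \<gamma> :: "real \<Rightarrow> real" and \<tau> :: real
  assumes K: "\<And>s. 0 < s \<Longrightarrow> (K has_real_derivative K1 s) (at s)"
      "\<And>s. 0 < s \<Longrightarrow> (K1 has_real_derivative K2 s) (at s)" "continuous_on {0<..} K2"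
      "\<And>s. 0 < s \<Longrightarrow> 0 < K s"
    and P: "\<And>s. 0 < s \<Longrightarrow> (P1 has_real_derivative P2 s) (at s)" "continuous_on {0<..} P2"
    and q: "\<And>x. (q has_real_derivative q1 x) (at x)" "\<And>x. (q1 has_real_derivative q2 x) (at x)"
      "\<And>x. 0 < q x" "fundamental_period T q"
    and ode: "\<And>x. K (q x) * q2 x = P1 (q x) - K1 (q x) * (q1 x)\<^sup>2 / 2"
    and \<psi>: "\<And>x. (\<psi> has_real_derivative \<psi>1 x) (at x)" "continuous_on UNIV \<psi>1"
      "\<And>x. K (q x) * (q1 x * \<psi>1 x - q2 x * \<psi> x) = 1" "\<And>x. \<psi> (x + T) = \<psi> x - \<tau> * q1 x"
    and \<beta>: "continuous_on UNIV \<beta>" "is_period T \<beta>"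
    and \<gamma>: "continuous_on UNIV \<gamma>" "is_period T \<gamma>" "\<And>x. 0 < \<gamma> x"
    and d: "\<And>x. d x - (\<beta> x)\<^sup>2 / \<gamma> x = P2 (q x) - K2 (q x) * (q1 x)\<^sup>2 / 2 - K1 (q x) * q2 x"
begin

section \<open>Reflection symmetry and zeros of the slope\<close>

lemma T: "0 < T" and q_per: "is_period T q" and T_least: "\<And>S. 0 < S \<Longrightarrow> is_period S q \<Longrightarrow> T \<le> S"
  using q(4) by (auto simp: fundamental_period_def not_less[symmetric])

lemma q_cont: "continuous_on S q" and q1_cont: "continuous_on S q1"
proof -
  have "continuous_on UNIV q" "continuous_on UNIV q1"
    by (rule DERIV_continuous_on[OF q(1)]) (rule DERIV_continuous_on[OF q(2)])
  then show "continuous_on S q" "continuous_on S q1" by (auto intro: continuous_on_subset)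
qed

lemma q1_per: "is_period T q1"
  by (rule deriv_periodic[OF q_per q(1)])

lemma q2_per: "is_period T q2"
  by (rule deriv_periodic[OF q1_per q(2)])

text \<open>The range of the profile is kept in a compact part of the open half line, where the
  coefficients of the profile equation are Lipschitz.\<close>

lemma q_bounds:
  obtains m M R where "0 < m" "\<And>x. q x \<in> {m..M}" "\<And>x. \<bar>q1 x\<bar> \<le> R" "0 < R"
proof -
  obtain M where M: "\<And>x. \<bar>q x\<bar> \<le> M" using periodic_bounded[OF q_cont q_per T] by blast
  obtain R where R: "0 < R" "\<And>x. \<bar>q1 x\<bar> \<le> R" using periodic_bounded[OF q1_cont q1_per T] by blast
  have "\<exists>z\<in>{0..T}. \<forall>x\<in>{0..T}. q z \<le> q x"
    using T q_cont by (intro continuous_attains_inf) auto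
  then obtain z where z: "\<And>x. x \<in> {0..T} \<Longrightarrow> q z \<le> q x" by blast
  have "q z \<le> q x" for x
  proof -
    obtain y where "0 \<le> y" "y < 0 + T" "q y = q x" using is_period_reduce[OF q_per T] .
    then show ?thesis using z[of y] by simp
  qed
  then show ?thesis using that[of "q z" M R] q(3) M R by (auto simp: abs_le_iff)
qed

text \<open>The equation is even in \<open>q1\<close>, so \<open>q (z + s)\<close> and
  \<open>q (z - s)\<close> solve the same equation with the same data at \<open>s = 0\<close>; a
  Gronwall estimate on their difference gives uniqueness.\<close>

lemma reflection_pos:
  assumes z: "q1 z = 0" and s: "0 \<le> s"
  shows "q (z + s) = q (z - s)"
proof -
  obtain m M R where m: "0 < m" and qm: "\<And>x. q x \<in> {m..M}" and R: "\<And>x. \<bar>q1 x\<bar> \<le> R" "0 < R"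
    using q_bounds by blast
  have pos: "t \<in> {m..M} \<Longrightarrow> 0 < t" for t using m by auto
  define A where "A t = P1 t / K t" for t
  define A1 where "A1 t = (P2 t * K t - P1 t * K1 t) / (K t * K t)" for t
  define B where "B t = K1 t / (2 * K t)" for t
  define B1 where "B1 t = (K2 t * (2 * K t) - K1 t * (2 * K1 t)) / ((2 * K t) * (2 * K t))" for t
  have K0: "K t \<noteq> 0" if "t \<in> {m..M}" for t using K(4)[OF pos[OF that]] by simp
  have sub: "{m..M} \<subseteq> {0<..}" using m by auto
  have cont: "continuous_on {m..M} K" "continuous_on {m..M} K1" "continuous_on {m..M} P1"
    using pos by (auto intro!: DERIV_continuous_on[OF has_field_derivative_at_within] K P)
  have cont2: "continuous_on {m..M} K2" "continuous_on {m..M} P2"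
    using continuous_on_subset[OF K(3) sub] continuous_on_subset[OF P(2) sub] by auto
  have dA: "(A has_real_derivative A1 t) (at t)" if "t \<in> {m..M}" for t
    unfolding A_def A1_def by (intro DERIV_divide P(1) K(1) pos[OF that] K0[OF that])
  have dB: "(B has_real_derivative B1 t) (at t)" if "t \<in> {m..M}" for t
    unfolding B_def B1_def using K0[OF that]
    by (intro DERIV_divide K(2) DERIV_cmult K(1) pos[OF that]) auto
  have "continuous_on {m..M} A1" "continuous_on {m..M} B1" "continuous_on {m..M} B"
    unfolding A1_def B1_def B_def using K0 by (intro continuous_intros cont cont2; auto)+
  then have bd: "bounded (A1 ` {m..M})" "bounded (B1 ` {m..M})" "bounded (B ` {m..M})"
    by (auto intro: compact_imp_bounded compact_continuous_image)
  obtain LA where LA: "0 < LA" "\<And>t. t \<in> {m..M} \<Longrightarrow> \<bar>A1 t\<bar> \<le> LA" using bd(1) unfolding bounded_pos by auto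
  obtain LB where LB: "0 < LB" "\<And>t. t \<in> {m..M} \<Longrightarrow> \<bar>B1 t\<bar> \<le> LB" using bd(2) unfolding bounded_pos by auto
  obtain B0 where B0: "0 < B0" "\<And>t. t \<in> {m..M} \<Longrightarrow> \<bar>B t\<bar> \<le> B0" using bd(3) unfolding bounded_pos by auto
  have q2_eq: "q2 x = A (q x) - B (q x) * (q1 x)\<^sup>2" for x
    using ode[of x] K0[OF qm[of x]] by (simp add: A_def B_def field_simps)
  define C where "C = LA + LB * R\<^sup>2 + B0 * (2 * R)"
  \<comment> \<open>The sum of the slopes appears because the derivative of
    \<open>q (z + s) - q (z - s)\<close> is \<open>q1 (z + s) + q1 (z - s)\<close>.\<close>
  have diff: "\<bar>q2 x - q2 y\<bar> \<le> C * (\<bar>q x - q y\<bar> + \<bar>q1 x + q1 y\<bar>)" for x y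
  proof -
    have 1: "\<bar>A (q x) - A (q y)\<bar> \<le> LA * \<bar>q x - q y\<bar>"
      by (rule lipschitz_of_deriv_bound[OF dA LA(2) qm qm])
    have "\<bar>B (q x) - B (q y)\<bar> \<le> LB * \<bar>q x - q y\<bar>"
      by (rule lipschitz_of_deriv_bound[OF dB LB(2) qm qm])
    moreover have "(q1 x)\<^sup>2 \<le> R\<^sup>2" using R(1)[of x] by (simp add: abs_le_square_iff[symmetric])
    ultimately have 2: "\<bar>(B (q x) - B (q y)) * (q1 x)\<^sup>2\<bar> \<le> (LB * \<bar>q x - q y\<bar>) * R\<^sup>2"
      unfolding abs_mult using LB by (intro mult_mono) auto
    have "\<bar>q1 x - q1 y\<bar> \<le> 2 * R" using R(1)[of x] R(1)[of y] by linarith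
    then have "\<bar>q1 x + q1 y\<bar> * \<bar>q1 x - q1 y\<bar> \<le> \<bar>q1 x + q1 y\<bar> * (2 * R)" by (intro mult_left_mono) auto
    then have "\<bar>(q1 x)\<^sup>2 - (q1 y)\<^sup>2\<bar> \<le> \<bar>q1 x + q1 y\<bar> * (2 * R)"
      unfolding abs_mult[symmetric] by (simp add: algebra_simps power2_eq_square)
    then have 3: "\<bar>B (q y) * ((q1 x)\<^sup>2 - (q1 y)\<^sup>2)\<bar> \<le> B0 * (\<bar>q1 x + q1 y\<bar> * (2 * R))"
      unfolding abs_mult using B0 qm by (intro mult_mono) auto
    have "q2 x - q2 y = (A (q x) - A (q y)) - (B (q x) - B (q y)) * (q1 x)\<^sup>2 - B (q y) * ((q1 x)\<^sup>2 - (q1 y)\<^sup>2)"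
      by (simp add: q2_eq algebra_simps)
    then have "\<bar>q2 x - q2 y\<bar> \<le> LA * \<bar>q x - q y\<bar> + (LB * \<bar>q x - q y\<bar>) * R\<^sup>2 + B0 * (\<bar>q1 x + q1 y\<bar> * (2 * R))"
      using 1 2 3 by linarith
    also have "\<dots> = (LA + LB * R\<^sup>2) * \<bar>q x - q y\<bar> + B0 * (2 * R) * \<bar>q1 x + q1 y\<bar>"
      by (simp add: algebra_simps)
    also have "\<dots> \<le> C * \<bar>q x - q y\<bar> + C * \<bar>q1 x + q1 y\<bar>"
      using LA LB B0 R by (intro add_mono mult_right_mono) (auto simp: C_def)
    finally show ?thesis by (simp add: algebra_simps)
  qed
  have sh: "((\<lambda>s. f (z + s)) has_real_derivative f' (z + t)) (at t)"
    "((\<lambda>s. f (z - s)) has_real_derivative - f' (z - t)) (at t)"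
    if f: "\<And>x. (f has_real_derivative f' x) (at x)" for f f' :: "real \<Rightarrow> real" and t
  proof -
    show "((\<lambda>s. f (z + s)) has_real_derivative f' (z + t)) (at t)"
      using DERIV_chain2[OF f, of "\<lambda>s. z + s" 1 t UNIV] DERIV_add[OF DERIV_const DERIV_ident, of z t UNIV]
      by simp
    show "((\<lambda>s. f (z - s)) has_real_derivative - f' (z - t)) (at t)"
      using DERIV_chain2[OF f, of "\<lambda>s. z - s" "- 1" t UNIV] DERIV_diff[OF DERIV_const DERIV_ident, of z t UNIV]
      by simp
  qed
  have "q (z + s) - q (z - s) = 0"
  proof (rule second_order_zero[of "\<lambda>s. q (z + s) - q (z - s)" "\<lambda>s. q1 (z + s) + q1 (z - s)"
        "\<lambda>s. q2 (z + s) - q2 (z - s)" C])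
    show "((\<lambda>s. q (z + s) - q (z - s)) has_real_derivative q1 (z + t) + q1 (z - t)) (at t)" for t
      using DERIV_diff[OF sh[OF q(1)]] by simp
    show "((\<lambda>s. q1 (z + s) + q1 (z - s)) has_real_derivative q2 (z + t) - q2 (z - t)) (at t)" for t
      using DERIV_add[OF sh[OF q(2)]] by simp
    show "0 \<le> C" using LA LB B0 R by (simp add: C_def)
  qed (use diff z s in auto)
  then show ?thesis by simp
qed

lemma reflection:
  assumes "q1 z = 0"
  shows "q (z + s) = q (z - s)"
  using reflection_pos[OF assms, of s] reflection_pos[OF assms, of "- s"] by (cases "0 \<le> s") auto

text \<open>The product of the reflections about \<open>z1\<close> and \<open>z2\<close> is the
  translation by \<open>2 * (z2 - z1)\<close>, which is thus a period.\<close>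

lemma zero_spacing:
  assumes "q1 z1 = 0" "q1 z2 = 0" "z1 < z2"
  shows "T \<le> 2 * (z2 - z1)"
proof (rule T_least)
  show "0 < 2 * (z2 - z1)" using assms by simp
  show "is_period (2 * (z2 - z1)) q"
    unfolding is_period_def
  proof
    fix x
    have "q (x + 2 * (z2 - z1)) = q (z2 + (x + z2 - 2 * z1))" by (simp add: algebra_simps)
    also have "\<dots> = q (z2 - (x + z2 - 2 * z1))" by (rule reflection[OF assms(2)])
    also have "\<dots> = q (z1 + (z1 - x))" by (simp add: algebra_simps)
    also have "\<dots> = q (z1 - (z1 - x))" by (rule reflection[OF assms(1)])
    finally show "q (x + 2 * (z2 - z1)) = q x" by simp
  qed
qed

lemma zeros:
  obtains a b where "a < b" "b < a + T" "q1 a = 0" "q1 b = 0"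
    "\<And>x. a < x \<Longrightarrow> x < b \<Longrightarrow> 0 < q1 x" "\<And>x. b < x \<Longrightarrow> x < a + T \<Longrightarrow> q1 x < 0"
proof -
  have per: "q1 (x + T) = q1 x" "q (x + T) = q x" for x using q1_per q_per by (auto simp: is_period_def)
  have rolle: "\<exists>z. x < z \<and> z < x + T \<and> q1 z = 0" for x
    using Rolle[of x "x + T" q] T q(1) per
    by (metis (no_types, lifting) DERIV_unique less_add_same_cancel1 q_cont real_differentiable_def)
  obtain x0 where x0: "q1 x0 = 0" using rolle by blast
  obtain z where z: "x0 < z" "z < x0 + T" "q1 z = 0" using rolle[of x0] by blast
  \<comment> \<open>The two bounds place \<open>z\<close> exactly half a period after
    \<open>x0\<close>; any further zero would be too close to one of them.\<close>
  have zT: "T \<le> 2 * (z - x0)" "T \<le> 2 * (x0 + T - z)"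
    using zero_spacing[OF x0 z(3,1)] zero_spacing[OF z(3) _ z(2)] per x0 by auto
  have nz: "q1 x \<noteq> 0" if "x0 < x" "x < z" for x
    using zero_spacing[OF x0 _ that(1)] that zT by force
  have nz': "q1 x \<noteq> 0" if "z < x" "x < x0 + T" for x
    using zero_spacing[OF z(3) _ that(1)] that zT by force
  \<comment> \<open>The Wronskian identity excludes a common zero of \<open>q1\<close> and
    \<open>q2\<close>. The sign of \<open>q2 z\<close> tells which half period is the increasing
    one, and so whether \<open>a\<close> is \<open>x0\<close> or \<open>z\<close>.\<close>
  have "q2 z \<noteq> 0" using \<psi>(3)[of z] z by auto
  then consider "q2 z < 0" | "0 < q2 z" by linarith
  then show ?thesis
  proof cases
    case 1
    obtain e where e: "0 < e" "\<And>h. 0 < h \<Longrightarrow> h < e \<Longrightarrow> q1 z < q1 (z - h)"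
      using DERIV_neg_dec_left[OF q(2) 1] by blast
    obtain e' where e': "0 < e'" "\<And>h. 0 < h \<Longrightarrow> h < e' \<Longrightarrow> q1 z > q1 (z + h)"
      using DERIV_neg_dec_right[OF q(2) 1] by blast
    define h where "h = min e (z - x0) / 2"
    define h' where "h' = min e' (x0 + T - z) / 2"
    have h: "0 < h" "h < e" "h < z - x0" "0 < h'" "h' < e'" "h' < x0 + T - z"
      using e e' z by (auto simp: h_def h'_def)
    show ?thesis
    proof (rule that[OF z(1,2) x0 z(3)])
      show "0 < q1 x" if "x0 < x" "x < z" for x
        by (rule pos_on_interval[OF q1_cont nz _ _ _ that, of "z - h"]) (use e(2)[of h] h z in auto)
      show "q1 x < 0" if "z < x" "x < x0 + T" for x
        using pos_on_interval[of "\<lambda>x. - q1 x" z "x0 + T" "z + h'" x] nz' that e'(2)[of h'] h z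
        by (auto intro: continuous_on_minus[OF q1_cont])
    qed
  next
    case 2
    obtain e where e: "0 < e" "\<And>h. 0 < h \<Longrightarrow> h < e \<Longrightarrow> q1 (z - h) < q1 z"
      using DERIV_pos_inc_left[OF q(2) 2] by blast
    obtain e' where e': "0 < e'" "\<And>h. 0 < h \<Longrightarrow> h < e' \<Longrightarrow> q1 z < q1 (z + h)"
      using DERIV_pos_inc_right[OF q(2) 2] by blast
    define h where "h = min e (z - x0) / 2"
    define h' where "h' = min e' (x0 + T - z) / 2"
    have h: "0 < h" "h < e" "h < z - x0" "0 < h'" "h' < e'" "h' < x0 + T - z"
      using e e' z by (auto simp: h_def h'_def)
    show ?thesis
    proof (rule that[OF z(2) _ z(3)])
      show "x0 + T < z + T" using z by simp
      show "q1 (x0 + T) = 0" using per x0 by simp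
      show "0 < q1 x" if "z < x" "x < x0 + T" for x
        by (rule pos_on_interval[OF q1_cont nz' _ _ _ that, of "z + h'"]) (use e'(2)[of h'] h z in auto)
      show "q1 x < 0" if "x0 + T < x" "x < z + T" for x
      proof -
        have "0 < - q1 (x - T)"
          using pos_on_interval[of "\<lambda>x. - q1 x" x0 z "z - h" "x - T"] nz that e(2)[of h] h z
          by (auto intro: continuous_on_minus[OF q1_cont])
        then show ?thesis using per(1)[of "x - T"] by simp
      qed
    qed
  qed
qed

theorem profile_signature:
  assumes "\<tau> \<noteq> 0"
  shows "neg_signature_operator T (op_domain T) (block_op T (\<lambda>x. K (q x)) d \<beta> \<gamma>)
    = ereal (if \<tau> < 0 then 2 else 1)"
proof -
  obtain a b where ab: "a < b" "b < a + T" "q1 a = 0" "q1 b = 0"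
    "\<And>x. a < x \<Longrightarrow> x < b \<Longrightarrow> 0 < q1 x" "\<And>x. b < x \<Longrightarrow> x < a + T \<Longrightarrow> q1 x < 0"
    using zeros by blast
  have Kq: "((\<lambda>x. K (q x)) has_real_derivative K1 (q x) * q1 x) (at x)"
    "((\<lambda>x. K1 (q x)) has_real_derivative K2 (q x) * q1 x) (at x)"
    "((\<lambda>x. P1 (q x)) has_real_derivative P2 (q x) * q1 x) (at x)" for x
    by (intro DERIV_chain2[OF K(1) q(1)] DERIV_chain2[OF K(2) q(1)] DERIV_chain2[OF P(1) q(1)] q(3))+
  have cq: "continuous_on UNIV (\<lambda>x. f (q x))" if "continuous_on {0<..} f" for f :: "real \<Rightarrow> real"
    by (rule continuous_on_compose2[OF that q_cont]) (use q(3) in auto)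
  have Kq_pos: "0 < K (q x)" for x by (rule K(4)[OF q(3)])
  have K0: "K (q x) \<noteq> 0" for x using Kq_pos[of x] by simp
  have cK1: "continuous_on UNIV (\<lambda>x. K1 (q x))" by (rule DERIV_continuous_on[OF Kq(2)])
  \<comment> \<open>\<open>q2\<close> is not assumed differentiable; the derivative is read off from
    the right-hand side of the profile equation.\<close>
  have dKq2: "((\<lambda>x. K (q x) * q2 x) has_real_derivative
      P2 (q x) * q1 x - (K2 (q x) * q1 x * (q1 x)\<^sup>2 + 2 * q1 x * q2 x * K1 (q x)) / 2) (at x)" for x
    unfolding ode
    by (intro DERIV_diff Kq DERIV_cdivide DERIV_mult)
      (auto intro!: derivative_eq_intros q(2))
  have cq2: "continuous_on UNIV q2"
  proof -
    have "continuous_on UNIV (\<lambda>x. (K (q x) * q2 x) / K (q x))"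
      by (rule continuous_on_divide[OF DERIV_continuous_on[OF dKq2] DERIV_continuous_on[OF Kq(1)]])
        (simp add: K0)
    then show ?thesis by (simp add: K0)
  qed
  have d_eq: "d = (\<lambda>x. P2 (q x) - K2 (q x) * (q1 x)\<^sup>2 / 2 - K1 (q x) * q2 x + (\<beta> x)\<^sup>2 / \<gamma> x)"
    using d by (auto simp: fun_eq_iff algebra_simps)
  have \<gamma>0: "\<gamma> x \<noteq> 0" for x using \<gamma>(3)[of x] by simp
  note c_eq = d
  interpret block T "\<lambda>x. K (q x)" "\<lambda>x. K1 (q x) * q1 x" d \<beta> \<gamma>
  proof
    show "continuous_on UNIV (\<lambda>x. K1 (q x) * q1 x)" by (intro continuous_intros cK1 q1_cont)
    show "is_period T (\<lambda>x. K (q x))" using q_per by (simp add: is_period_def)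
    show "continuous_on UNIV d"
      unfolding d_eq by (intro continuous_intros cq K P cK1 q1_cont cq2 \<beta> \<gamma>) (use \<gamma>0 in auto)
    show "is_period T d"
      unfolding d_eq using q_per q1_per q2_per \<beta>(2) \<gamma>(2) by (simp add: is_period_def)
  qed (use T Kq \<beta> \<gamma> in auto)
  interpret hill T "\<lambda>x. K (q x)" "\<lambda>x. K1 (q x) * q1 x" d \<beta> \<gamma> q1 q2 \<psi> \<psi>1 \<tau> a b
  proof
    \<comment> \<open>Translation invariance: differentiating the profile equation in space shows
      that \<open>q1\<close> is a null solution.\<close>
    show "((\<lambda>x. K (q x) * q2 x) has_real_derivative c x * q1 x) (at x)" for x
    proof -
      have "c x * q1 x = P2 (q x) * q1 x - (K2 (q x) * q1 x * (q1 x)\<^sup>2 + 2 * q1 x * q2 x * K1 (q x)) / 2"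
        unfolding c_def c_eq by (simp add: algebra_simps power2_eq_square)
      then show ?thesis using dKq2[of x] by simp
    qed
  qed (use Kq_pos q \<psi> q1_per ab in auto)
  show ?thesis by (rule hill_signature[OF assms])
qed

end

section \<open>Differentiation with respect to parameters\<close>

text \<open>Only continuity in each direction is kept; in finite dimension it suffices to rebuild
  continuity of the derivative as an operator.\<close>

lemma C1_onE:
  fixes F :: "'a::real_normed_vector \<Rightarrow> 'b::real_normed_vector"
  assumes "C1_on S F"
  obtains D where "\<And>z. z \<in> S \<Longrightarrow> (F has_derivative D z) (at z)" "\<And>h. continuous_on S (\<lambda>z. D z h)"
proof -
  obtain F' :: "'a \<Rightarrow> 'a \<Rightarrow>\<^sub>L 'b" where
    F': "\<And>z. z \<in> S \<Longrightarrow> (F has_derivative blinfun_apply (F' z)) (at z)" "continuous_on S F'"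
    using assms unfolding C1_on_def by blast
  show ?thesis
    by (rule that[of "\<lambda>z. blinfun_apply (F' z)"]) (auto intro!: F' continuous_intros)
qed

lemma leibniz_rule_open:
  fixes g :: "'a::euclidean_space \<times> real \<Rightarrow> real"
  assumes \<Omega>: "open \<Omega>" "p \<in> \<Omega>"
    and g: "\<And>z. z \<in> \<Omega> \<times> UNIV \<Longrightarrow> (g has_derivative D z) (at z)"
    and D: "\<And>h. continuous_on (\<Omega> \<times> UNIV) (\<lambda>z. D z h)"
  shows "((\<lambda>q. integral {a..b} (\<lambda>x. g (q, x))) has_derivative
    (\<lambda>h. integral {a..b} (\<lambda>x. D (p, x) (h, 0)))) (at p)"
proof -
  obtain r where r: "0 < r" "ball p r \<subseteq> \<Omega>" using \<Omega> open_contains_ball by blast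
  have gq: "((\<lambda>q. g (q, x)) has_derivative (\<lambda>h. D (q, x) (h, 0))) (at q within S)" if "q \<in> \<Omega>" for q x S
  proof -
    have "((\<lambda>q. g (q, x)) has_derivative (\<lambda>h. D (q, x) (h, 0))) (at q)"
      by (rule has_derivative_compose[where f = "\<lambda>q. (q, x)" and g = g, OF _ g])
        (use that in \<open>auto intro!: derivative_eq_intros\<close>)
    then show ?thesis by (rule has_derivative_at_withinI)
  qed
  have bl: "bounded_linear (\<lambda>h. D (q, x) (h, 0))" if "q \<in> \<Omega>" for q x
    using gq[OF that, of x UNIV] by (rule has_derivative_bounded_linear)
  define fx where "fx q x = Blinfun (\<lambda>h. D (q, x) (h, 0))" for q x
  have fx: "blinfun_apply (fx q x) = (\<lambda>h. D (q, x) (h, 0))" if "q \<in> \<Omega>" for q x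
    unfolding fx_def by (rule bounded_linear_Blinfun_apply[OF bl[OF that]])
  have cg: "continuous_on {a..b} (\<lambda>x. g (q, x))" if "q \<in> \<Omega>" for q
  proof -
    have "continuous_on (\<Omega> \<times> UNIV) g"
      using g has_derivative_at_withinI has_derivative_continuous_on by blast
    then show ?thesis
      by (rule continuous_on_compose2) (use that in \<open>auto intro!: continuous_intros\<close>)
  qed
  have "((\<lambda>q. integral (cbox a b) (\<lambda>x. g (q, x))) has_derivative
      blinfun_apply (integral (cbox a b) (fx p))) (at p within ball p r)"
  proof (rule leibniz_rule[where U = "ball p r"])
    show "((\<lambda>q. g (q, x)) has_derivative blinfun_apply (fx q x)) (at q within ball p r)"
      if "q \<in> ball p r" for q x
      using that r by (subst fx) (auto intro: gq)
    show "(\<lambda>x. g (q, x)) integrable_on cbox a b" if "q \<in> ball p r" for q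
      using integrable_continuous_interval[OF cg[of q]] that r by auto
    show "continuous_on (ball p r \<times> cbox a b) (\<lambda>(q, x). fx q x)"
    proof (rule continuous_on_blinfun_componentwise)
      fix i :: 'a
      have "continuous_on (ball p r \<times> cbox a b) (\<lambda>z. D z (i, 0))"
        by (rule continuous_on_subset[OF D]) (use r in auto)
      then show "continuous_on (ball p r \<times> cbox a b) (\<lambda>z. blinfun_apply (case z of (q, x) \<Rightarrow> fx q x) i)"
        by (rule continuous_on_eq) (use r fx in \<open>auto simp: subset_iff\<close>)
    qed
  qed (use r in auto)
  then have "((\<lambda>q. integral {a..b} (\<lambda>x. g (q, x))) has_derivative
      blinfun_apply (integral {a..b} (fx p))) (at p)"
    using r at_within_open[of p "ball p r"] by simp
  moreover have "blinfun_apply (integral {a..b} (fx p)) h = integral {a..b} (\<lambda>x. D (p, x) (h, 0))" for h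
  proof -
    have c: "continuous_on {a..b} (fx p)"
    proof (rule continuous_on_blinfun_componentwise)
      fix i :: 'a
      have "continuous_on {a..b} (\<lambda>x. D (p, x) (i, 0))"
        by (rule continuous_on_compose2[OF D]) (use \<Omega> in \<open>auto intro!: continuous_intros\<close>)
      then show "continuous_on {a..b} (\<lambda>x. blinfun_apply (fx p x) i)" by (simp add: fx \<Omega>)
    qed
    show ?thesis
      using blinfun_apply_integral[OF integrable_continuous_interval[OF c], of h] by (simp add: fx \<Omega>)
  qed
  ultimately show ?thesis by (metis (no_types, lifting) has_derivative_transform ext UNIV_I)
qed

lemma integral_scale_unit:
  fixes f :: "real \<Rightarrow> real"
  assumes "0 < T" "continuous_on UNIV f"
  shows "integral {0..T} f = T * integral {0..1} (\<lambda>s. f (T * s))"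
proof -
  have "f integrable_on {0..T}"
    using assms(2) by (intro integrable_continuous_interval) (auto intro: continuous_on_subset)
  then have "(f has_integral integral {0..T} f) {0..T}" by (rule integrable_integral)
  from has_integral_stretch_real[OF this, of T] assms(1)
  have "((\<lambda>x. f (T * x)) has_integral (1 / T) * integral {0..T} f) ((\<lambda>x. x / T) ` {0..T})" by simp
  moreover have "(\<lambda>x. x / T) ` {0..T} = {0..1}" using assms(1) by simp
  ultimately show ?thesis using assms(1) by (simp add: integral_unique)
qed

text \<open>The substitution \<open>x = T q s\<close> reduces a variable endpoint to a fixed one.\<close>

lemma leibniz_rule_variable:
  fixes g :: "'a::euclidean_space \<times> real \<Rightarrow> real"
  assumes \<Omega>: "open \<Omega>" "p \<in> \<Omega>"
    and g: "\<And>z. z \<in> \<Omega> \<times> UNIV \<Longrightarrow> (g has_derivative D z) (at z)"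
    and D: "\<And>h. continuous_on (\<Omega> \<times> UNIV) (\<lambda>z. D z h)"
    and T: "\<And>q. q \<in> \<Omega> \<Longrightarrow> (T has_derivative T' q) (at q)" "\<And>h. continuous_on \<Omega> (\<lambda>q. T' q h)"
      "\<And>q. q \<in> \<Omega> \<Longrightarrow> 0 < T q"
  shows "((\<lambda>q. integral {0..T q} (\<lambda>x. g (q, x))) has_derivative
    (\<lambda>h. T' p h * g (p, T p) + integral {0..T p} (\<lambda>x. D (p, x) (h, 0)))) (at p)"
proof -
  have linD: "linear (D z)" if "z \<in> \<Omega> \<times> UNIV" for z using g[OF that] by (rule has_derivative_linear)
  have D_split: "D z (h, k) = D z (h, 0) + k * D z (0, 1)" if "z \<in> \<Omega> \<times> UNIV" for z h k
  proof -
    have "(h, k) = (h, 0) + k *\<^sub>R (0, 1)" by simp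
    then show ?thesis using linear_add[OF linD[OF that]] linear_scale[OF linD[OF that]]
      by (metis real_scaleR_def)
  qed
  have cT: "continuous_on \<Omega> T"
    using T(1) has_derivative_at_withinI has_derivative_continuous_on by blast
  have cg: "continuous_on (\<Omega> \<times> UNIV) g"
    using g has_derivative_at_withinI has_derivative_continuous_on by blast
  have cgq: "continuous_on S (\<lambda>x. g (q, x))" if "q \<in> \<Omega>" for q S
    by (rule continuous_on_compose2[OF cg]) (use that in \<open>auto intro!: continuous_intros\<close>)
  define G where "G z = g (fst z, T (fst z) * snd z)" for z
  define E where "E z h = D (fst z, T (fst z) * snd z) (fst h, T' (fst z) (fst h) * snd z + T (fst z) * snd h)" for z h
  have dG: "(G has_derivative E z) (at z)" if z: "z \<in> \<Omega> \<times> UNIV" for z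
  proof -
    have "((\<lambda>z. T (fst z)) has_derivative (\<lambda>h. T' (fst z) (fst h))) (at z)"
      by (rule has_derivative_compose[where f = fst and g = T, OF _ T(1)])
        (use z in \<open>auto intro!: derivative_eq_intros\<close>)
    then have "((\<lambda>z. (fst z, T (fst z) * snd z)) has_derivative
        (\<lambda>h. (fst h, T (fst z) * snd h + T' (fst z) (fst h) * snd z))) (at z)"
      by (intro has_derivative_Pair has_derivative_mult has_derivative_fst has_derivative_snd
          has_derivative_ident)
    then have "((\<lambda>z. g (fst z, T (fst z) * snd z)) has_derivative
        (\<lambda>h. D (fst z, T (fst z) * snd z) (fst h, T (fst z) * snd h + T' (fst z) (fst h) * snd z))) (at z)"
      by (rule has_derivative_compose[OF _ g]) (use z in auto)
    then show ?thesis unfolding G_def[abs_def] E_def[abs_def] by (simp add: add.commute)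
  qed
  have contE: "continuous_on (\<Omega> \<times> UNIV) (\<lambda>z. E z h)" for h
  proof -
    have 1: "continuous_on (\<Omega> \<times> UNIV) (\<lambda>z. T (fst z))"
      by (rule continuous_on_compose2[OF cT]) (auto intro!: continuous_intros)
    have 2: "continuous_on (\<Omega> \<times> UNIV) (\<lambda>z. T' (fst z) (fst h))"
      by (rule continuous_on_compose2[OF T(2)]) (auto intro!: continuous_intros)
    have 3: "continuous_on (\<Omega> \<times> UNIV) (\<lambda>z. D (fst z, T (fst z) * snd z) k)" for k
      by (rule continuous_on_compose2[OF D]) (auto intro!: continuous_intros 1)
    have "continuous_on (\<Omega> \<times> UNIV) (\<lambda>z. D (fst z, T (fst z) * snd z) (fst h, 0)
        + (T' (fst z) (fst h) * snd z + T (fst z) * snd h) * D (fst z, T (fst z) * snd z) (0, 1))"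
      by (intro continuous_intros 1 2 3)
    then show ?thesis
    proof (rule continuous_on_eq)
      fix z :: "'a \<times> real" assume "z \<in> \<Omega> \<times> UNIV"
      then show "D (fst z, T (fst z) * snd z) (fst h, 0)
        + (T' (fst z) (fst h) * snd z + T (fst z) * snd h) * D (fst z, T (fst z) * snd z) (0, 1) = E z h"
        unfolding E_def by (subst (3) D_split) auto
    qed
  qed
  have "((\<lambda>q. T q * integral {0..1} (\<lambda>s. G (q, s))) has_derivative
      (\<lambda>h. T p * integral {0..1} (\<lambda>s. E (p, s) (h, 0)) + T' p h * integral {0..1} (\<lambda>s. G (p, s)))) (at p)"
    by (rule has_derivative_mult[OF T(1)[OF \<Omega>(2)] leibniz_rule_open[OF \<Omega> dG contE]])
  then have "((\<lambda>q. integral {0..T q} (\<lambda>x. g (q, x))) has_derivative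
      (\<lambda>h. T p * integral {0..1} (\<lambda>s. E (p, s) (h, 0)) + T' p h * integral {0..1} (\<lambda>s. G (p, s)))) (at p)"
  proof (rule has_derivative_transform_within_open[OF _ \<Omega>])
    show "T q * integral {0..1} (\<lambda>s. G (q, s)) = integral {0..T q} (\<lambda>x. g (q, x))" if "q \<in> \<Omega>" for q
      using integral_scale_unit[OF T(3)[OF that] cgq[OF that]] by (simp add: G_def)
  qed
  moreover have "T p * integral {0..1} (\<lambda>s. E (p, s) (h, 0)) + T' p h * integral {0..1} (\<lambda>s. G (p, s))
      = T' p h * g (p, T p) + integral {0..T p} (\<lambda>x. D (p, x) (h, 0))" for h
  proof -
    have cDk: "continuous_on S (\<lambda>x. D (p, x) k)" for k S
      by (rule continuous_on_compose2[OF D]) (use \<Omega> in \<open>auto intro!: continuous_intros\<close>)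
    have cDs: "continuous_on {0..1} (\<lambda>s. D (p, T p * s) k)" for k
      by (rule continuous_on_compose2[OF cDk[of UNIV]]) (auto intro!: continuous_intros)
    have dg: "((\<lambda>s. g (p, T p * s)) has_real_derivative T p * D (p, T p * s) (0, 1)) (at s)" for s
    proof -
      have "((\<lambda>s. g (p, T p * s)) has_derivative (\<lambda>k. D (p, T p * s) (0, T p * k))) (at s)"
        by (rule has_derivative_compose[OF _ g]) (use \<Omega> in \<open>auto intro!: derivative_eq_intros\<close>)
      moreover have "D (p, T p * s) (0, T p * k) = T p * D (p, T p * s) (0, 1) * k" for k
        using D_split[of "(p, T p * s)" 0 "T p * k"] linear_0[OF linD[of "(p, T p * s)"]] \<Omega>
        by (simp add: zero_prod_def)
      ultimately show ?thesis unfolding has_field_derivative_def by simp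
    qed
    \<comment> \<open>The integrand is the derivative of \<open>s * g (p, T p * s)\<close>; its
      integral turns all terms carrying \<open>T' p h\<close> into the endpoint value
      \<open>g (p, T p)\<close>.\<close>
    have "((\<lambda>s. 1 * g (p, T p * s) + s * (T p * D (p, T p * s) (0, 1))) has_integral
        1 * g (p, T p * 1) - 0 * g (p, T p * 0)) {0..1}"
    proof (rule fundamental_theorem_of_calculus)
      fix s :: real
      have "((\<lambda>s. s * g (p, T p * s)) has_real_derivative
          1 * g (p, T p * s) + (T p * D (p, T p * s) (0, 1)) * s) (at s)"
        by (rule DERIV_mult[OF DERIV_ident dg])
      then show "((\<lambda>s. s * g (p, T p * s)) has_vector_derivative
          1 * g (p, T p * s) + s * (T p * D (p, T p * s) (0, 1))) (at s within {0..1})"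
        unfolding has_real_derivative_iff_has_vector_derivative[symmetric] mult.commute[of s]
        by (rule has_field_derivative_at_within)
    qed simp
    then have I1: "((\<lambda>s. g (p, T p * s) + s * (T p * D (p, T p * s) (0, 1))) has_integral g (p, T p)) {0..1}"
      by simp
    have I2: "((\<lambda>s. D (p, T p * s) (h, 0)) has_integral integral {0..1} (\<lambda>s. D (p, T p * s) (h, 0))) {0..1}"
      by (intro integrable_integral integrable_continuous_interval cDs)
    have cG: "continuous_on {0..1} (\<lambda>s. G (p, s))"
      unfolding G_def fst_conv snd_conv
      by (rule continuous_on_compose2[OF cgq[OF \<Omega>(2), of UNIV]]) (auto intro!: continuous_intros)
    have cE: "continuous_on {0..1} (\<lambda>s. E (p, s) (h, 0))"
      by (rule continuous_on_compose2[OF contE]) (use \<Omega> in \<open>auto intro!: continuous_intros\<close>)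
    have "((\<lambda>s. T p * E (p, s) (h, 0) + T' p h * G (p, s)) has_integral
        T p * integral {0..1} (\<lambda>s. E (p, s) (h, 0)) + T' p h * integral {0..1} (\<lambda>s. G (p, s))) {0..1}"
      by (intro has_integral_add has_integral_mult_right integrable_integral integrable_continuous_interval cE cG)
    moreover have "((\<lambda>s. T p * E (p, s) (h, 0) + T' p h * G (p, s)) has_integral
        T' p h * g (p, T p) + T p * integral {0..1} (\<lambda>s. D (p, T p * s) (h, 0))) {0..1}"
    proof (rule has_integral_eq[OF _ has_integral_add[OF has_integral_mult_right[OF I1, of "T' p h"]
            has_integral_mult_right[OF I2, of "T p"]]])
      fix s :: real
      have "E (p, s) (h, 0) = D (p, T p * s) (h, 0) + (T' p h * s) * D (p, T p * s) (0, 1)"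
        using D_split[of "(p, T p * s)" h "T' p h * s"] \<Omega> by (simp add: E_def)
      then show "T' p h * (g (p, T p * s) + s * (T p * D (p, T p * s) (0, 1))) + T p * D (p, T p * s) (h, 0)
          = T p * E (p, s) (h, 0) + T' p h * G (p, s)"
        by (simp add: G_def algebra_simps)
    qed
    ultimately have "T p * integral {0..1} (\<lambda>s. E (p, s) (h, 0)) + T' p h * integral {0..1} (\<lambda>s. G (p, s))
      = T' p h * g (p, T p) + T p * integral {0..1} (\<lambda>s. D (p, T p * s) (h, 0))"
      by (rule has_integral_unique)
    then show ?thesis
      using integral_scale_unit[OF T(3)[OF \<Omega>(2)] cDk, of "(h, 0)"] by simp
  qed
  ultimately show ?thesis by simp
qed

text \<open>With one space derivative known to be C1, the increment of \<open>r q\<close> over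
  \<open>[x - 1, y]\<close> is an integral of \<open>r1 q\<close>; it is differentiated under the
  integral in \<open>q\<close> and then in the endpoint \<open>y\<close>. The base point
  \<open>x - 1\<close> is any point left of \<open>x\<close>.\<close>

lemma mixed_partial_commute:
  fixes r r1 :: "'a::euclidean_space \<Rightarrow> real \<Rightarrow> real"
  assumes \<Omega>: "open \<Omega>" "p \<in> \<Omega>"
    and r: "\<And>z. z \<in> \<Omega> \<times> UNIV \<Longrightarrow> ((\<lambda>(q, x). r q x) has_derivative D0 z) (at z)"
    and r1: "\<And>z. z \<in> \<Omega> \<times> UNIV \<Longrightarrow> ((\<lambda>(q, x). r1 q x) has_derivative D1 z) (at z)"
    and D1: "\<And>h. continuous_on (\<Omega> \<times> UNIV) (\<lambda>z. D1 z h)"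
    and dr: "\<And>q x. q \<in> \<Omega> \<Longrightarrow> (r q has_real_derivative r1 q x) (at x)"
  shows "((\<lambda>x. D0 (p, x) (h, 0)) has_real_derivative D1 (p, x) (h, 0)) (at x)"
proof -
  have rq: "((\<lambda>q. r q y) has_derivative (\<lambda>h. D0 (p, y) (h, 0))) (at p)" for y
    using has_derivative_compose[where f = "\<lambda>q. (q, y)" and g = "\<lambda>(q, x). r q x",
        OF has_derivative_Pair[OF has_derivative_ident has_derivative_const] r, of p] \<Omega> by simp
  have int: "D0 (p, y) (h, 0) - D0 (p, x - 1) (h, 0) = integral {x - 1..y} (\<lambda>s. D1 (p, s) (h, 0))"
    if y: "x - 1 \<le> y" for y
  proof -
    have "((\<lambda>q. integral {x - 1..y} (\<lambda>s. (\<lambda>(q, x). r1 q x) (q, s))) has_derivative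
        (\<lambda>h. integral {x - 1..y} (\<lambda>s. D1 (p, s) (h, 0)))) (at p)"
      by (rule leibniz_rule_open[OF \<Omega> r1 D1])
    moreover have "integral {x - 1..y} (\<lambda>s. (\<lambda>(q, x). r1 q x) (q, s)) = r q y - r q (x - 1)" if "q \<in> \<Omega>" for q
      using dr[OF that] y
      by (intro integral_unique fundamental_theorem_of_calculus)
        (auto simp: has_real_derivative_iff_has_vector_derivative[symmetric] intro: has_field_derivative_at_within)
    ultimately have 1: "((\<lambda>q. r q y - r q (x - 1)) has_derivative
        (\<lambda>h. integral {x - 1..y} (\<lambda>s. D1 (p, s) (h, 0)))) (at p)"
      by (rule has_derivative_transform_within_open[OF _ \<Omega>])
    have 2: "((\<lambda>q. r q y - r q (x - 1)) has_derivative (\<lambda>h. D0 (p, y) (h, 0) - D0 (p, x - 1) (h, 0))) (at p)"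
      by (rule has_derivative_diff[OF rq rq])
    show ?thesis using fun_cong[OF has_derivative_unique[OF 2 1], of h] .
  qed
  have c: "continuous_on {x - 1..x + 1} (\<lambda>s. D1 (p, s) (h, 0))"
    by (rule continuous_on_compose2[OF D1]) (use \<Omega> in \<open>auto intro!: continuous_intros\<close>)
  have "((\<lambda>y. integral {x - 1..y} (\<lambda>s. D1 (p, s) (h, 0))) has_real_derivative D1 (p, x) (h, 0)) (at x within {x - 1..x + 1})"
    by (rule integral_has_real_derivative[OF c]) simp
  then have "((\<lambda>y. integral {x - 1..y} (\<lambda>s. D1 (p, s) (h, 0))) has_real_derivative D1 (p, x) (h, 0)) (at x)"
    by (simp add: at_within_Icc_at)
  then have "((\<lambda>y. D0 (p, x - 1) (h, 0) + integral {x - 1..y} (\<lambda>s. D1 (p, s) (h, 0))) has_real_derivative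
      0 + D1 (p, x) (h, 0)) (at x)"
    by (intro DERIV_add DERIV_const)
  then have "((\<lambda>y. D0 (p, x - 1) (h, 0) + integral {x - 1..y} (\<lambda>s. D1 (p, s) (h, 0))) has_real_derivative
      D1 (p, x) (h, 0)) (at x)" by simp
  note D = this
  have eq: "D0 (p, x - 1) (h, 0) + integral {x - 1..y} (\<lambda>s. D1 (p, s) (h, 0)) = D0 (p, y) (h, 0)"
    if "y \<in> {x - 1<..<x + 1}" for y
    using int[of y] that by simp
  show ?thesis
    by (rule has_field_derivative_transform_within_open[OF D, of "{x - 1<..<x + 1}"]) (use eq in auto)
qed

text \<open>Second derivatives are required at \<open>p\<close> only. The second difference over a
  parallelogram of side \<open>s\<close> is symmetric in \<open>u\<close> and \<open>v\<close>, and
  the mean value theorem along \<open>u\<close> equates it with \<open>s^2 * Du v\<close> up to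
  \<open>o(s^2)\<close>.\<close>

lemma symmetric_second_derivative:
  fixes F :: "'a::real_normed_vector \<Rightarrow> real"
  assumes \<Omega>: "open \<Omega>" "p \<in> \<Omega>" and F: "\<And>q. q \<in> \<Omega> \<Longrightarrow> (F has_derivative F' q) (at q)"
    and Fu: "((\<lambda>q. F' q u) has_derivative Du) (at p)" and Fv: "((\<lambda>q. F' q v) has_derivative Dv) (at p)"
    and norms: "norm u = 1" "norm v = 1"
  shows "Du v = Dv u"
proof -
  obtain r where r: "0 < r" "ball p r \<subseteq> \<Omega>" using \<Omega> open_contains_ball by blast
  have key: "\<exists>d>0. \<forall>s. 0 < s \<and> s < d \<longrightarrow>
      \<bar>(F (p + s *\<^sub>R u + s *\<^sub>R v) - F (p + s *\<^sub>R u) - F (p + s *\<^sub>R v) + F p) - s\<^sup>2 * D v\<bar> \<le> 3 * e * s\<^sup>2"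
    if e: "0 < e" and D: "((\<lambda>q. F' q u) has_derivative D) (at p)" and uv: "norm u = 1" "norm v = 1" for e u v D
  proof -
    have linD: "linear D" using D by (rule has_derivative_linear)
    obtain d0 where d0: "0 < d0" "\<And>q. norm (q - p) < d0 \<Longrightarrow> \<bar>F' q u - F' p u - D (q - p)\<bar> \<le> e * norm (q - p)"
      using D e unfolding has_derivative_at_alt by (metis real_norm_def)
    define d where "d = min r d0 / 2"
    have d: "0 < d" "2 * d \<le> r" "2 * d \<le> d0" using r d0 by (auto simp: d_def)
    show ?thesis
    proof (intro exI[of _ d] conjI allI impI)
      fix s assume s: "0 < s \<and> s < d"
      define a where "a t = F (p + t *\<^sub>R u + s *\<^sub>R v) - F (p + t *\<^sub>R u)" for t
      define a1 where "a1 t = F' (p + t *\<^sub>R u + s *\<^sub>R v) u - F' (p + t *\<^sub>R u) u" for t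
      have nrm: "norm (t *\<^sub>R u + s *\<^sub>R v) \<le> 2 * s" "norm (t *\<^sub>R u) \<le> s" if "0 \<le> t" "t \<le> s" for t
        using norm_triangle_ineq[of "t *\<^sub>R u" "s *\<^sub>R v"] that uv s by auto
      have inO: "p + t *\<^sub>R u + s *\<^sub>R v \<in> \<Omega>" "p + t *\<^sub>R u \<in> \<Omega>" if "0 \<le> t" "t \<le> s" for t
      proof -
        have "dist p (p + t *\<^sub>R u + s *\<^sub>R v) < r" "dist p (p + t *\<^sub>R u) < r"
          using nrm[OF that] s d by (auto simp: dist_norm norm_minus_commute algebra_simps)
        then show "p + t *\<^sub>R u + s *\<^sub>R v \<in> \<Omega>" "p + t *\<^sub>R u \<in> \<Omega>" using r by auto
      qed
      have line: "((\<lambda>t. F (w + t *\<^sub>R u)) has_real_derivative F' (w + t *\<^sub>R u) u) (at t)"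
        if "w + t *\<^sub>R u \<in> \<Omega>" for w t
      proof -
        have "((\<lambda>t. F (w + t *\<^sub>R u)) has_derivative (\<lambda>k. F' (w + t *\<^sub>R u) (k *\<^sub>R u))) (at t)"
          by (rule has_derivative_compose[where f = "\<lambda>t. w + t *\<^sub>R u" and g = F, OF _ F[OF that]])
            (auto intro!: derivative_eq_intros)
        moreover have "F' (w + t *\<^sub>R u) (k *\<^sub>R u) = F' (w + t *\<^sub>R u) u * k" for k
          using linear_scale[OF has_derivative_linear[OF F[OF that]]] by (simp add: mult.commute)
        ultimately show ?thesis unfolding has_field_derivative_def by simp
      qed
      have "(a has_real_derivative a1 t) (at t)" if t: "0 \<le> t" "t \<le> s" for t
      proof -
        have eq: "p + t *\<^sub>R u + s *\<^sub>R v = (p + s *\<^sub>R v) + t *\<^sub>R u" for t by simp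
        show ?thesis unfolding a_def a1_def using inO[OF t]
          unfolding eq by (intro DERIV_diff line)
      qed
      then obtain \<xi> where \<xi>: "0 < \<xi>" "\<xi> < s" "a s - a 0 = (s - 0) * a1 \<xi>"
        using MVT2[of 0 s a a1] s by auto
      have 1: "\<bar>F' (p + \<xi> *\<^sub>R u + s *\<^sub>R v) u - F' p u - D (\<xi> *\<^sub>R u + s *\<^sub>R v)\<bar> \<le> e * (2 * s)"
      proof -
        have "norm (\<xi> *\<^sub>R u + s *\<^sub>R v) < d0" using nrm(1)[of \<xi>] \<xi> s d by simp
        then have "\<bar>F' (p + \<xi> *\<^sub>R u + s *\<^sub>R v) u - F' p u - D (\<xi> *\<^sub>R u + s *\<^sub>R v)\<bar> \<le> e * norm (\<xi> *\<^sub>R u + s *\<^sub>R v)"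
          using d0(2)[of "p + \<xi> *\<^sub>R u + s *\<^sub>R v"] by (simp add: add.assoc)
        also have "\<dots> \<le> e * (2 * s)" using nrm(1)[of \<xi>] \<xi> e by (intro mult_left_mono) auto
        finally show ?thesis .
      qed
      have 2: "\<bar>F' (p + \<xi> *\<^sub>R u) u - F' p u - D (\<xi> *\<^sub>R u)\<bar> \<le> e * s"
      proof -
        have "norm (\<xi> *\<^sub>R u) < d0" using nrm(2)[of \<xi>] \<xi> s d by simp
        then have "\<bar>F' (p + \<xi> *\<^sub>R u) u - F' p u - D (\<xi> *\<^sub>R u)\<bar> \<le> e * norm (\<xi> *\<^sub>R u)"
          using d0(2)[of "p + \<xi> *\<^sub>R u"] by simp
        also have "\<dots> \<le> e * s" using nrm(2)[of \<xi>] \<xi> e by (intro mult_left_mono) auto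
        finally show ?thesis .
      qed
      have "D (\<xi> *\<^sub>R u + s *\<^sub>R v) = D (\<xi> *\<^sub>R u) + s * D v"
        by (simp add: linear_add[OF linD] linear_scale[OF linD])
      \<comment> \<open>The displacements have norms at most \<open>2 * s\<close> and
        \<open>s\<close>, whence the factor 3.\<close>
      then have "\<bar>a1 \<xi> - s * D v\<bar> \<le> 3 * e * s" using 1 2 unfolding a1_def by linarith
      then have "s * \<bar>a1 \<xi> - s * D v\<bar> \<le> s * (3 * e * s)" using s by (intro mult_left_mono) auto
      then have "\<bar>s * a1 \<xi> - s\<^sup>2 * D v\<bar> \<le> 3 * e * s\<^sup>2"
        using s by (simp add: abs_mult_pos' power2_eq_square algebra_simps flip: abs_mult_pos)
      moreover have "s * a1 \<xi> = F (p + s *\<^sub>R u + s *\<^sub>R v) - F (p + s *\<^sub>R u) - F (p + s *\<^sub>R v) + F p"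
        using \<xi>(3) by (simp add: a_def)
      ultimately show "\<bar>(F (p + s *\<^sub>R u + s *\<^sub>R v) - F (p + s *\<^sub>R u) - F (p + s *\<^sub>R v) + F p) - s\<^sup>2 * D v\<bar> \<le> 3 * e * s\<^sup>2"
        by simp
    qed (rule d(1))
  qed
  have "\<bar>Du v - Dv u\<bar> \<le> 0 + e" if "0 < e" for e :: real
  proof -
    have e6: "0 < e / 6" using that by simp
    obtain d where d: "0 < d" "\<And>s. 0 < s \<Longrightarrow> s < d \<Longrightarrow>
      \<bar>(F (p + s *\<^sub>R u + s *\<^sub>R v) - F (p + s *\<^sub>R u) - F (p + s *\<^sub>R v) + F p) - s\<^sup>2 * Du v\<bar> \<le> 3 * (e / 6) * s\<^sup>2"
      using key[OF e6 Fu norms] by blast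
    obtain d' where d': "0 < d'" "\<And>s. 0 < s \<Longrightarrow> s < d' \<Longrightarrow>
      \<bar>(F (p + s *\<^sub>R v + s *\<^sub>R u) - F (p + s *\<^sub>R v) - F (p + s *\<^sub>R u) + F p) - s\<^sup>2 * Dv u\<bar> \<le> 3 * (e / 6) * s\<^sup>2"
      using key[OF e6 Fv norms(2,1)] by blast
    define s where "s = min d d' / 2"
    have s: "0 < s" "s < d" "s < d'" using d d' by (auto simp: s_def)
    have comm: "p + s *\<^sub>R v + s *\<^sub>R u = p + s *\<^sub>R u + s *\<^sub>R v" by simp
    have "\<bar>s\<^sup>2 * Du v - s\<^sup>2 * Dv u\<bar> \<le> e * s\<^sup>2"
      using d(2)[OF s(1,2)] d'(2)[OF s(1,3)] unfolding comm by linarith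
    then have "\<bar>s\<^sup>2 * (Du v - Dv u)\<bar> \<le> s\<^sup>2 * e" by (simp add: algebra_simps)
    then have "s\<^sup>2 * \<bar>Du v - Dv u\<bar> \<le> s\<^sup>2 * e" unfolding abs_mult by simp
    then show ?thesis using s by (simp add: mult_le_cancel_left)
  qed
  then have "\<bar>Du v - Dv u\<bar> \<le> 0" by (rule field_le_epsilon)
  then show ?thesis by simp
qed

lemma partial_eq:
  assumes "(F has_derivative F') (at p)"
  shows "partial i F p = F' (axis i 1)"
proof -
  have "((\<lambda>t. F (p + t *\<^sub>R axis i 1)) has_derivative (\<lambda>k. F' (k *\<^sub>R axis i 1))) (at 0)"
    by (rule has_derivative_compose[where g = F and f = "\<lambda>t. p + t *\<^sub>R axis i 1"])
      (use assms in \<open>auto intro!: derivative_eq_intros\<close>)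
  moreover have "F' (k *\<^sub>R axis i 1) = F' (axis i 1) * k" for k
    using linear_scale[OF has_derivative_linear[OF assms]] by (simp add: mult.commute)
  ultimately have "((\<lambda>t. F (p + t *\<^sub>R axis i 1)) has_real_derivative F' (axis i 1)) (at 0)"
    unfolding has_field_derivative_def by simp
  then show ?thesis unfolding partial_def by (rule DERIV_imp_deriv)
qed

text \<open>The gradient is known throughout \<Omega>, but its components need a derivative only at
  \<open>p\<close>; this is enough for the symmetry as well.\<close>

lemma Hessian_eq:
  assumes \<Omega>: "open \<Omega>" "p \<in> \<Omega>"
    and F: "\<And>q. q \<in> \<Omega> \<Longrightarrow> (F has_derivative (\<lambda>h. \<Sum>k\<in>UNIV. G k q * h $ k)) (at q)"
    and G: "\<And>k. (G k has_derivative G' k) (at p)"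
  shows "Hessian F p $ i $ k = G' k (axis i 1)" "transpose (Hessian F p) = Hessian F p"
proof -
  have s: "(\<Sum>k\<in>UNIV. G k q * axis j 1 $ k) = G j q" for j q
    by (simp add: axis_def if_distrib cong: if_cong)
  have pk: "partial k F q = G k q" if "q \<in> \<Omega>" for k q
    using partial_eq[OF F[OF that]] by (simp add: s)
  have "(partial k F has_derivative G' k) (at p)" for k
    by (rule has_derivative_transform_within_open[OF G \<Omega>]) (simp add: pk)
  then show H: "Hessian F p $ i $ k = G' k (axis i 1)" for i k
    unfolding Hessian_def by (simp add: partial_eq)
  have "G' k (axis i 1) = G' i (axis k 1)" for i k
    by (rule symmetric_second_derivative[OF \<Omega> F])
      (simp_all add: s G)
  then show "transpose (Hessian F p) = Hessian F p"
    by (simp add: vec_eq_iff transpose_def H)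
qed

section \<open>Families of profiles\<close>

lemma smooth_familyE:
  assumes "smooth_family \<Omega> r z T"
  obtains D0 D1 D2 T' where
    "\<And>s. s \<in> \<Omega> \<times> UNIV \<Longrightarrow> ((\<lambda>(q, x). r q x) has_derivative D0 s) (at s)" "\<And>h. continuous_on (\<Omega> \<times> UNIV) (\<lambda>s. D0 s h)"
    "\<And>s. s \<in> \<Omega> \<times> UNIV \<Longrightarrow> ((\<lambda>(q, x). deriv (r q) x) has_derivative D1 s) (at s)" "\<And>h. continuous_on (\<Omega> \<times> UNIV) (\<lambda>s. D1 s h)"
    "\<And>s. s \<in> \<Omega> \<times> UNIV \<Longrightarrow> ((\<lambda>(q, x). z q x) has_derivative D2 s) (at s)" "\<And>h. continuous_on (\<Omega> \<times> UNIV) (\<lambda>s. D2 s h)"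
    "\<And>q. q \<in> \<Omega> \<Longrightarrow> (T has_derivative T' q) (at q)" "\<And>h. continuous_on \<Omega> (\<lambda>q. T' q h)"
proof -
  let ?F = "\<lambda>(q, x). (r q x, deriv (r q) x, z q x)"
  obtain D where D: "\<And>s. s \<in> \<Omega> \<times> UNIV \<Longrightarrow> (?F has_derivative D s) (at s)"
    "\<And>h. continuous_on (\<Omega> \<times> UNIV) (\<lambda>s. D s h)"
    using assms C1_onE[of "\<Omega> \<times> UNIV" ?F] unfolding smooth_family_def by blast
  obtain T' where T': "\<And>q. q \<in> \<Omega> \<Longrightarrow> (T has_derivative T' q) (at q)" "\<And>h. continuous_on \<Omega> (\<lambda>q. T' q h)"
    using assms C1_onE[of \<Omega> T] unfolding smooth_family_def by blast
  have eq: "(\<lambda>(q, x). r q x) = (\<lambda>s. fst (?F s))" "(\<lambda>(q, x). deriv (r q) x) = (\<lambda>s. fst (snd (?F s)))"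
    "(\<lambda>(q, x). z q x) = (\<lambda>s. snd (snd (?F s)))" by (auto simp: fun_eq_iff)
  show ?thesis
  proof (rule that[of "\<lambda>s h. fst (D s h)" "\<lambda>s h. fst (snd (D s h))" "\<lambda>s h. snd (snd (D s h))" T'])
    fix s assume s: "s \<in> \<Omega> \<times> (UNIV :: real set)"
    show "((\<lambda>(q, x). r q x) has_derivative (\<lambda>h. fst (D s h))) (at s)"
      unfolding eq by (intro has_derivative_fst D s)
    show "((\<lambda>(q, x). deriv (r q) x) has_derivative (\<lambda>h. fst (snd (D s h)))) (at s)"
      unfolding eq by (intro has_derivative_fst has_derivative_snd D s)
    show "((\<lambda>(q, x). z q x) has_derivative (\<lambda>h. snd (snd (D s h)))) (at s)"
      unfolding eq by (intro has_derivative_snd D s)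
  qed (intro continuous_on_fst continuous_on_snd D T'; assumption)+
qed

text \<open>\<open>D0\<close> and \<open>D1\<close> are joint derivatives of the profile and of its
  slope: arguments \<open>(h, 0)\<close> are parameter directions, \<open>(0, 1)\<close> is the
  space direction.\<close>

locale family =
  fixes \<Omega> :: "'a::euclidean_space set" and r r1 :: "'a \<Rightarrow> real \<Rightarrow> real" and T :: "'a \<Rightarrow> real"
    and D0 D1 :: "'a \<times> real \<Rightarrow> 'a \<times> real \<Rightarrow> real" and T' :: "'a \<Rightarrow> 'a \<Rightarrow> real"
  assumes \<Omega>: "open \<Omega>"
    and r: "\<And>s. s \<in> \<Omega> \<times> UNIV \<Longrightarrow> ((\<lambda>(q, x). r q x) has_derivative D0 s) (at s)"
      "\<And>h. continuous_on (\<Omega> \<times> UNIV) (\<lambda>s. D0 s h)"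
    and r1: "\<And>s. s \<in> \<Omega> \<times> UNIV \<Longrightarrow> ((\<lambda>(q, x). r1 q x) has_derivative D1 s) (at s)"
      "\<And>h. continuous_on (\<Omega> \<times> UNIV) (\<lambda>s. D1 s h)"
    and dr: "\<And>q x. q \<in> \<Omega> \<Longrightarrow> (r q has_real_derivative r1 q x) (at x)"
    and T: "\<And>q. q \<in> \<Omega> \<Longrightarrow> (T has_derivative T' q) (at q)"
    and per: "\<And>q. q \<in> \<Omega> \<Longrightarrow> is_period (T q) (r q)"
begin

lemma D0_space:
  assumes "q \<in> \<Omega>"
  shows "D0 (q, x) (0, 1) = r1 q x"
proof -
  have "((\<lambda>x. (q, x)) has_derivative (\<lambda>k. (0, k))) (at x)"
    by (rule has_derivative_Pair[OF has_derivative_const has_derivative_ident])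
  from has_derivative_compose[OF this r(1)] assms
  have "(r q has_derivative (\<lambda>k. D0 (q, x) (0, k))) (at x)" by simp
  moreover have "(r q has_derivative (\<lambda>k. r1 q x * k)) (at x)"
    using dr[OF assms] by (simp add: has_field_derivative_def)
  ultimately have "(\<lambda>k. D0 (q, x) (0, k)) = (\<lambda>k. r1 q x * k)" by (rule has_derivative_unique)
  from fun_cong[OF this, of 1] show ?thesis by simp
qed

lemma D0_commute:
  assumes "q \<in> \<Omega>"
  shows "((\<lambda>x. D0 (q, x) (h, 0)) has_real_derivative D1 (q, x) (h, 0)) (at x)"
  by (rule mixed_partial_commute[OF \<Omega> assms r(1) r1 dr])

lemma r1_per:
  assumes "q \<in> \<Omega>"
  shows "is_period (T q) (r1 q)"
  by (rule deriv_periodic[OF per[OF assms] dr[OF assms]])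

text \<open>Differentiating \<open>r q (x + T q) = r q x\<close> in \<open>q\<close> produces the
  derivative of the period times the slope. This is the source of the shear of \<psi>.\<close>

lemma D0_shift:
  assumes q: "q \<in> \<Omega>"
  shows "D0 (q, x + T q) (h, 0) = D0 (q, x) (h, 0) - T' q h * r1 q x"
proof -
  have lin: "linear (D0 (q, x + T q))" using r(1)[of "(q, x + T q)"] q by (auto intro: has_derivative_linear)
  have "((\<lambda>q. x + T q) has_derivative (\<lambda>h. 0 + T' q h)) (at q)"
    by (intro has_derivative_add has_derivative_const T q)
  then have "((\<lambda>q. (q, x + T q)) has_derivative (\<lambda>h. (h, T' q h))) (at q)"
    by (intro has_derivative_Pair has_derivative_ident) simp
  from has_derivative_compose[OF this r(1)] q
  have "((\<lambda>q. r q (x + T q)) has_derivative (\<lambda>h. D0 (q, x + T q) (h, T' q h))) (at q)" by simp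
  then have 1: "((\<lambda>q. r q x) has_derivative (\<lambda>h. D0 (q, x + T q) (h, T' q h))) (at q)"
    by (rule has_derivative_transform_within_open[OF _ \<Omega> q]) (use per in \<open>auto simp: is_period_def\<close>)
  have "((\<lambda>q. (q, x)) has_derivative (\<lambda>h. (h, 0))) (at q)"
    by (rule has_derivative_Pair[OF has_derivative_ident has_derivative_const])
  from has_derivative_compose[OF this r(1)] q
  have 2: "((\<lambda>q. r q x) has_derivative (\<lambda>h. D0 (q, x) (h, 0))) (at q)" by simp
  have "D0 (q, x + T q) (h, T' q h) = D0 (q, x) (h, 0)"
    by (rule fun_cong[OF has_derivative_unique[OF 1 2]])
  moreover have "(h, T' q h) = (h, 0) + T' q h *\<^sub>R (0, 1)" by simp
  then have "D0 (q, x + T q) (h, T' q h) = D0 (q, x + T q) (h, 0) + T' q h * D0 (q, x + T q) (0, 1)"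
    by (metis linear_add[OF lin] linear_scale[OF lin] real_scaleR_def)
  moreover have "D0 (q, x + T q) (0, 1) = r1 q x"
    using r1_per[OF q] by (simp add: D0_space[OF q] is_period_def)
  ultimately show ?thesis by simp
qed

end

section \<open>Energies quadratic in the slope, Eulerian and Lagrangian alike\<close>

locale energy =
  fixes E :: "real \<Rightarrow> real \<Rightarrow> real" and F F1 F2 K K1 K2 :: "real \<Rightarrow> real"
  assumes E: "\<And>s t. 0 < s \<Longrightarrow> E s t = F s + K s * t\<^sup>2 / 2"
    and F: "\<And>s. 0 < s \<Longrightarrow> (F has_real_derivative F1 s) (at s)"
      "\<And>s. 0 < s \<Longrightarrow> (F1 has_real_derivative F2 s) (at s)" "continuous_on {0<..} F2"
    and K: "\<And>s. 0 < s \<Longrightarrow> (K has_real_derivative K1 s) (at s)"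
      "\<And>s. 0 < s \<Longrightarrow> (K1 has_real_derivative K2 s) (at s)" "continuous_on {0<..} K2"
      "\<And>s. 0 < s \<Longrightarrow> 0 < K s"
begin

text \<open>The form of \<open>E\<close> is prescribed for positive fields only; differentiation
  sees just a neighbourhood.\<close>

lemma deriv_local:
  assumes "(g has_real_derivative D) (at s)" "0 < s" "\<And>t. 0 < t \<Longrightarrow> g t = h t"
  shows "deriv h s = D"
  by (rule DERIV_imp_deriv, rule has_field_derivative_transform_within_open[OF assms(1), of "{0<..}"])
    (use assms in auto)

lemma pd1_E: "0 < s \<Longrightarrow> pd1 E s t = F1 s + K1 s * t\<^sup>2 / 2"
  unfolding pd1_def
  by (rule deriv_local[of "\<lambda>s. F s + K s * t\<^sup>2 / 2"])
    (auto intro!: DERIV_add DERIV_cdivide DERIV_cmult_right F K simp: E)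

lemma pd2_E: "0 < s \<Longrightarrow> pd2 E s t = K s * t"
proof -
  assume "0 < s"
  then have "E s = (\<lambda>t. F s + K s * t\<^sup>2 / 2)" by (simp add: fun_eq_iff E)
  then show ?thesis
    unfolding pd2_def by (auto intro!: DERIV_imp_deriv derivative_eq_intros)
qed

lemma pd22_E: "0 < s \<Longrightarrow> pd2 (pd2 E) s t = K s"
proof -
  assume "0 < s"
  then have "pd2 E s = (\<lambda>t. K s * t)" by (simp add: fun_eq_iff pd2_E)
  then show ?thesis
    unfolding pd2_def[of "pd2 E"] by (auto intro!: DERIV_imp_deriv derivative_eq_intros)
qed

lemma pd12_E: "0 < s \<Longrightarrow> pd1 (pd2 E) s t = K1 s * t"
  unfolding pd1_def
  by (rule deriv_local[of "\<lambda>s. K s * t"]) (auto intro!: DERIV_cmult_right K simp: pd2_E)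

lemma pd11_E: "0 < s \<Longrightarrow> pd1 (pd1 E) s t = F2 s + K2 s * t\<^sup>2 / 2"
  unfolding pd1_def[of "pd1 E"]
  by (rule deriv_local[of "\<lambda>s. F1 s + K1 s * t\<^sup>2 / 2"])
    (auto intro!: DERIV_add DERIV_cdivide DERIV_cmult_right F K simp: pd1_E)

lemma along_deriv:
  assumes q: "\<And>x. (q has_real_derivative q1 x) (at x)" "\<And>x. (q1 has_real_derivative q2 x) (at x)" "\<And>x. 0 < q x"
  shows "deriv q = q1"
    "\<And>x. ((\<lambda>x. K (q x) * q1 x) has_real_derivative K1 (q x) * (q1 x)\<^sup>2 + K (q x) * q2 x) (at x)"
    "Euler_op E q x = F1 (q x) - K1 (q x) * (q1 x)\<^sup>2 / 2 - K (q x) * q2 x"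
    "Legendre_op E q x = K (q x) * (q1 x)\<^sup>2 / 2 - F (q x)"
    "Hess_op T E q h x = - weak_deriv T (\<lambda>s. K (q s) * deriv h s) x
       + (F2 (q x) - K2 (q x) * (q1 x)\<^sup>2 / 2 - K1 (q x) * q2 x) * h x"
proof -
  show dq: "deriv q = q1" using q(1) by (auto intro: DERIV_imp_deriv)
  have chain: "((\<lambda>x. f (q x) * q1 x) has_real_derivative f1 (q x) * (q1 x)\<^sup>2 + f (q x) * q2 x) (at x)"
    if "\<And>s. 0 < s \<Longrightarrow> (f has_real_derivative f1 s) (at s)" for f f1 x
    using DERIV_mult[OF DERIV_chain2[OF that[OF q(3)] q(1)] q(2)[of x]]
    by (simp add: power2_eq_square algebra_simps)
  show Kd: "((\<lambda>x. K (q x) * q1 x) has_real_derivative K1 (q x) * (q1 x)\<^sup>2 + K (q x) * q2 x) (at x)" for x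
    by (rule chain[OF K(1)])
  have a2: "along (pd2 E) q = (\<lambda>x. K (q x) * q1 x)" by (simp add: along_def fun_eq_iff dq pd2_E q)
  have a12: "along (pd1 (pd2 E)) q = (\<lambda>x. K1 (q x) * q1 x)" by (simp add: along_def fun_eq_iff dq pd12_E q)
  have a22: "along (pd2 (pd2 E)) q = (\<lambda>x. K (q x))" by (simp add: along_def fun_eq_iff pd22_E q)
  show "Euler_op E q x = F1 (q x) - K1 (q x) * (q1 x)\<^sup>2 / 2 - K (q x) * q2 x"
    unfolding Euler_op_def a2 DERIV_imp_deriv[OF Kd] by (simp add: along_def dq pd1_E q)
  show "Legendre_op E q x = K (q x) * (q1 x)\<^sup>2 / 2 - F (q x)"
    unfolding Legendre_op_def a2 by (simp add: along_def dq E q power2_eq_square)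
  show "Hess_op T E q h x = - weak_deriv T (\<lambda>s. K (q s) * deriv h s) x
       + (F2 (q x) - K2 (q x) * (q1 x)\<^sup>2 / 2 - K1 (q x) * q2 x) * h x"
  proof -
    have "deriv (\<lambda>x. K1 (q x) * q1 x) x = K2 (q x) * (q1 x)\<^sup>2 + K1 (q x) * q2 x"
      by (rule DERIV_imp_deriv, rule chain[OF K(2)])
    then show ?thesis
      unfolding Hess_op_def a12 a22 by (simp add: along_def dq pd11_E q)
  qed
qed

text \<open>Along the axis \<open>m\<close> the potential \<open>P\<close> stays fixed while the
  energy level grows at unit speed. Differentiating \<open>en\<close> at \<open>t = 0\<close> and
  inserting the profile equation gives the normalized Wronskian; \<tau> is the derivative of the
  period along the same axis.\<close>

theorem family_signature:
  fixes \<Omega> :: "(real^4) set"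
  assumes fam: "family \<Omega> r (\<lambda>q. deriv (r q)) T D0 D1 T'" and p: "p \<in> \<Omega>"
    and q2: "\<And>x. (deriv (r p) has_real_derivative q2 x) (at x)"
    and pos: "\<And>q x. q \<in> \<Omega> \<Longrightarrow> 0 < r q x" and fund: "fundamental_period (T p) (r p)"
    and P: "\<And>s. 0 < s \<Longrightarrow> (P has_real_derivative P1 s) (at s)"
      "\<And>s. 0 < s \<Longrightarrow> (P1 has_real_derivative P2 s) (at s)" "continuous_on {0<..} P2"
    and en: "\<And>t x. p + t *\<^sub>R axis m 1 \<in> \<Omega> \<Longrightarrow>
       K (r (p + t *\<^sub>R axis m 1) x) * (deriv (r (p + t *\<^sub>R axis m 1)) x)\<^sup>2 / 2
         - P (r (p + t *\<^sub>R axis m 1) x) = p $ m + t"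
    and eul: "\<And>x. Euler_op E (r p) x = F1 (r p x) - P1 (r p x)"
    and \<beta>: "continuous_on UNIV \<beta>" "is_period (T p) \<beta>"
    and \<gamma>: "continuous_on UNIV \<gamma>" "is_period (T p) \<gamma>" "\<And>x. 0 < \<gamma> x"
    and P2: "\<And>x. P2 (r p x) = F2 (r p x) - (\<beta> x)\<^sup>2 / \<gamma> x"
    and \<tau>: "T' p (axis m 1) \<noteq> 0"
  shows "neg_signature_operator (T p) (op_domain (T p))
      (\<lambda>U x. (Hess_op (T p) E (r p) (\<lambda>s. fst (U s)) x + \<beta> x * snd (U x), \<beta> x * fst (U x) + \<gamma> x * snd (U x)))
    = ereal (if T' p (axis m 1) < 0 then 2 else 1)"
proof -
  interpret family \<Omega> r "\<lambda>q. deriv (r q)" T D0 D1 T' by (rule fam)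
  let ?e = "axis m 1 :: real^4"
  define \<psi> where "\<psi> x = D0 (p, x) (?e, 0)" for x
  define \<psi>1 where "\<psi>1 x = D1 (p, x) (?e, 0)" for x
  note q = dr[OF p] q2 pos[OF p]
  define d where "d x = F2 (r p x) - K2 (r p x) * (deriv (r p) x)\<^sup>2 / 2 - K1 (r p x) * q2 x" for x
  have ode: "K (r p x) * q2 x = P1 (r p x) - K1 (r p x) * (deriv (r p) x)\<^sup>2 / 2" for x
    using eul[of x] along_deriv(3)[OF q, of x] by simp
  have wronski: "K (r p x) * (deriv (r p) x * \<psi>1 x - q2 x * \<psi> x) = 1" for x
  proof -
    have line: "((\<lambda>t. (p + t *\<^sub>R ?e, x)) has_derivative (\<lambda>k. (k *\<^sub>R ?e, 0))) (at 0)"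
      by (rule has_derivative_Pair[OF _ has_derivative_const]) (auto intro!: derivative_eq_intros)
    have along_line: "((\<lambda>t. g (p + t *\<^sub>R ?e) x) has_real_derivative D (?e, 0)) (at 0)"
      if g: "((\<lambda>(q, x). g q x) has_derivative D) (at (p, x))" for g :: "real^4 \<Rightarrow> real \<Rightarrow> real" and D
    proof -
      have "((\<lambda>t. (\<lambda>(q, x). g q x) (p + t *\<^sub>R ?e, x)) has_derivative (\<lambda>k. D (k *\<^sub>R ?e, 0))) (at 0)"
        by (rule has_derivative_compose[OF line]) (use g in simp)
      moreover have "D (k *\<^sub>R ?e, 0) = D (?e, 0) * k" for k
        using linear_scale[OF has_derivative_linear[OF g], of k "(?e, 0)"] by (simp add: mult.commute)
      ultimately show ?thesis unfolding has_field_derivative_def by simp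
    qed
    have d0: "((\<lambda>t. r (p + t *\<^sub>R ?e) x) has_real_derivative \<psi> x) (at 0)"
      unfolding \<psi>_def by (rule along_line[OF r(1)]) (use p in simp)
    have d1: "((\<lambda>t. deriv (r (p + t *\<^sub>R ?e)) x) has_real_derivative \<psi>1 x) (at 0)"
      unfolding \<psi>1_def by (rule along_line[OF r1(1)]) (use p in simp)
    have r0: "r (p + 0 *\<^sub>R ?e) x = r p x" "0 < r (p + 0 *\<^sub>R ?e) x" using pos[OF p] by auto
    let ?L = "\<lambda>t. K (r (p + t *\<^sub>R ?e) x) * (deriv (r (p + t *\<^sub>R ?e)) x)\<^sup>2 / 2 - P (r (p + t *\<^sub>R ?e) x)"
    have D: "(?L has_real_derivative (K1 (r p x) * \<psi> x * (deriv (r p) x)\<^sup>2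
        + 2 * deriv (r p) x * \<psi>1 x * K (r p x)) / 2 - P1 (r p x) * \<psi> x) (at 0)"
    proof -
      have dK: "((\<lambda>t. K (r (p + t *\<^sub>R ?e) x)) has_real_derivative K1 (r p x) * \<psi> x) (at 0)"
        and dP: "((\<lambda>t. P (r (p + t *\<^sub>R ?e) x)) has_real_derivative P1 (r p x) * \<psi> x) (at 0)"
        using DERIV_chain2[OF K(1)[OF r0(2)] d0] DERIV_chain2[OF P(1)[OF r0(2)] d0] by (simp_all add: r0)
      have dsq: "((\<lambda>t. (deriv (r (p + t *\<^sub>R ?e)) x)\<^sup>2) has_real_derivative 2 * deriv (r p) x * \<psi>1 x) (at 0)"
        using DERIV_power[OF d1, of 2] by (simp add: ac_simps)
      show ?thesis
        using DERIV_diff[OF DERIV_cdivide[OF DERIV_mult[OF dK dsq], of 2] dP] by simp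
    qed
    have "open ((\<lambda>t. p + t *\<^sub>R ?e) -` \<Omega>)"
      by (intro continuous_open_vimage \<Omega> continuous_intros)
    then have "((\<lambda>t. p $ m + t) has_real_derivative (K1 (r p x) * \<psi> x * (deriv (r p) x)\<^sup>2
        + 2 * deriv (r p) x * \<psi>1 x * K (r p x)) / 2 - P1 (r p x) * \<psi> x) (at 0)"
      by (rule has_field_derivative_transform_within_open[OF D]) (use p en in auto)
    moreover have "((\<lambda>t. p $ m + t) has_real_derivative 1) (at 0)" by (auto intro!: derivative_eq_intros)
    ultimately have "(K1 (r p x) * \<psi> x * (deriv (r p) x)\<^sup>2
        + 2 * deriv (r p) x * \<psi>1 x * K (r p x)) / 2 - P1 (r p x) * \<psi> x = 1"
      by (rule DERIV_unique)
    moreover have "K (r p x) * (deriv (r p) x * \<psi>1 x - q2 x * \<psi> x)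
        = K (r p x) * deriv (r p) x * \<psi>1 x - (K (r p x) * q2 x) * \<psi> x" by (simp add: algebra_simps)
    ultimately show ?thesis unfolding ode by (simp add: algebra_simps)
  qed
  interpret profile "T p" K K1 K2 P1 P2 "r p" "deriv (r p)" q2 \<psi> \<psi>1 d \<beta> \<gamma> "T' p ?e"
  proof
    show "(\<psi> has_real_derivative \<psi>1 x) (at x)" for x
      unfolding \<psi>_def \<psi>1_def by (rule D0_commute[OF p])
    show "continuous_on UNIV \<psi>1"
      unfolding \<psi>1_def by (rule continuous_on_compose2[OF r1(2)]) (use p in \<open>auto intro!: continuous_intros\<close>)
    show "\<psi> (x + T p) = \<psi> x - T' p ?e * deriv (r p) x" for x
      unfolding \<psi>_def by (rule D0_shift[OF p])
    show "d x - (\<beta> x)\<^sup>2 / \<gamma> x = P2 (r p x) - K2 (r p x) * (deriv (r p) x)\<^sup>2 / 2 - K1 (r p x) * q2 x" for x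
      by (simp add: d_def P2)
  qed (use K P q ode wronski \<beta> \<gamma> fund in auto)
  have "block_op (T p) (\<lambda>x. K (r p x)) d \<beta> \<gamma> =
      (\<lambda>U x. (Hess_op (T p) E (r p) (\<lambda>s. fst (U s)) x + \<beta> x * snd (U x), \<beta> x * fst (U x) + \<gamma> x * snd (U x)))"
    by (simp add: fun_eq_iff block_op_def along_deriv(5)[OF q(1-3)] d_def)
  then show ?thesis using profile_signature[OF \<tau>] by simp
qed

end

section \<open>The action\<close>

lemma C2_on_UNIV_E:
  assumes "C2_on UNIV f"
  obtains f2 where "\<And>x. (f has_real_derivative deriv f x) (at x)" "\<And>x. (deriv f has_real_derivative f2 x) (at x)"
proof -
  obtain f1 f2 where f: "\<And>x. (f has_real_derivative f1 x) (at x)" "\<And>x. (f1 has_real_derivative f2 x) (at x)"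
    using assms unfolding C2_on_def by blast
  have "deriv f = f1" using f(1) by (auto intro: DERIV_imp_deriv)
  then show ?thesis using that[of f2] f by simp
qed

text \<open>With \<open>V' = v\<close> one has \<open>V (Y x) = x + const\<close>, so that \<open>V\<close> inverts \<open>Y\<close> up to a translation.\<close>

lemma corresponding_period:
  assumes corr: "corresponding \<rho> u v w" and v: "continuous_on UNIV v" "\<And>y. 0 < v y"
    and \<Xi>: "fundamental_period \<Xi> (\<lambda>x. (\<rho> x, u x))" and \<Upsilon>: "fundamental_period \<Upsilon> (\<lambda>y. (v y, w y))"
  shows "\<Upsilon> = integral {0..\<Xi>} \<rho>"
proof -
  obtain Y where Y: "\<And>x. (Y has_real_derivative \<rho> x) (at x)" "\<And>x. \<rho> x = 1 / v (Y x)" "\<And>x. u x = w (Y x)"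
    using corr unfolding corresponding_def by blast
  have \<rho>_pos: "0 < \<rho> x" for x using Y(2) v(2) by simp
  obtain V where V: "\<And>y. (V has_real_derivative v y) (at y)"
    using einterval_antiderivative[of "-\<infinity>" "\<infinity>" v] v(1)
    by (auto simp: continuous_on_eq_continuous_at has_real_derivative_iff_has_vector_derivative)
  have V_mono: "V y < V z" if "y < z" for y z
    using DERIV_pos_imp_increasing[OF that, of V] V v(2) by blast
  have Y_mono: "Y y < Y z" if "y < z" for y z
    using DERIV_pos_imp_increasing[OF that, of Y] Y(1) \<rho>_pos by blast
  have V_inj: "y = z" if "V y = V z" for y z
    using V_mono[of y z] V_mono[of z y] that by (cases y z rule: linorder_cases) auto
  define c where "c = V (Y 0)"
  have VY: "V (Y x) = x + c" for x
  proof -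
    have "((\<lambda>x. V (Y x) - x) has_real_derivative v (Y x) * \<rho> x - 1) (at x)" for x
      by (intro DERIV_diff DERIV_chain2[OF V Y(1)] DERIV_ident)
    moreover have "v (Y x) * \<rho> x - 1 = 0" for x using Y(2)[of x] v(2)[of "Y x"] by simp
    ultimately have "\<And>x. ((\<lambda>x. V (Y x) - x) has_real_derivative 0) (at x)" by simp
    from DERIV_isconst_all[OF allI[OF this], of x 0] show ?thesis by (simp add: c_def)
  qed
  have shift: "H (x + S) = H x + (H (0 + S) - H 0)"
    if H: "\<And>x. (H has_real_derivative g x) (at x)" and S: "\<And>x. g (x + S) = g x" for H g :: "real \<Rightarrow> real" and S x
  proof -
    have "((\<lambda>x. H (x + S) - H x) has_real_derivative 0) (at x)" for x
    proof -
      have "((\<lambda>x. H (x + S)) has_real_derivative g (x + S)) (at x)"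
        using H by (subst DERIV_shift[symmetric]) simp
      from DERIV_diff[OF this H[of x]] S show ?thesis by simp
    qed
    from DERIV_isconst_all[OF allI[OF this], of x 0] show ?thesis by simp
  qed
  have per\<rho>: "\<rho> (x + \<Xi>) = \<rho> x" "u (x + \<Xi>) = u x" "0 < \<Xi>" for x
    using \<Xi> by (auto simp: fundamental_period_def is_period_def)
  have perv: "v (x + \<Upsilon>) = v x" "w (x + \<Upsilon>) = w x" "0 < \<Upsilon>" for x
    using \<Upsilon> by (auto simp: fundamental_period_def is_period_def)
  define M where "M = Y (0 + \<Xi>) - Y 0"
  define D where "D = V (0 + \<Upsilon>) - V 0"
  have YM: "Y (x + \<Xi>) = Y x + M" for x unfolding M_def by (rule shift[OF Y(1) per\<rho>(1)])
  have VD: "V (y + \<Upsilon>) = V y + D" for y unfolding D_def by (rule shift[OF V perv(1)])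
  have MD: "0 < M" "0 < D"
    using Y_mono[of 0 \<Xi>] V_mono[of 0 \<Upsilon>] per\<rho>(3) perv(3) by (auto simp: M_def D_def)
  have "is_period M (\<lambda>y. (v y, w y))"
    unfolding is_period_def
  proof
    fix y
    define x where "x = V y - c"
    have y: "Y x = y" by (rule V_inj) (simp add: VY x_def)
    have "v (Y x) = 1 / \<rho> x" for x using Y(2)[of x] by simp
    then have "v (Y (x + \<Xi>)) = v (Y x)" using per\<rho>(1)[of x] by simp
    moreover have "w (Y (x + \<Xi>)) = w (Y x)" using Y(3) per\<rho>(2) by metis
    ultimately show "(v (y + M), w (y + M)) = (v y, w y)" by (simp add: YM y)
  qed
  \<comment> \<open>Minimality is used in both directions: \<open>M\<close> is a period in the mass
    variable, \<open>D\<close> one in space, and monotonicity of \<open>Y\<close> turns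
    \<open>\<Xi> \<le> D\<close> into the reverse inequality
    \<open>M \<le> \<Upsilon>\<close>.\<close>
  then have le1: "\<Upsilon> \<le> M" using \<Upsilon> MD(1) by (auto simp: fundamental_period_def not_less[symmetric])
  have YD: "Y (x + D) = Y x + \<Upsilon>" for x by (rule V_inj) (simp add: VY VD)
  have "is_period D (\<lambda>x. (\<rho> x, u x))"
    by (simp add: is_period_def Y(2,3) YD perv)
  then have "\<Xi> \<le> D" using \<Xi> MD(2) by (auto simp: fundamental_period_def not_less[symmetric])
  then have "Y (0 + \<Xi>) \<le> Y (0 + D)" using Y_mono[of \<Xi> D] by (cases "\<Xi> = D") auto
  then have "M \<le> \<Upsilon>" using YD[of 0] by (simp add: M_def)
  with le1 have "\<Upsilon> = M" by simp
  also have "M = integral {0..\<Xi>} \<rho>"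
    unfolding M_def
    by (rule integral_unique[symmetric])
      (use fundamental_theorem_of_calculus[of 0 \<Xi> Y \<rho>] Y(1) per\<rho>(3) in
        \<open>auto simp: has_real_derivative_iff_has_vector_derivative[symmetric] intro: has_field_derivative_at_within\<close>)
  finally show ?thesis .
qed

lemma energy_lagr:
  assumes "C2_on {0<..} f" "C2_on {0<..} \<kappa>" "\<And>s. 0 < s \<Longrightarrow> 0 < \<kappa> s"
  obtains F1 F2 K1 K2 where "energy (lagr_energy f \<kappa>) f F1 F2 \<kappa> K1 K2"
  using assms unfolding C2_on_def energy_def lagr_energy_def by (metis greaterThan_iff)

text \<open>The fifth power comes from the factor \<rho> against the square of \<rho>^3 in the
  substituted slope.\<close>

lemma energy_euler:
  assumes "C2_on {0<..} f" "C2_on {0<..} \<kappa>" and pos: "\<And>s. 0 < s \<Longrightarrow> 0 < \<kappa> s"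
  obtains F1 F2 K1 K2 where
    "energy (euler_energy f \<kappa>) (\<lambda>s. s * f (1 / s)) F1 F2 (\<lambda>s. \<kappa> (1 / s) / s ^ 5) K1 K2"
proof -
  obtain f1 f2 where f: "\<And>s. 0 < s \<Longrightarrow> (f has_real_derivative f1 s) (at s)"
    "\<And>s. 0 < s \<Longrightarrow> (f1 has_real_derivative f2 s) (at s)" "continuous_on {0<..} f2"
    using assms(1) unfolding C2_on_def by (metis greaterThan_iff)
  obtain k1 k2 where k: "\<And>s. 0 < s \<Longrightarrow> (\<kappa> has_real_derivative k1 s) (at s)"
    "\<And>s. 0 < s \<Longrightarrow> (k1 has_real_derivative k2 s) (at s)" "continuous_on {0<..} k2"
    using assms(2) unfolding C2_on_def by (metis greaterThan_iff)
  have inv: "((\<lambda>s. g (1 / s)) has_real_derivative g1 (1 / s) * (- 1 / s\<^sup>2)) (at s)"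
    if "0 < s" "\<And>s. 0 < s \<Longrightarrow> (g has_real_derivative g1 s) (at s)" for g g1 and s :: real
    by (rule DERIV_chain2[OF that(2)])
      (use that(1) in \<open>auto intro!: derivative_eq_intros simp: power2_eq_square\<close>)
  have cont: "continuous_on {0<..} (\<lambda>s. g (1 / s))" if "continuous_on {0<..} g" for g :: "real \<Rightarrow> real"
    by (rule continuous_on_compose2[OF that]) (auto intro!: continuous_intros)
  have cd: "continuous_on {0<..} g" if "\<And>s. 0 < s \<Longrightarrow> (g has_real_derivative g1 s) (at s)" for g g1 :: "real \<Rightarrow> real"
    using that by (auto intro!: DERIV_continuous_on[OF has_field_derivative_at_within])
  show ?thesis
  proof (rule that, unfold_locales)
    fix s t :: real assume s: "0 < s"
    show "euler_energy f \<kappa> s t = s * f (1 / s) + \<kappa> (1 / s) / s ^ 5 * t\<^sup>2 / 2"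
      using s unfolding euler_energy_def lagr_energy_def by (simp add: field_simps eval_nat_numeral)
    show "0 < \<kappa> (1 / s) / s ^ 5" using s pos by simp
    show "((\<lambda>s. s * f (1 / s)) has_real_derivative f (1 / s) - f1 (1 / s) / s) (at s)"
      using s by (auto intro!: derivative_eq_intros inv[OF _ f(1)] simp: field_simps power2_eq_square)
    show "((\<lambda>s. f (1 / s) - f1 (1 / s) / s) has_real_derivative f2 (1 / s) / s ^ 3) (at s)"
      using s by (auto intro!: derivative_eq_intros inv[OF _ f(1)] inv[OF _ f(2)] simp: field_simps eval_nat_numeral)
    show "((\<lambda>s. \<kappa> (1 / s) / s ^ 5) has_real_derivative - k1 (1 / s) / s ^ 7 - 5 * \<kappa> (1 / s) / s ^ 6) (at s)"
      using s by (auto intro!: derivative_eq_intros inv[OF _ k(1)] simp: field_simps eval_nat_numeral)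
    show "((\<lambda>s. - k1 (1 / s) / s ^ 7 - 5 * \<kappa> (1 / s) / s ^ 6) has_real_derivative
        k2 (1 / s) / s ^ 9 + 12 * k1 (1 / s) / s ^ 8 + 30 * \<kappa> (1 / s) / s ^ 7) (at s)"
      using s by (auto intro!: derivative_eq_intros inv[OF _ k(1)] inv[OF _ k(2)] simp: field_simps eval_nat_numeral)
  next
    show "continuous_on {0<..} (\<lambda>s. f2 (1 / s) / s ^ 3)"
      by (intro continuous_intros cont f) auto
    show "continuous_on {0<..} (\<lambda>s. k2 (1 / s) / s ^ 9 + 12 * k1 (1 / s) / s ^ 8 + 30 * \<kappa> (1 / s) / s ^ 7)"
      by (intro continuous_intros cont k cd[OF k(1)] cd[OF k(2)]) auto
  qed
qed

text \<open>The derivatives of the integrand of the action in the four parameters at fixed profile.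
  The first integrates to the period \<Xi>, the second to \<Upsilon>.\<close>

definition action_density ::
  "(real^4 \<Rightarrow> real \<Rightarrow> real) \<Rightarrow> (real^4 \<Rightarrow> real \<Rightarrow> real) \<Rightarrow> 4 \<Rightarrow> (real^4) \<times> real \<Rightarrow> real" where
  "action_density \<rho> u k = (\<lambda>(q, x). if k = 1 then 1 else if k = 2 then \<rho> q x
     else if k = 3 then - u q x else - (\<rho> q x * u q x))"

context energy
begin

text \<open>By the Euler equation the variation of the profile contributes a total derivative, whose boundary
  term cancels the variation of the period by the third profile equation.\<close>

lemma action_has_derivative:
  fixes \<Omega> :: "(real^4) set"
  assumes fam: "family \<Omega> \<rho> (\<lambda>q. deriv (\<rho> q)) \<Xi> D0 D1 \<Xi>'"
    and D2: "\<And>s. s \<in> \<Omega> \<times> UNIV \<Longrightarrow> ((\<lambda>(q, x). u q x) has_derivative D2 s) (at s)"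
      "\<And>h. continuous_on (\<Omega> \<times> UNIV) (\<lambda>s. D2 s h)"
    and \<Xi>: "\<And>h. continuous_on \<Omega> (\<lambda>q. \<Xi>' q h)" "\<And>q. q \<in> \<Omega> \<Longrightarrow> 0 < \<Xi> q"
    and wave: "\<And>q. q \<in> \<Omega> \<Longrightarrow> eulerian_wave E (q $ 1) (q $ 2) (q $ 3) (q $ 4) (\<rho> q) (u q) (\<Xi> q)"
    and p: "p \<in> \<Omega>"
  shows "(action E \<rho> u \<Xi> has_derivative
    (\<lambda>h. \<Sum>k\<in>UNIV. integral {0..\<Xi> p} (\<lambda>x. action_density \<rho> u k (p, x)) * h $ k)) (at p)"
proof -
  interpret family \<Omega> \<rho> "\<lambda>q. deriv (\<rho> q)" \<Xi> D0 D1 \<Xi>' by (rule fam)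
  define R where "R = (\<lambda>(q, x). \<rho> q x)"
  define S where "S = (\<lambda>(q, x). deriv (\<rho> q) x)"
  define U where "U = (\<lambda>(q, x). u q x)"
  have pos: "0 < \<rho> q x" if "q \<in> \<Omega>" for q x using wave[OF that] by (simp add: eulerian_wave_def)
  have Rpos: "0 < R z" if "z \<in> \<Omega> \<times> UNIV" for z using that pos by (auto simp: R_def)
  have dR: "(R has_derivative D0 z) (at z)" and dS: "(S has_derivative D1 z) (at z)"
    and dU: "(U has_derivative D2 z) (at z)" if "z \<in> \<Omega> \<times> UNIV" for z
    using r(1)[OF that] r1(1)[OF that] D2(1)[OF that] by (simp_all add: R_def S_def U_def)
  define g where "g z = E (R z) (S z) + R z * (U z)\<^sup>2 / 2 - fst z $ 4 * R z * U z + fst z $ 2 * R z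
     - fst z $ 3 * U z + fst z $ 1" for z
  define D where "D z h = (F1 (R z) + K1 (R z) * (S z)\<^sup>2 / 2 + (U z)\<^sup>2 / 2 - fst z $ 4 * U z + fst z $ 2) * D0 z h
     + K (R z) * S z * D1 z h + (R z * U z - fst z $ 4 * R z - fst z $ 3) * D2 z h
     + (fst h $ 1 + fst h $ 2 * R z - fst h $ 3 * U z - fst h $ 4 * (R z * U z))" for z h
  have nth: "((\<lambda>z::(real^4) \<times> real. fst z $ i) has_derivative (\<lambda>h. fst h $ i)) (at z)" for i z
    by (intro bounded_linear.has_derivative[OF bounded_linear_vec_nth] has_derivative_fst has_derivative_ident)
  have dg: "(g has_derivative D z) (at z)" if z: "z \<in> \<Omega> \<times> UNIV" for z
  proof -
    have FR: "((\<lambda>z. F (R z)) has_derivative (\<lambda>h. D0 z h * F1 (R z))) (at z)"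
      by (rule DERIV_compose_FDERIV[OF F(1)[OF Rpos[OF z]] dR[OF z]])
    have KR: "((\<lambda>z. K (R z)) has_derivative (\<lambda>h. D0 z h * K1 (R z))) (at z)"
      by (rule DERIV_compose_FDERIV[OF K(1)[OF Rpos[OF z]] dR[OF z]])
    have "((\<lambda>z. F (R z) + 1 / 2 * (K (R z) * (S z * S z)) + 1 / 2 * (R z * (U z * U z)) - fst z $ 4 * R z * U z
       + fst z $ 2 * R z - fst z $ 3 * U z + fst z $ 1) has_derivative D z) (at z)"
      by (rule has_derivative_eq_rhs, (rule has_derivative_add has_derivative_diff has_derivative_mult_right
            has_derivative_mult FR KR dR[OF z] dS[OF z] dU[OF z] nth)+)
        (simp add: D_def fun_eq_iff field_simps power2_eq_square)
    then show ?thesis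
    proof (rule has_derivative_transform_within_open[where s = "\<Omega> \<times> UNIV"])
      show "open (\<Omega> \<times> (UNIV::real set))" by (intro open_Times \<Omega> open_UNIV)
      show "F (R z) + 1 / 2 * (K (R z) * (S z * S z)) + 1 / 2 * (R z * (U z * U z)) - fst z $ 4 * R z * U z
         + fst z $ 2 * R z - fst z $ 3 * U z + fst z $ 1 = g z" if "z \<in> \<Omega> \<times> UNIV" for z
        using E[OF Rpos[OF that]] by (simp add: g_def power2_eq_square)
    qed (rule z)
  qed
  have cR: "continuous_on (\<Omega> \<times> UNIV) R" and cS: "continuous_on (\<Omega> \<times> UNIV) S" and cU: "continuous_on (\<Omega> \<times> UNIV) U"
    by (rule has_derivative_continuous_on[OF has_derivative_at_withinI[OF dR]]
        has_derivative_continuous_on[OF has_derivative_at_withinI[OF dS]]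
        has_derivative_continuous_on[OF has_derivative_at_withinI[OF dU]], assumption)+
  have comp: "continuous_on (\<Omega> \<times> UNIV) (\<lambda>z. f (R z))"
    if "\<And>s. 0 < s \<Longrightarrow> (f has_real_derivative f1 s) (at s)" for f f1
  proof -
    have "continuous_on {0<..} f"
      using that by (auto intro!: DERIV_continuous_on[OF has_field_derivative_at_within])
    then show ?thesis by (rule continuous_on_compose2[OF _ cR]) (use Rpos in auto)
  qed
  have cD: "continuous_on (\<Omega> \<times> UNIV) (\<lambda>z. D z h)" for h
    unfolding D_def by (intro continuous_intros comp[OF F(2)] comp[OF K(1)] comp[OF K(2)] cR cS cU r(2) r1(2) D2(2))
      simp_all
  have act: "action E \<rho> u \<Xi> = (\<lambda>q. integral {0..\<Xi> q} (\<lambda>x. g (q, x)))"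
    by (simp add: fun_eq_iff action_def g_def R_def S_def U_def)
  have L: "(action E \<rho> u \<Xi> has_derivative
      (\<lambda>h. \<Xi>' p h * g (p, \<Xi> p) + integral {0..\<Xi> p} (\<lambda>x. D (p, x) (h, 0)))) (at p)"
    unfolding act by (rule leibniz_rule_variable[OF \<Omega> p dg cD T \<Xi>])
  have weq: "Euler_op E (\<rho> p) x + (u p x)\<^sup>2 / 2 - p $ 4 * u p x = - p $ 2"
    "\<rho> p x * u p x - p $ 4 * \<rho> p x = p $ 3"
    "Legendre_op E (\<rho> p) x - \<rho> p x * (u p x)\<^sup>2 / 2 + p $ 4 * \<rho> p x * u p x - p $ 2 * \<rho> p x + p $ 3 * u p x = p $ 1" for x
    using wave[OF p] by (auto simp: eulerian_wave_def)
  have "C2_on UNIV (\<rho> p)" using wave[OF p] by (simp add: eulerian_wave_def)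
  then obtain q2 where q2: "\<And>x. (deriv (\<rho> p) has_real_derivative q2 x) (at x)" using C2_on_UNIV_E by blast
  note q = dr[OF p] q2 pos[OF p]
  have "\<Xi>' p h * g (p, \<Xi> p) + integral {0..\<Xi> p} (\<lambda>x. D (p, x) (h, 0))
      = (\<Sum>k\<in>UNIV. integral {0..\<Xi> p} (\<lambda>x. action_density \<rho> u k (p, x)) * h $ k)" for h
  proof -
    let ?K = "\<lambda>x. K (\<rho> p x) * deriv (\<rho> p) x"
    \<comment> \<open>Eliminating \<mu> by the third profile equation leaves \<open>E\<close> plus
      its Legendre expression, that is \<open>K\<close> times the squared slope.\<close>
    have gT: "g (p, x) = ?K x * deriv (\<rho> p) x" for x
      using weq(3)[of x] along_deriv(4)[OF q, of x] E[OF pos[OF p], of x]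
      by (simp add: g_def R_def S_def U_def power2_eq_square)
    define B where "B x = ?K x * D0 (p, x) (h, 0)" for x
    define B1 where "B1 x = (K1 (\<rho> p x) * (deriv (\<rho> p) x)\<^sup>2 + K (\<rho> p x) * q2 x) * D0 (p, x) (h, 0)
        + D1 (p, x) (h, 0) * ?K x" for x
    have dB: "(B has_real_derivative B1 x) (at x)" for x
      unfolding B_def B1_def by (intro DERIV_mult along_deriv(2)[OF q] D0_commute[OF p])
    \<comment> \<open>The Euler equation turns the variation of \<rho> into the total derivative
      \<open>B1\<close>, and the second profile equation annihilates the coefficient of the
      variation of \<open>u\<close>.\<close>
    have DB: "D (p, x) (h, 0) = B1 x + (\<Sum>k\<in>UNIV. action_density \<rho> u k (p, x) * h $ k)" for x
    proof -
      have "F1 (\<rho> p x) + K1 (\<rho> p x) * (deriv (\<rho> p) x)\<^sup>2 / 2 + (u p x)\<^sup>2 / 2 - p $ 4 * u p x + p $ 2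
          = K1 (\<rho> p x) * (deriv (\<rho> p) x)\<^sup>2 + K (\<rho> p x) * q2 x"
        using weq(1)[of x] along_deriv(3)[OF q, of x] by (simp add: field_simps)
      moreover have "\<rho> p x * u p x - p $ 4 * \<rho> p x - p $ 3 = 0" using weq(2)[of x] by simp
      ultimately show ?thesis
        by (simp add: D_def B1_def R_def S_def U_def action_density_def sum_4 algebra_simps)
    qed
    have iB: "(B1 has_integral B (\<Xi> p) - B 0) {0..\<Xi> p}"
      by (rule fundamental_theorem_of_calculus)
        (use \<Xi>(2)[OF p] dB in \<open>auto simp: has_real_derivative_iff_has_vector_derivative[symmetric]
          intro: has_field_derivative_at_within\<close>)
    \<comment> \<open>Only the shift of \<open>D0\<close> over one period survives in the boundary
      term; by \<open>gT\<close> it is the opposite of the variation of the endpoint.\<close>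
    have B: "B (\<Xi> p) - B 0 = - \<Xi>' p h * g (p, \<Xi> p)"
    proof -
      have "\<rho> p (0 + \<Xi> p) = \<rho> p 0" "deriv (\<rho> p) (0 + \<Xi> p) = deriv (\<rho> p) 0"
        using per[OF p] r1_per[OF p] unfolding is_period_def by blast+
      then have eq: "\<rho> p (\<Xi> p) = \<rho> p 0" "deriv (\<rho> p) (\<Xi> p) = deriv (\<rho> p) 0" by simp_all
      have D0: "D0 (p, \<Xi> p) (h, 0) = D0 (p, 0) (h, 0) - \<Xi>' p h * deriv (\<rho> p) 0"
        using D0_shift[OF p, of 0 h] by simp
      show ?thesis unfolding B_def gT eq D0 right_diff_distrib by simp
    qed
    have iS: "((\<lambda>x. \<Sum>k\<in>UNIV. action_density \<rho> u k (p, x) * h $ k) has_integral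
        (\<Sum>k\<in>UNIV. integral {0..\<Xi> p} (\<lambda>x. action_density \<rho> u k (p, x)) * h $ k)) {0..\<Xi> p}"
    proof (intro has_integral_sum has_integral_mult_left integrable_integral integrable_continuous_interval)
      fix k :: 4
      have pair: "continuous_on S (\<lambda>x. (p, x))" "(\<lambda>x. (p, x)) ` S \<subseteq> \<Omega> \<times> UNIV" for S :: "real set"
        using p by (auto intro!: continuous_on_Pair continuous_on_const continuous_on_id)
      have cRp: "continuous_on S (\<lambda>x. \<rho> p x)" and cUp: "continuous_on S (\<lambda>x. u p x)" for S
        using continuous_on_compose2[OF cR pair] continuous_on_compose2[OF cU pair] by (simp_all add: R_def U_def)
      show "continuous_on {0..\<Xi> p} (\<lambda>x. action_density \<rho> u k (p, x))"
        unfolding action_density_def prod.case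
        by (cases "k = 1"; cases "k = 2"; cases "k = 3") (auto intro!: continuous_intros cRp cUp)
    qed simp
    have "((\<lambda>x. D (p, x) (h, 0)) has_integral - \<Xi>' p h * g (p, \<Xi> p)
        + (\<Sum>k\<in>UNIV. integral {0..\<Xi> p} (\<lambda>x. action_density \<rho> u k (p, x)) * h $ k)) {0..\<Xi> p}"
      using has_integral_add[OF iB iS] unfolding DB B .
    then show ?thesis by (simp add: integral_unique)
  qed
  then show ?thesis using L by simp
qed

end

text \<open>The gradient components of the action are integrals of C1 densities over a C1 period, so
  the action is differentiated twice without second derivatives of the profiles.\<close>

lemma density_integral_differentiable:
  fixes \<Omega> :: "(real^4) set"
  assumes \<Omega>: "open \<Omega>" "p \<in> \<Omega>"
    and D0: "\<And>s. s \<in> \<Omega> \<times> UNIV \<Longrightarrow> ((\<lambda>(q, x). \<rho> q x) has_derivative D0 s) (at s)"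
      "\<And>h. continuous_on (\<Omega> \<times> UNIV) (\<lambda>s. D0 s h)"
    and D2: "\<And>s. s \<in> \<Omega> \<times> UNIV \<Longrightarrow> ((\<lambda>(q, x). u q x) has_derivative D2 s) (at s)"
      "\<And>h. continuous_on (\<Omega> \<times> UNIV) (\<lambda>s. D2 s h)"
    and T: "\<And>q. q \<in> \<Omega> \<Longrightarrow> (T has_derivative T' q) (at q)" "\<And>h. continuous_on \<Omega> (\<lambda>q. T' q h)"
      "\<And>q. q \<in> \<Omega> \<Longrightarrow> 0 < T q"
  obtains G' where "((\<lambda>q. integral {0..T q} (\<lambda>x. action_density \<rho> u k (q, x))) has_derivative G') (at p)"
proof -
  let ?R = "\<lambda>(q, x). \<rho> q x" and ?U = "\<lambda>(q, x). u q x"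
  define D where "D z h = (if k = 1 then 0 else if k = 2 then D0 z h else if k = 3 then - D2 z h
      else - (?R z * D2 z h + D0 z h * ?U z))" for z h
  have "(action_density \<rho> u k has_derivative D z) (at z)" if z: "z \<in> \<Omega> \<times> UNIV" for z
  proof -
    have eq: "action_density \<rho> u k = (\<lambda>z. if k = 1 then 1 else if k = 2 then ?R z
        else if k = 3 then - ?U z else - (?R z * ?U z))"
      by (auto simp: action_density_def fun_eq_iff)
    have "((\<lambda>z. - ?U z) has_derivative (\<lambda>h. - D2 z h)) (at z)"
      "((\<lambda>z. - (?R z * ?U z)) has_derivative (\<lambda>h. - (?R z * D2 z h + D0 z h * ?U z))) (at z)"
      by (intro has_derivative_minus has_derivative_mult D0(1)[OF z] D2(1)[OF z])+
    then show ?thesis unfolding eq D_def using D0(1)[OF z] by (cases "k = 1"; cases "k = 2"; cases "k = 3") auto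
  qed
  moreover have "continuous_on (\<Omega> \<times> UNIV) (\<lambda>z. D z h)" for h
  proof -
    have cR: "continuous_on (\<Omega> \<times> UNIV) ?R" and cU: "continuous_on (\<Omega> \<times> UNIV) ?U"
      by (rule has_derivative_continuous_on[OF has_derivative_at_withinI[OF D0(1)]]
          has_derivative_continuous_on[OF has_derivative_at_withinI[OF D2(1)]], assumption)+
    have "continuous_on (\<Omega> \<times> UNIV) (\<lambda>z. - (?R z * D2 z h + D0 z h * ?U z))"
      by (intro continuous_intros cR cU D0(2) D2(2))
    then show ?thesis unfolding D_def using D0(2)[of h] continuous_on_minus[OF D2(2)[of h]]
      by (cases "k = 1"; cases "k = 2"; cases "k = 3") auto
  qed
  ultimately show ?thesis using leibniz_rule_variable[OF \<Omega> _ _ T, of "action_density \<rho> u k" D] that by blast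
qed

section \<open>The signature identity\<close>

text \<open>With \<open>\<beta> = j / \<rho>\<close> and \<open>\<gamma> = \<rho>\<close> the Schur
  complement subtracts \<open>j^2 / \<rho>^3\<close>, precisely the contribution of the eliminated
  velocity to the second derivative of \<open>P\<close>.\<close>

lemma eulerian_signature:
  fixes \<Omega> :: "(real^4) set"
  assumes f: "C2_on {0<..} f" and \<kappa>: "C2_on {0<..} \<kappa>" "\<And>s. 0 < s \<Longrightarrow> 0 < \<kappa> s"
    and fam: "family \<Omega> \<rho> (\<lambda>q. deriv (\<rho> q)) \<Xi> D0 D1 \<Xi>'" and p: "p \<in> \<Omega>"
    and wave: "\<And>q. q \<in> \<Omega> \<Longrightarrow> eulerian_wave (euler_energy f \<kappa>) (q $ 1) (q $ 2) (q $ 3) (q $ 4) (\<rho> q) (u q) (\<Xi> q)"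
    and \<tau>: "\<Xi>' p (axis 1 1) \<noteq> 0"
  shows "neg_signature_operator (\<Xi> p) (op_domain (\<Xi> p)) (A_E (euler_energy f \<kappa>) (\<Xi> p) (\<rho> p) (p $ 3))
    = ereal (if \<Xi>' p (axis 1 1) < 0 then 2 else 1)"
proof -
  define E where "E = euler_energy f \<kappa>"
  obtain F1 F2 K1 K2 where "energy E (\<lambda>s. s * f (1 / s)) F1 F2 (\<lambda>s. \<kappa> (1 / s) / s ^ 5) K1 K2"
    using energy_euler[OF f \<kappa>] unfolding E_def by blast
  then interpret energy E "\<lambda>s. s * f (1 / s)" F1 F2 "\<lambda>s. \<kappa> (1 / s) / s ^ 5" K1 K2 .
  interpret family \<Omega> \<rho> "\<lambda>q. deriv (\<rho> q)" \<Xi> D0 D1 \<Xi>' by (rule fam)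
  have pos: "0 < \<rho> q x" if "q \<in> \<Omega>" for q x using wave[OF that] by (simp add: eulerian_wave_def)
  have C2: "C2_on UNIV (\<rho> q)" if "q \<in> \<Omega>" for q using wave[OF that] by (simp add: eulerian_wave_def)
  have weq: "Euler_op E (\<rho> q) x + (u q x)\<^sup>2 / 2 - q $ 4 * u q x = - q $ 2"
    "u q x = q $ 4 + q $ 3 / \<rho> q x"
    "Legendre_op E (\<rho> q) x - \<rho> q x * (u q x)\<^sup>2 / 2 + q $ 4 * \<rho> q x * u q x - q $ 2 * \<rho> q x + q $ 3 * u q x = q $ 1"
    if q: "q \<in> \<Omega>" for q x
  proof -
    have "\<rho> q x * u q x - q $ 4 * \<rho> q x = q $ 3" using wave[OF q] by (simp add: eulerian_wave_def)
    then show "u q x = q $ 4 + q $ 3 / \<rho> q x" using pos[OF q, of x] by (simp add: field_simps)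
  qed (use wave[OF q] in \<open>unfold eulerian_wave_def E_def, blast+\<close>)
  obtain q2 where q2: "\<And>x. (deriv (\<rho> p) has_real_derivative q2 x) (at x)" by (rule C2_on_UNIV_E[OF C2[OF p]]) (rule that)
  define l j \<sigma> where "l = p $ 2" and "j = p $ 3" and "\<sigma> = p $ 4"
  \<comment> \<open>the effective potential left after eliminating \<open>u = \<sigma> + j / \<rho>\<close> from the profile equations\<close>
  define P where "P s = s * f (1 / s) - \<sigma>\<^sup>2 * s / 2 - j\<^sup>2 / (2 * s) - j * \<sigma> + l * s" for s
  have "neg_signature_operator (\<Xi> p) (op_domain (\<Xi> p))
      (\<lambda>U x. (Hess_op (\<Xi> p) E (\<rho> p) (\<lambda>s. fst (U s)) x + j / \<rho> p x * snd (U x),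
        j / \<rho> p x * fst (U x) + \<rho> p x * snd (U x)))
    = ereal (if \<Xi>' p (axis 1 1) < 0 then 2 else 1)"
  proof (rule family_signature[OF fam p q2 pos _ _ _ _ _ _ _ _ _ _ _ _ \<tau>, where P = P
        and ?P1.0 = "\<lambda>s. F1 s - \<sigma>\<^sup>2 / 2 + j\<^sup>2 / (2 * s\<^sup>2) + l" and ?P2.0 = "\<lambda>s. F2 s - j\<^sup>2 / s ^ 3"])
    have fp: "fundamental_period (\<Xi> p) (\<lambda>x. (\<rho> p x, u p x))" using wave[OF p] by (simp add: eulerian_wave_def)
    \<comment> \<open>The velocity is a function of \<rho>, so the pair and \<rho> alone have the
      same periods.\<close>
    show "fundamental_period (\<Xi> p) (\<rho> p)"
      using fp weq(2)[OF p] unfolding fundamental_period_def is_period_def by auto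
    show "(P has_real_derivative F1 s - \<sigma>\<^sup>2 / 2 + j\<^sup>2 / (2 * s\<^sup>2) + l) (at s)" if "0 < s" for s
    proof -
      have "((\<lambda>s. l * s - j * \<sigma> - \<sigma>\<^sup>2 * s / 2 - j\<^sup>2 / (2 * s)) has_real_derivative
          l - \<sigma>\<^sup>2 / 2 + j\<^sup>2 / (2 * s\<^sup>2)) (at s)"
        using that by (auto intro!: derivative_eq_intros simp: field_simps power2_eq_square)
      from DERIV_add[OF F(1)[OF that] this]
      show ?thesis by (simp add: P_def[abs_def] algebra_simps)
    qed
    show "((\<lambda>s. F1 s - \<sigma>\<^sup>2 / 2 + j\<^sup>2 / (2 * s\<^sup>2) + l) has_real_derivative F2 s - j\<^sup>2 / s ^ 3) (at s)" if "0 < s" for s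
      using that by (auto intro!: derivative_eq_intros F(2) simp: field_simps eval_nat_numeral)
    show "continuous_on {0<..} (\<lambda>s. F2 s - j\<^sup>2 / s ^ 3)"
      by (intro continuous_intros F(3)) auto
    show "\<kappa> (1 / \<rho> (p + t *\<^sub>R axis 1 1) x) / \<rho> (p + t *\<^sub>R axis 1 1) x ^ 5 * (deriv (\<rho> (p + t *\<^sub>R axis 1 1)) x)\<^sup>2 / 2
        - P (\<rho> (p + t *\<^sub>R axis 1 1) x) = p $ 1 + t" if q: "p + t *\<^sub>R axis 1 1 \<in> \<Omega>" for t x
    proof -
      let ?q = "p + t *\<^sub>R axis 1 (1::real)"
      have co: "?q $ 1 = p $ 1 + t" "?q $ 2 = l" "?q $ 3 = j" "?q $ 4 = \<sigma>"
        by (simp_all add: axis_def l_def j_def \<sigma>_def)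
      obtain q2 where q2: "\<And>x. (deriv (\<rho> ?q) has_real_derivative q2 x) (at x)" by (rule C2_on_UNIV_E[OF C2[OF q]]) (rule that)
      have "- (\<rho> ?q x * (u ?q x)\<^sup>2 / 2) + \<sigma> * \<rho> ?q x * u ?q x + j * u ?q x
          = \<sigma>\<^sup>2 * \<rho> ?q x / 2 + j\<^sup>2 / (2 * \<rho> ?q x) + j * \<sigma>"
        using pos[OF q, of x] unfolding weq(2)[OF q] co by (simp add: field_simps power2_eq_square)
      then show ?thesis
        using weq(3)[OF q, of x] along_deriv(4)[OF dr[OF q] q2 pos[OF q], of x] unfolding co P_def by simp
    qed
    show "Euler_op E (\<rho> p) x = F1 (\<rho> p x) - (F1 (\<rho> p x) - \<sigma>\<^sup>2 / 2 + j\<^sup>2 / (2 * (\<rho> p x)\<^sup>2) + l)" for x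
    proof -
      have "(u p x)\<^sup>2 / 2 - \<sigma> * u p x = j\<^sup>2 / (2 * (\<rho> p x)\<^sup>2) - \<sigma>\<^sup>2 / 2"
        using pos[OF p, of x] unfolding weq(2)[OF p] j_def[symmetric] \<sigma>_def[symmetric]
        by (simp add: field_simps power2_eq_square)
      then show ?thesis using weq(1)[OF p, of x] unfolding l_def \<sigma>_def by simp
    qed
    have c\<rho>: "continuous_on UNIV (\<rho> p)" by (rule DERIV_continuous_on[OF dr[OF p]])
    show "continuous_on UNIV (\<lambda>x. j / \<rho> p x)"
      using pos[OF p] by (intro continuous_intros c\<rho>) (simp add: less_imp_neq[symmetric])
    show "is_period (\<Xi> p) (\<lambda>x. j / \<rho> p x)" using per[OF p] by (simp add: is_period_def)
    show "continuous_on UNIV (\<rho> p)" "is_period (\<Xi> p) (\<rho> p)" "0 < \<rho> p x" for x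
      using c\<rho> per[OF p] pos[OF p] by auto
    show "F2 (\<rho> p x) - j\<^sup>2 / \<rho> p x ^ 3 = F2 (\<rho> p x) - (j / \<rho> p x)\<^sup>2 / \<rho> p x" for x
      by (simp add: power_divide eval_nat_numeral mult.assoc)
  qed
  moreover have "A_E E (\<Xi> p) (\<rho> p) j = (\<lambda>U x. (Hess_op (\<Xi> p) E (\<rho> p) (\<lambda>s. fst (U s)) x + j / \<rho> p x * snd (U x),
        j / \<rho> p x * fst (U x) + \<rho> p x * snd (U x)))"
    by (simp add: fun_eq_iff A_E_def)
  ultimately show ?thesis unfolding E_def j_def by simp
qed

text \<open>In mass coordinates \<lambda> is the energy level and \<mu> a coefficient of the
  potential, so the second axis replaces the first. The Schur complement subtracts the constant
  \<open>j^2\<close>.\<close>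

lemma lagrangian_signature:
  fixes \<Omega> :: "(real^4) set"
  assumes f: "C2_on {0<..} f" and \<kappa>: "C2_on {0<..} \<kappa>" "\<And>s. 0 < s \<Longrightarrow> 0 < \<kappa> s"
    and fam: "family \<Omega> v (\<lambda>q. deriv (v q)) \<Upsilon> D0 D1 \<Upsilon>'" and p: "p \<in> \<Omega>"
    and wave: "\<And>q. q \<in> \<Omega> \<Longrightarrow> lagrangian_wave (lagr_energy f \<kappa>) (q $ 1) (q $ 2) (q $ 3) (q $ 4) (v q) (w q) (\<Upsilon> q)"
    and \<tau>: "\<Upsilon>' p (axis 2 1) \<noteq> 0"
  shows "neg_signature_operator (\<Upsilon> p) (op_domain (\<Upsilon> p)) (A_L (lagr_energy f \<kappa>) (\<Upsilon> p) (v p) (p $ 3))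
    = ereal (if \<Upsilon>' p (axis 2 1) < 0 then 2 else 1)"
proof -
  define e where "e = lagr_energy f \<kappa>"
  obtain F1 F2 K1 K2 where "energy e f F1 F2 \<kappa> K1 K2"
    using energy_lagr[OF f \<kappa>] unfolding e_def by blast
  then interpret energy e f F1 F2 \<kappa> K1 K2 .
  interpret family \<Omega> v "\<lambda>q. deriv (v q)" \<Upsilon> D0 D1 \<Upsilon>' by (rule fam)
  have pos: "0 < v q x" if "q \<in> \<Omega>" for q x using wave[OF that] by (simp add: lagrangian_wave_def)
  have C2: "C2_on UNIV (v q)" if "q \<in> \<Omega>" for q using wave[OF that] by (simp add: lagrangian_wave_def)
  have weq: "Euler_op e (v q) x - q $ 3 * w q x = - q $ 1" "w q x = q $ 3 * v q x + q $ 4"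
    "Legendre_op e (v q) x - (w q x)\<^sup>2 / 2 + q $ 3 * v q x * w q x - q $ 1 * v q x + q $ 4 * w q x = q $ 2"
    if q: "q \<in> \<Omega>" for q x
  proof -
    have "w q x - q $ 3 * v q x = q $ 4" using wave[OF q] unfolding lagrangian_wave_def by blast
    then show "w q x = q $ 3 * v q x + q $ 4" by simp
  qed (use wave[OF q] in \<open>unfold lagrangian_wave_def e_def, blast+\<close>)
  obtain q2 where q2: "\<And>x. (deriv (v p) has_real_derivative q2 x) (at x)" by (rule C2_on_UNIV_E[OF C2[OF p]]) (rule that)
  define \<mu> j \<sigma> where "\<mu> = p $ 1" and "j = p $ 3" and "\<sigma> = p $ 4"
  \<comment> \<open>The effective potential after the substitution
    \<open>w = j * v + \<sigma>\<close>.\<close>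
  define P where "P s = f s - (j * s + \<sigma>)\<^sup>2 / 2 + \<mu> * s" for s
  have "neg_signature_operator (\<Upsilon> p) (op_domain (\<Upsilon> p))
      (\<lambda>U x. (Hess_op (\<Upsilon> p) e (v p) (\<lambda>s. fst (U s)) x + - j * snd (U x),
        - j * fst (U x) + 1 * snd (U x)))
    = ereal (if \<Upsilon>' p (axis 2 1) < 0 then 2 else 1)"
  proof (rule family_signature[OF fam p q2 pos _ _ _ _ _ _ _ _ _ _ _ _ \<tau>, where P = P
        and ?P1.0 = "\<lambda>s. F1 s - j * (j * s + \<sigma>) + \<mu>" and ?P2.0 = "\<lambda>s. F2 s - j\<^sup>2"])
    have fp: "fundamental_period (\<Upsilon> p) (\<lambda>x. (v p x, w p x))" using wave[OF p] by (simp add: lagrangian_wave_def)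
    show "fundamental_period (\<Upsilon> p) (v p)"
      using fp weq(2)[OF p] unfolding fundamental_period_def is_period_def by auto
    show "(P has_real_derivative F1 s - j * (j * s + \<sigma>) + \<mu>) (at s)" if "0 < s" for s
      unfolding P_def using that
      by (auto intro!: derivative_eq_intros F(1) simp: field_simps power2_eq_square)
    show "((\<lambda>s. F1 s - j * (j * s + \<sigma>) + \<mu>) has_real_derivative F2 s - j\<^sup>2) (at s)" if "0 < s" for s
      using that by (auto intro!: derivative_eq_intros F(2) simp: power2_eq_square)
    show "continuous_on {0<..} (\<lambda>s. F2 s - j\<^sup>2)"
      by (intro continuous_intros F(3))
    show "\<kappa> (v (p + t *\<^sub>R axis 2 1) x) * (deriv (v (p + t *\<^sub>R axis 2 1)) x)\<^sup>2 / 2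
        - P (v (p + t *\<^sub>R axis 2 1) x) = p $ 2 + t" if q: "p + t *\<^sub>R axis 2 1 \<in> \<Omega>" for t x
    proof -
      let ?q = "p + t *\<^sub>R axis 2 (1::real)"
      have co: "?q $ 1 = \<mu>" "?q $ 2 = p $ 2 + t" "?q $ 3 = j" "?q $ 4 = \<sigma>"
        by (simp_all add: axis_def \<mu>_def j_def \<sigma>_def)
      obtain q2 where q2: "\<And>x. (deriv (v ?q) has_real_derivative q2 x) (at x)" by (rule C2_on_UNIV_E[OF C2[OF q]]) (rule that)
      have "- ((w ?q x)\<^sup>2 / 2) + j * v ?q x * w ?q x + \<sigma> * w ?q x = (j * v ?q x + \<sigma>)\<^sup>2 / 2"
        unfolding weq(2)[OF q] co by (simp add: field_simps power2_eq_square)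
      then show ?thesis
        using weq(3)[OF q, of x] along_deriv(4)[OF dr[OF q] q2 pos[OF q], of x] unfolding co P_def by simp
    qed
    show "Euler_op e (v p) x = F1 (v p x) - (F1 (v p x) - j * (j * v p x + \<sigma>) + \<mu>)" for x
      using weq(1)[OF p, of x] unfolding weq(2)[OF p] \<mu>_def j_def \<sigma>_def by simp
    show "is_period (\<Upsilon> p) (\<lambda>x. - j)" "is_period (\<Upsilon> p) (\<lambda>x. 1::real)" by (simp_all add: is_period_def)
  qed auto
  moreover have "A_L e (\<Upsilon> p) (v p) j = (\<lambda>U x. (Hess_op (\<Upsilon> p) e (v p) (\<lambda>s. fst (U s)) x + - j * snd (U x),
        - j * fst (U x) + 1 * snd (U x)))"
    by (simp add: fun_eq_iff A_L_def)
  ultimately show ?thesis unfolding e_def j_def by simp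
qed

theorem theorem7:
  fixes f \<kappa> :: "real \<Rightarrow> real"
    and \<Omega> :: "(real^4) set"
    and \<rho> u v w :: "real^4 \<Rightarrow> real \<Rightarrow> real"
    and \<Xi> \<Upsilon> :: "real^4 \<Rightarrow> real"
    and p :: "real^4"
  defines "e \<equiv> lagr_energy f \<kappa>"
    and "E \<equiv> euler_energy f \<kappa>"
  defines "\<Theta> \<equiv> action E \<rho> u \<Xi>"
  assumes "C2_on {0<..} f" and "C2_on {0<..} \<kappa>" and "\<And>s. 0 < s \<Longrightarrow> 0 < \<kappa> s"
    and "open \<Omega>"
    and "\<And>q. q \<in> \<Omega> \<Longrightarrow> eulerian_wave E (q $ 1) (q $ 2) (q $ 3) (q $ 4) (\<rho> q) (u q) (\<Xi> q)"
    and "\<And>q. q \<in> \<Omega> \<Longrightarrow> lagrangian_wave e (q $ 1) (q $ 2) (q $ 3) (q $ 4) (v q) (w q) (\<Upsilon> q)"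
    and "\<And>q. q \<in> \<Omega> \<Longrightarrow> corresponding (\<rho> q) (u q) (v q) (w q)"
    and "smooth_family \<Omega> \<rho> u \<Xi>" and "smooth_family \<Omega> v w \<Upsilon>"
    and "p \<in> \<Omega>"
    and "Hessian \<Theta> p $ 1 $ 1 \<noteq> 0" and "Hessian \<Theta> p $ 2 $ 2 \<noteq> 0"
    and "invertible (constraint_E (Hessian \<Theta> p))"
    and "invertible (constraint_L (Hessian \<Theta> p))"
  shows "neg_signature_matrix (Hessian \<Theta> p) - 2
           = neg_signature_operator (\<Xi> p) (op_domain (\<Xi> p)) (A_E E (\<Xi> p) (\<rho> p) (p $ 3))
             - neg_signature_matrix (constraint_E (Hessian \<Theta> p))
       \<and> neg_signature_operator (\<Xi> p) (op_domain (\<Xi> p)) (A_E E (\<Xi> p) (\<rho> p) (p $ 3))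
             - neg_signature_matrix (constraint_E (Hessian \<Theta> p))
           = neg_signature_operator (\<Upsilon> p) (op_domain (\<Upsilon> p)) (A_L e (\<Upsilon> p) (v p) (p $ 3))
             - neg_signature_matrix (constraint_L (Hessian \<Theta> p))"
proof -
  have f: "C2_on {0<..} f" and \<kappa>: "C2_on {0<..} \<kappa>" "\<And>s. 0 < s \<Longrightarrow> 0 < \<kappa> s"
    and \<Omega>: "open \<Omega>" and p: "p \<in> \<Omega>"
    and waveE: "\<And>q. q \<in> \<Omega> \<Longrightarrow> eulerian_wave E (q $ 1) (q $ 2) (q $ 3) (q $ 4) (\<rho> q) (u q) (\<Xi> q)"
    and waveL: "\<And>q. q \<in> \<Omega> \<Longrightarrow> lagrangian_wave e (q $ 1) (q $ 2) (q $ 3) (q $ 4) (v q) (w q) (\<Upsilon> q)"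
    and corr: "\<And>q. q \<in> \<Omega> \<Longrightarrow> corresponding (\<rho> q) (u q) (v q) (w q)"
    and H0: "Hessian \<Theta> p $ 1 $ 1 \<noteq> 0" "Hessian \<Theta> p $ 2 $ 2 \<noteq> 0"
    and inv: "invertible (constraint_E (Hessian \<Theta> p))" "invertible (constraint_L (Hessian \<Theta> p))"
    by fact+
  obtain D0 D1 D2 \<Xi>' where D:
    "\<And>s. s \<in> \<Omega> \<times> UNIV \<Longrightarrow> ((\<lambda>(q, x). \<rho> q x) has_derivative D0 s) (at s)" "\<And>h. continuous_on (\<Omega> \<times> UNIV) (\<lambda>s. D0 s h)"
    "\<And>s. s \<in> \<Omega> \<times> UNIV \<Longrightarrow> ((\<lambda>(q, x). deriv (\<rho> q) x) has_derivative D1 s) (at s)" "\<And>h. continuous_on (\<Omega> \<times> UNIV) (\<lambda>s. D1 s h)"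
    "\<And>s. s \<in> \<Omega> \<times> UNIV \<Longrightarrow> ((\<lambda>(q, x). u q x) has_derivative D2 s) (at s)" "\<And>h. continuous_on (\<Omega> \<times> UNIV) (\<lambda>s. D2 s h)"
    "\<And>q. q \<in> \<Omega> \<Longrightarrow> (\<Xi> has_derivative \<Xi>' q) (at q)" "\<And>h. continuous_on \<Omega> (\<lambda>q. \<Xi>' q h)"
    by (rule smooth_familyE[OF \<open>smooth_family \<Omega> \<rho> u \<Xi>\<close>]) (rule that; assumption)
  obtain B0 B1 B2 \<Upsilon>' where B:
    "\<And>s. s \<in> \<Omega> \<times> UNIV \<Longrightarrow> ((\<lambda>(q, x). v q x) has_derivative B0 s) (at s)" "\<And>h. continuous_on (\<Omega> \<times> UNIV) (\<lambda>s. B0 s h)"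
    "\<And>s. s \<in> \<Omega> \<times> UNIV \<Longrightarrow> ((\<lambda>(q, x). deriv (v q) x) has_derivative B1 s) (at s)" "\<And>h. continuous_on (\<Omega> \<times> UNIV) (\<lambda>s. B1 s h)"
    "\<And>s. s \<in> \<Omega> \<times> UNIV \<Longrightarrow> ((\<lambda>(q, x). w q x) has_derivative B2 s) (at s)" "\<And>h. continuous_on (\<Omega> \<times> UNIV) (\<lambda>s. B2 s h)"
    "\<And>q. q \<in> \<Omega> \<Longrightarrow> (\<Upsilon> has_derivative \<Upsilon>' q) (at q)" "\<And>h. continuous_on \<Omega> (\<lambda>q. \<Upsilon>' q h)"
    by (rule smooth_familyE[OF \<open>smooth_family \<Omega> v w \<Upsilon>\<close>]) (rule that; assumption)
  have perE: "fundamental_period (\<Xi> q) (\<lambda>x. (\<rho> q x, u q x))" "0 < \<Xi> q" "is_period (\<Xi> q) (\<rho> q)"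
    and drE: "(\<rho> q has_real_derivative deriv (\<rho> q) x) (at x)" if "q \<in> \<Omega>" for q x
    using waveE[OF that] C2_on_UNIV_E[of "\<rho> q"]
    by (auto simp: eulerian_wave_def fundamental_period_def is_period_def)
  have perL: "fundamental_period (\<Upsilon> q) (\<lambda>x. (v q x, w q x))" "is_period (\<Upsilon> q) (v q)" "0 < v q x"
    and drL: "(v q has_real_derivative deriv (v q) x) (at x)" if "q \<in> \<Omega>" for q x
    using waveL[OF that] C2_on_UNIV_E[of "v q"]
    by (auto simp: lagrangian_wave_def fundamental_period_def is_period_def)
  have famE: "family \<Omega> \<rho> (\<lambda>q. deriv (\<rho> q)) \<Xi> D0 D1 \<Xi>'"
    by (unfold_locales) (fact \<Omega> D drE perE)+
  have famL: "family \<Omega> v (\<lambda>q. deriv (v q)) \<Upsilon> B0 B1 \<Upsilon>'"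
    by (unfold_locales) (fact \<Omega> B drL perL)+
  obtain F1 F2 K1 K2 where "energy E (\<lambda>s. s * f (1 / s)) F1 F2 (\<lambda>s. \<kappa> (1 / s) / s ^ 5) K1 K2"
    using energy_euler[OF f \<kappa>] unfolding E_def by blast
  then interpret energy E "\<lambda>s. s * f (1 / s)" F1 F2 "\<lambda>s. \<kappa> (1 / s) / s ^ 5" K1 K2 .
  define G where "G k q = integral {0..\<Xi> q} (\<lambda>x. action_density \<rho> u k (q, x))" for k q
  have grad: "(\<Theta> has_derivative (\<lambda>h. \<Sum>k\<in>UNIV. G k q * h $ k)) (at q)" if "q \<in> \<Omega>" for q
    unfolding \<Theta>_def G_def by (rule action_has_derivative[OF famE D(5,6,8) perE(2) waveE that])
  have "\<exists>G'. (G k has_derivative G') (at p)" for k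
    using density_integral_differentiable[OF \<Omega> p D(1,2,5,6,7,8) perE(2)] unfolding G_def[abs_def] by metis
  then obtain G' where G': "\<And>k. (G k has_derivative G' k) (at p)" by metis
  note H = Hessian_eq[OF \<Omega> p grad G']
  \<comment> \<open>The density of index 1 is the constant 1, so \<Theta>'s first partial is the
    period and its second derivative in \<mu> is the derivative of \<Xi>.\<close>
  have "(\<Xi> has_derivative G' 1) (at p)"
    by (rule has_derivative_transform_within_open[OF G' \<Omega> p])
      (use perE(2) in \<open>force simp: G_def action_density_def\<close>)
  then have "G' 1 = \<Xi>' p" using D(7)[OF p] by (rule has_derivative_unique)
  then have H1: "Hessian \<Theta> p $ 1 $ 1 = \<Xi>' p (axis 1 1)" by (simp add: H(1))
  \<comment> \<open>The correspondence of the two profiles enters here only: it identifies the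
    second partial of the Eulerian action with the Lagrangian period.\<close>
  have "integral {0..\<Xi> q} (\<rho> q) = \<Upsilon> q" if q: "q \<in> \<Omega>" for q
    by (rule corresponding_period[OF corr[OF q] DERIV_continuous_on[OF drL[OF q]] perL(3)[OF q]
          perE(1)[OF q] perL(1)[OF q], symmetric])
  then have "(\<Upsilon> has_derivative G' 2) (at p)"
    by (intro has_derivative_transform_within_open[OF G'[of 2] \<Omega> p]) (simp add: G_def action_density_def)
  then have "G' 2 = \<Upsilon>' p" using B(7)[OF p] by (rule has_derivative_unique)
  then have H2: "Hessian \<Theta> p $ 2 $ 2 = \<Upsilon>' p (axis 2 1)" by (simp add: H(1))
  \<comment> \<open>The same number is computed with two pivots, \<mu> and \<lambda>; the operators
    are never compared directly.\<close>
  have "neg_signature_matrix (Hessian \<Theta> p) - 2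
      = ereal (if \<Xi>' p (axis 1 1) < 0 then 2 else 1) - neg_signature_matrix (constraint_E (Hessian \<Theta> p))"
    unfolding constraint_E_def H1[symmetric]
    by (rule neg_signature_constraint_matrix[OF H(2) H0(1)])
      (use inv in \<open>simp_all add: constraint_E_def vector_3\<close>)
  moreover have "neg_signature_matrix (Hessian \<Theta> p) - 2
      = ereal (if \<Upsilon>' p (axis 2 1) < 0 then 2 else 1) - neg_signature_matrix (constraint_L (Hessian \<Theta> p))"
    unfolding constraint_L_def H2[symmetric]
    by (rule neg_signature_constraint_matrix[OF H(2) H0(2)])
      (use inv in \<open>simp_all add: constraint_L_def vector_3\<close>)
  moreover have "neg_signature_operator (\<Xi> p) (op_domain (\<Xi> p)) (A_E E (\<Xi> p) (\<rho> p) (p $ 3))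
      = ereal (if \<Xi>' p (axis 1 1) < 0 then 2 else 1)"
    unfolding E_def by (rule eulerian_signature[OF f \<kappa> famE p waveE[unfolded E_def]]) (use H0 H1 in simp_all)
  moreover have "neg_signature_operator (\<Upsilon> p) (op_domain (\<Upsilon> p)) (A_L e (\<Upsilon> p) (v p) (p $ 3))
      = ereal (if \<Upsilon>' p (axis 2 1) < 0 then 2 else 1)"
    unfolding e_def by (rule lagrangian_signature[OF f \<kappa> famL p waveL[unfolded e_def]]) (use H0 H2 in simp_all)
  ultimately show ?thesis by simp
qed

end
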